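(* Let $T>0$, let $\{B_t\}_{t\in[0,T]}$ be a one-dimensional Brownian motion on a filtered probability space $(\Omega,\mathcal F,\{\mathcal F_t\}_{t\in[0,T]},\mathbb P)$, let $h:[0,T]\times\mathbb R\to\mathbb R_+$ be a Hurst function with parameters $(h_*,h^* )$, and put $\sigma(t,s,x)=(t-s)^{h(t,x)-\frac12}$ for $0\le s<t\le T$, $x\in\mathbb R$. Let $g$ be a measurable, $\{\mathcal F_t\}$-adapted, $\mathbb R$-valued stochastic process satisfying the following condition for some $p\ge 2$: $$\sup_{t\in[0,T]}\int_0^t\big[k_1(t,s)+k_2(t,s)\big]\,\mathbb E\big[|g(s)|^p\big]\,ds<\infty ,$$ where $k_1,k_2\in\mathcal K_0$ are kernels such that for all $0\le s<t\le T$ and $x,y\in\mathbb R$ $$|\sigma(t,s,x)|^2\le k_1(t,s)(1+|x|^2),\qquad |\sigma(t,s,x)-\sigma(t,s,y)|^2\le k_2(t,s)|x-y|^2 .$$ Then there exists a unique measurable, $\{\mathcal F_t\}$-adapted, $\mathbb R$-valued process $X^h=\{X^h_t\}_{t\in[0,T]}$ satisfying for all $t\in[0,T]$ $$X_t^h=g(t)+\int_0^t (t-s)^{h(t,X_s^h)-\frac12}\,dB_s .$$ Furthermore, for this $p$ there is a constant $C_{T,p,k_1}>0$ such that for all $t\in[0,T]$ $$\mathbb E\big[|X_t^h|^p\big]\le C_{T,p,k_1}\Big(1+\mathbb E\big[|g(t)|^p\big]+\sup_{t\in[0,T]}\int_0^t (t-s)^{h_*-\frac12}\,\mathbb E\b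ig[|g(s)|^p\big]\,ds\Big).$$
   Context: Hurst function: $h:[0,T]\times\mathbb R\to\mathbb R_+$ is a Hurst function with parameters $(h_*,h^* )$, $h_*\le h^*$, if $h(t,x)\in[h_*,h^*]\subset(0,1)$ for all $(t,x)\in[0,T]\times\mathbb R$ and there is $C>0$ with $|h(t,x)-h(t,y)|\le C|x-y|$ and $|h(t,x)-h(t',x)|\le C|t-t'|$ for all $x,y\in\mathbb R$, $t,t'\in[0,T]$. Class $\mathcal K_0$: a (measurable) Volterra kernel $k:\{(t,s):0\le s<t\le T\}\to\mathbb R_+$ belongs to $\mathcal K_0$ if $t\mapsto\int_0^t k(t,s)\,ds\in L^\infty([0,T])$ and $\limsup_{\epsilon\downarrow0}\big\|\int_{\cdot}^{\cdot+\epsilon}k(\cdot+\epsilon,s)\,ds\big\|_{L^\infty}=0$, where the norm is over those $t\in[0,T]$ with $t+\epsilon\le T$. The integral is an Itô integral; the equation is understood to hold almost surely for each $t\in[0,T]$, and uniqueness is up to modification (two solutions agree a.s. at each $t$). The process $X^h$ is called a Self-Exciting Multifractional (SEM) process.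
   Formalization: The constant C may depend on h_* as well as on T, p and k_1 (a constant uniform in h_* is impossible in general), and is chosen for a fixed underlying set of sample points; uniformity over all sample spaces follows by embedding them in a disjoint union. *)

theory Defs
  imports "HOL-Probability.Probability"
begin

section \<open>Filtrations, processes and Brownian motion on a bounded time interval\<close>

text \<open>The time set is the real interval from 0 to T; values of a filtration, process or kernel at
  parameters outside their stated domain are irrelevant.  Filtrations are not assumed to be
  complete or right-continuous.\<close>

definition filtered_prob_space :: "'a measure \<Rightarrow> real \<Rightarrow> (real \<Rightarrow> 'a measure) \<Rightarrow> bool" where
  "filtered_prob_space M T F \<longleftrightarrow>
     prob_space M \<and>
     (\<forall>t\<in>{0..T}. subalgebra M (F t)) \<and>
     (\<forall>s\<in>{0..T}. \<forall>t\<in>{0..T}. s \<le> t \<longrightarrow> subalgebra (F t) (F s))"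

definition measurable_process :: "'a measure \<Rightarrow> real \<Rightarrow> (real \<Rightarrow> 'a \<Rightarrow> real) \<Rightarrow> bool" where
  "measurable_process M T X \<longleftrightarrow>
     (\<lambda>(t, \<omega>). X t \<omega>) \<in> borel_measurable (restrict_space borel {0..T} \<Otimes>\<^sub>M M)"

definition adapted_process :: "(real \<Rightarrow> 'a measure) \<Rightarrow> real \<Rightarrow> (real \<Rightarrow> 'a \<Rightarrow> real) \<Rightarrow> bool" where
  "adapted_process F T X \<longleftrightarrow> (\<forall>t\<in>{0..T}. X t \<in> borel_measurable (F t))"

definition brownian_motion ::
    "'a measure \<Rightarrow> real \<Rightarrow> (real \<Rightarrow> 'a measure) \<Rightarrow> (real \<Rightarrow> 'a \<Rightarrow> real) \<Rightarrow> bool" where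
  "brownian_motion M T F B \<longleftrightarrow>
     adapted_process F T B \<and>
     (AE \<omega> in M. B 0 \<omega> = 0) \<and>
     (AE \<omega> in M. continuous_on {0..T} (\<lambda>t. B t \<omega>)) \<and>
     (\<forall>s t. 0 \<le> s \<and> s < t \<and> t \<le> T \<longrightarrow>
        prob_space.indep_set M (sets (F s))
          {(\<lambda>\<omega>. B t \<omega> - B s \<omega>) -` A \<inter> space M | A. A \<in> sets borel} \<and>
        distributed M lborel (\<lambda>\<omega>. B t \<omega> - B s \<omega>) (normal_density 0 (sqrt (t - s))))"


section \<open>The Ito integral\<close>

text \<open>The data \<open>n\<close>, \<open>\<tau>\<close>, \<open>\<xi>\<close> encode the simple process
  \<open>\<Sum>i<n. \<xi>\<^sub>i 1\<^bsub>(\<tau>\<^sub>i, \<tau>\<^sub>i\<^sub>+\<^sub>1]\<^esub>\<close> with bounded, \<open>F(\<tau>\<^sub>i)\<close>-measurable coefficients.\<close>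

definition simple_data ::
    "'a measure \<Rightarrow> (real \<Rightarrow> 'a measure) \<Rightarrow> real \<Rightarrow> nat \<Rightarrow> (nat \<Rightarrow> real) \<Rightarrow> (nat \<Rightarrow> 'a \<Rightarrow> real) \<Rightarrow> bool" where
  "simple_data M F t n \<tau> \<xi> \<longleftrightarrow>
     (\<forall>i\<le>n. \<tau> i \<in> {0..t}) \<and>
     (\<forall>i<n. \<tau> i \<le> \<tau> (Suc i)) \<and>
     (\<forall>i<n. \<xi> i \<in> borel_measurable (F (\<tau> i)) \<and> (\<exists>K. \<forall>\<omega>\<in>space M. \<bar>\<xi> i \<omega>\<bar> \<le> K))"

definition simple_process ::
    "nat \<Rightarrow> (nat \<Rightarrow> real) \<Rightarrow> (nat \<Rightarrow> 'a \<Rightarrow> real) \<Rightarrow> real \<Rightarrow> 'a \<Rightarrow> real" where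
  "simple_process n \<tau> \<xi> s \<omega> = (\<Sum>i<n. \<xi> i \<omega> * indicator {\<tau> i<..\<tau> (Suc i)} s)"

definition simple_integral ::
    "(real \<Rightarrow> 'a \<Rightarrow> real) \<Rightarrow> nat \<Rightarrow> (nat \<Rightarrow> real) \<Rightarrow> (nat \<Rightarrow> 'a \<Rightarrow> real) \<Rightarrow> 'a \<Rightarrow> real" where
  "simple_integral B n \<tau> \<xi> \<omega> = (\<Sum>i<n. \<xi> i \<omega> * (B (\<tau> (Suc i)) \<omega> - B (\<tau> i) \<omega>))"

text \<open>The \<open>L\<^sup>2\<close> theory of the integral over the interval from 0 to t, for measurable adapted
  integrands that are square integrable with respect to \<open>ds \<otimes> dP\<close> (a consequence of the first
  limit below).  The value is determined up to almost sure equality.\<close>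

definition has_ito_integral ::
    "'a measure \<Rightarrow> (real \<Rightarrow> 'a measure) \<Rightarrow> (real \<Rightarrow> 'a \<Rightarrow> real) \<Rightarrow> real \<Rightarrow>
     (real \<Rightarrow> 'a \<Rightarrow> real) \<Rightarrow> ('a \<Rightarrow> real) \<Rightarrow> bool" where
  "has_ito_integral M F B t H I \<longleftrightarrow>
     measurable_process M t H \<and> adapted_process F t H \<and> I \<in> borel_measurable M \<and>
     (\<exists>n \<tau> \<xi>. (\<forall>k. simple_data M F t (n k) (\<tau> k) (\<xi> k)) \<and>
        (\<lambda>k. \<integral>\<^sup>+\<omega>. (\<integral>\<^sup>+s\<in>{0..t}.
             ennreal ((H s \<omega> - simple_process (n k) (\<tau> k) (\<xi> k) s \<omega>)\<^sup>2) \<partial>lborel) \<partial>M)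
          \<longlonglongrightarrow> 0 \<and>
        (\<lambda>k. \<integral>\<^sup>+\<omega>. ennreal ((I \<omega> - simple_integral B (n k) (\<tau> k) (\<xi> k) \<omega>)\<^sup>2) \<partial>M)
          \<longlonglongrightarrow> 0)"

definition ito_integrable ::
    "'a measure \<Rightarrow> (real \<Rightarrow> 'a measure) \<Rightarrow> (real \<Rightarrow> 'a \<Rightarrow> real) \<Rightarrow> real \<Rightarrow>
     (real \<Rightarrow> 'a \<Rightarrow> real) \<Rightarrow> bool" where
  "ito_integrable M F B t H \<longleftrightarrow> (\<exists>I. has_ito_integral M F B t H I)"

definition ito_integral ::
    "'a measure \<Rightarrow> (real \<Rightarrow> 'a measure) \<Rightarrow> (real \<Rightarrow> 'a \<Rightarrow> real) \<Rightarrow> real \<Rightarrow>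
     (real \<Rightarrow> 'a \<Rightarrow> real) \<Rightarrow> 'a \<Rightarrow> real" where
  "ito_integral M F B t H = (SOME I. has_ito_integral M F B t H I)"


section \<open>Hurst functions, Volterra kernels and SEM processes\<close>

definition hurst_function :: "real \<Rightarrow> real \<Rightarrow> real \<Rightarrow> (real \<Rightarrow> real \<Rightarrow> real) \<Rightarrow> bool" where
  "hurst_function T hl hu h \<longleftrightarrow>
     0 < hl \<and> hl \<le> hu \<and> hu < 1 \<and>
     (\<forall>t\<in>{0..T}. \<forall>x. h t x \<in> {hl..hu}) \<and>
     (\<exists>C>0. (\<forall>t\<in>{0..T}. \<forall>x y. \<bar>h t x - h t y\<bar> \<le> C * \<bar>x - y\<bar>) \<and>
            (\<forall>t\<in>{0..T}. \<forall>t'\<in>{0..T}. \<forall>x. \<bar>h t x - h t' x\<bar> \<le> C * \<bar>t - t'\<bar>))"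

text \<open>The integrals are over half-open intervals because \<open>k t s\<close> is only meaningful for \<open>s < t\<close>.
  Measurability of \<open>k\<close> on the triangle makes both functions inside \<open>esssup\<close> measurable.\<close>

definition volterra_K0 :: "real \<Rightarrow> (real \<Rightarrow> real \<Rightarrow> real) \<Rightarrow> bool" where
  "volterra_K0 T k \<longleftrightarrow>
     (\<lambda>(t, s). k t s) \<in> borel_measurable (restrict_space borel {(t, s). 0 \<le> s \<and> s < t \<and> t \<le> T}) \<and>
     (\<forall>t s. 0 \<le> s \<and> s < t \<and> t \<le> T \<longrightarrow> 0 \<le> k t s) \<and>
     esssup (restrict_space lborel {0..T})
       (\<lambda>t. \<integral>\<^sup>+s\<in>{0..<t}. ennreal (k t s) \<partial>lborel) < \<infinity> \<and>
     Limsup (at_right 0) (\<lambda>\<epsilon>. esssup (restrict_space lborel {t\<in>{0..T}. t + \<epsilon> \<le> T})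
       (\<lambda>t. \<integral>\<^sup>+s\<in>{t..<t + \<epsilon>}. ennreal (k (t + \<epsilon>) s) \<partial>lborel)) = 0"

definition sem_kernel :: "(real \<Rightarrow> real \<Rightarrow> real) \<Rightarrow> real \<Rightarrow> real \<Rightarrow> real \<Rightarrow> real" where
  "sem_kernel h t s x = (t - s) powr (h t x - 1/2)"

definition abs_moment :: "'a measure \<Rightarrow> real \<Rightarrow> ('a \<Rightarrow> real) \<Rightarrow> ennreal" where
  "abs_moment M p Z = (\<integral>\<^sup>+\<omega>. ennreal (\<bar>Z \<omega>\<bar> powr p) \<partial>M)"

definition sem_solution ::
    "'a measure \<Rightarrow> real \<Rightarrow> (real \<Rightarrow> 'a measure) \<Rightarrow> (real \<Rightarrow> 'a \<Rightarrow> real) \<Rightarrow>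
     (real \<Rightarrow> real \<Rightarrow> real) \<Rightarrow> (real \<Rightarrow> 'a \<Rightarrow> real) \<Rightarrow> (real \<Rightarrow> 'a \<Rightarrow> real) \<Rightarrow> bool" where
  "sem_solution M T F B h g X \<longleftrightarrow>
     measurable_process M T X \<and> adapted_process F T X \<and>
     (\<forall>t\<in>{0..T}.
        ito_integrable M F B t (\<lambda>s \<omega>. sem_kernel h t s (X s \<omega>)) \<and>
        (AE \<omega> in M. X t \<omega> = g t \<omega> + ito_integral M F B t (\<lambda>s \<omega>. sem_kernel h t s (X s \<omega>)) \<omega>))"

end

theory Submission
  imports Defs
begin

text \<open>Put \<open>\<eta> = min hl (1/2)\<close>. The proof rests on two explicit estimates of the kernel. The Hurst
  exponent takes its values in a compact part of the open unit interval, so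
  \<open>\<bar>\<sigma>(t,s,x)\<bar> \<le> (1 + T) (t - s) powr (\<eta> - 1/2)\<close> uniformly in \<open>x\<close>: the integrands have a
  deterministic envelope that is square integrable in \<open>s\<close>. Differentiating a power in its exponent
  costs a logarithm, which is absorbed by lowering the exponent, and so
  \<open>(\<sigma>(t,s,x) - \<sigma>(t,s,y))\<^sup>2 \<le> L (t - s) powr (\<eta> - 1) (x - y)\<^sup>2\<close> with an integrable convolution
  kernel.

  The second estimate and the Ito isometry turn the equation into a fixed point problem for a map
  that is a contraction for the distance \<open>sup\<^sub>t exp (-l t) E \<bar>X\<^sub>t - Y\<^sub>t\<bar>\<^sup>2\<close> once \<open>l\<close> is large,
  because the Laplace transform of \<open>r powr (\<eta> - 1)\<close> tends to zero (\<open>kernel_integral_contraction\<close>).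
  Only differences of solutions enter, and these are differences of stochastic integrals; hence
  their second moments are finite at every time, whether or not those of \<open>g\<close> are. Picard iteration
  gives existence, the same estimate gives uniqueness. The first estimate makes the stochastic
  integral sub-Gaussian with a variance that depends on \<open>T\<close> and \<open>hl\<close> alone
  (\<open>simple_integral_exp_moment\<close>), so all its moments are bounded by such constants, and
  \<open>E \<bar>X\<^sub>t\<bar>\<^sup>p \<le> 2\<^sup>p (E \<bar>g(t)\<bar>\<^sup>p + const)\<close> follows from \<open>X\<^sub>t = g(t) + \<integral> \<sigma> dB\<close>.

  Two points need care. The integrand is only measurable and adapted, so it is approximated by
  freezing it at the points of a shifted grid; the error averaged over the shifts is a mean
  modulus of continuity of translations, hence some shift is good (\<open>shifted_grid_approximation\<close>).
  And the filtration need not be complete, so a limit may not be modified on a null set; limits of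
  adapted variables and processes are therefore taken as the pointwise \<open>lim\<close> of sequences that
  converge fast in mean square. In particular the stochastic convolution gets a jointly measurable
  adapted version from its values at left grid points, using that it is Hoelder continuous in mean
  square (\<open>stochastic_convolution\<close>).\<close>

section \<open>Increments of Brownian motion\<close>

locale brownian = prob_space M for M :: "'a measure" +
  fixes T :: real and F :: "real \<Rightarrow> 'a measure" and B :: "real \<Rightarrow> 'a \<Rightarrow> real"
  assumes filtered: "filtered_prob_space M T F" and bm: "brownian_motion M T F B"
begin

abbreviation incr :: "real \<Rightarrow> real \<Rightarrow> 'a \<Rightarrow> real" where
  "incr s t \<equiv> (\<lambda>\<omega>. B t \<omega> - B s \<omega>)"

lemma subalgebra_F: "0 \<le> t \<Longrightarrow> t \<le> T \<Longrightarrow> subalgebra M (F t)"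
  using filtered by (auto simp: filtered_prob_space_def)

lemma space_F: "0 \<le> t \<Longrightarrow> t \<le> T \<Longrightarrow> space (F t) = space M"
  using subalgebra_F by (auto simp: subalgebra_def)

lemma measurable_F_M:
  "0 \<le> t \<Longrightarrow> t \<le> T \<Longrightarrow> X \<in> borel_measurable (F t) \<Longrightarrow> X \<in> borel_measurable M"
  using measurable_from_subalg subalgebra_F by blast

lemma measurable_F_mono:
  assumes "0 \<le> s" "s \<le> t" "t \<le> T" "X \<in> borel_measurable (F s)"
  shows "X \<in> borel_measurable (F t)"
proof -
  have "subalgebra (F t) (F s)"
    using filtered assms by (auto simp: filtered_prob_space_def)
  then show ?thesis using assms measurable_from_subalg by blast
qed

lemma B_adapted: "0 \<le> t \<Longrightarrow> t \<le> T \<Longrightarrow> B t \<in> borel_measurable (F t)"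
  using bm by (auto simp: brownian_motion_def adapted_process_def)

lemma B_measurable: "0 \<le> t \<Longrightarrow> t \<le> T \<Longrightarrow> B t \<in> borel_measurable M"
  using B_adapted measurable_F_M by blast

lemma indep_increment:
  assumes st: "0 \<le> s" "s < t" "t \<le> T" and X: "X \<in> borel_measurable (F s)"
  shows "indep_var borel X borel (incr s t)"
proof -
  have ind: "indep_set (sets (F s)) {(incr s t) -` A \<inter> space M | A. A \<in> sets borel}"
    using bm st by (auto simp: brownian_motion_def)
  have s: "s \<le> T" "0 \<le> t" using st by auto
  have "X \<in> borel_measurable M" by (rule measurable_F_M[OF st(1) s(1) X])
  moreover have "(incr s t) \<in> borel_measurable M"
    by (intro borel_measurable_diff B_measurable st s)
  moreover have *: "X -` A \<inter> space M \<in> sets (F s)" if "A \<in> sets borel" for A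
    using measurable_sets[OF X that] unfolding space_F[OF st(1) s(1)] .
  moreover have "indep_sets (\<lambda>i. {case_bool X (incr s t) i -` A \<inter> space M | A.
      A \<in> sets (case_bool borel borel i)}) UNIV"
    by (rule indep_sets_mono_sets[OF ind[unfolded indep_set_def]])
      (use * in \<open>auto split: bool.splits\<close>)
  ultimately show ?thesis
    unfolding indep_var_def indep_vars_def2 by (auto split: bool.split)
qed

text \<open>Independence of the increment is used only in this product form: with powers for the
  isometry, and with hyperbolic functions for the exponential moments.\<close>

lemma
  assumes st: "0 \<le> s" "s < t" "t \<le> T" and X: "X \<in> borel_measurable (F s)" and "integrable M X"
    and f: "f \<in> borel_measurable borel"
    and fi: "integrable lborel (\<lambda>x. normal_density 0 (sqrt (t - s)) x * f x)"
  shows integrable_increment_product: "integrable M (\<lambda>\<omega>. X \<omega> * f (incr s t \<omega>))"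
    and expectation_increment_product: "expectation (\<lambda>\<omega>. X \<omega> * f (incr s t \<omega>)) =
      expectation X * (\<integral>x. normal_density 0 (sqrt (t - s)) x * f x \<partial>lborel)"
proof -
  have iv: "indep_var borel X borel (\<lambda>\<omega>. f (incr s t \<omega>))"
    using indep_var_compose[OF indep_increment[OF st X], of id borel f borel] f
    by (simp add: comp_def)
  have d: "distributed M lborel (incr s t) (normal_density 0 (sqrt (t - s)))"
    using bm st by (auto simp: brownian_motion_def)
  have i: "integrable M (\<lambda>\<omega>. f (incr s t \<omega>))"
    using distributed_integrable[OF d, of f] f fi by simp
  have e: "expectation (\<lambda>\<omega>. f (incr s t \<omega>)) =
      (\<integral>x. normal_density 0 (sqrt (t - s)) x * f x \<partial>lborel)"
    using distributed_integral[OF d, of f] f by simp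
  show "integrable M (\<lambda>\<omega>. X \<omega> * f (incr s t \<omega>))"
    using indep_var_integrable[OF iv \<open>integrable M X\<close> i] .
  show "expectation (\<lambda>\<omega>. X \<omega> * f (incr s t \<omega>)) =
      expectation X * (\<integral>x. normal_density 0 (sqrt (t - s)) x * f x \<partial>lborel)"
    using indep_var_lebesgue_integral[OF iv \<open>integrable M X\<close> i] e by simp
qed

lemma
  assumes st: "0 \<le> s" "s \<le> t" "t \<le> T" and X: "X \<in> borel_measurable (F s)" "integrable M X"
  shows integrable_increment: "integrable M (\<lambda>\<omega>. X \<omega> * incr s t \<omega>)"
    and expectation_increment: "expectation (\<lambda>\<omega>. X \<omega> * incr s t \<omega>) = 0"
    and integrable_increment_square: "integrable M (\<lambda>\<omega>. X \<omega> * (incr s t \<omega>)\<^sup>2)"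
    and expectation_increment_square:
      "expectation (\<lambda>\<omega>. X \<omega> * (incr s t \<omega>)\<^sup>2) = expectation X * (t - s)"
proof -
  have "integrable M (\<lambda>\<omega>. X \<omega> * incr s t \<omega>) \<and>
     expectation (\<lambda>\<omega>. X \<omega> * incr s t \<omega>) = 0 \<and>
     integrable M (\<lambda>\<omega>. X \<omega> * (incr s t \<omega>)\<^sup>2) \<and>
     expectation (\<lambda>\<omega>. X \<omega> * (incr s t \<omega>)\<^sup>2) = expectation X * (t - s)"
  proof (cases "s = t")
    case False
    then have lt: "s < t" using st by simp
    let ?\<sigma> = "sqrt (t - s)"
    have pos: "?\<sigma> > 0" using lt by simp
    have 1: "has_bochner_integral lborel (\<lambda>x. normal_density 0 ?\<sigma> x * x) 0"
      using normal_moment_nz_1[of ?\<sigma> 0] pos by simp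
    have 2: "has_bochner_integral lborel (\<lambda>x. normal_density 0 ?\<sigma> x * x\<^sup>2) (t - s)"
    proof -
      have e: "fact (2 * 1) / ((2 / ?\<sigma>\<^sup>2) ^ 1 * fact 1) = t - s" using lt by (simp add: fact_numeral)
      show ?thesis using normal_moment_even[OF pos, of 0 1] unfolding e by simp
    qed
    have i1: "integrable lborel (\<lambda>x. normal_density 0 ?\<sigma> x * x)"
      "(\<integral>x. normal_density 0 ?\<sigma> x * x \<partial>lborel) = 0" using 1 by (simp_all only: has_bochner_integral_iff)
    have i2: "integrable lborel (\<lambda>x. normal_density 0 ?\<sigma> x * x\<^sup>2)"
      "(\<integral>x. normal_density 0 ?\<sigma> x * x\<^sup>2 \<partial>lborel) = t - s" using 2
          by (simp_all only: has_bochner_integral_iff)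
    have m: "(\<lambda>x. x) \<in> borel_measurable borel" "(\<lambda>x::real. x\<^sup>2) \<in> borel_measurable borel" by measurable
    have e: "expectation (\<lambda>\<omega>. X \<omega> * incr s t \<omega>) = 0"
      using expectation_increment_product[OF st(1) lt st(3) X m(1) i1(1)] unfolding i1(2)
          by (simp only: mult_zero_right)
    show ?thesis
      by (intro conjI e integrable_increment_product[OF st(1) lt st(3) X m(1) i1(1)]
        integrable_increment_product[OF st(1) lt st(3) X m(2) i2(1)]
        expectation_increment_product[OF st(1) lt st(3) X m(2) i2(1), unfolded i2(2)])
  qed simp
  then show "integrable M (\<lambda>\<omega>. X \<omega> * incr s t \<omega>)"
     "expectation (\<lambda>\<omega>. X \<omega> * incr s t \<omega>) = 0"
     "integrable M (\<lambda>\<omega>. X \<omega> * (incr s t \<omega>)\<^sup>2)"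
     "expectation (\<lambda>\<omega>. X \<omega> * (incr s t \<omega>)\<^sup>2) = expectation X * (t - s)" by auto
qed

definition bounded_F :: "real \<Rightarrow> ('a \<Rightarrow> real) \<Rightarrow> bool" where
  "bounded_F s X \<longleftrightarrow> X \<in> borel_measurable (F s) \<and> (\<exists>K. \<forall>\<omega>\<in>space M. \<bar>X \<omega>\<bar> \<le> K)"

lemma bounded_F_mono: "bounded_F s X \<Longrightarrow> 0 \<le> s \<Longrightarrow> s \<le> t \<Longrightarrow> t \<le> T \<Longrightarrow> bounded_F t X"
  using measurable_F_mono unfolding bounded_F_def by blast

lemma bounded_F_mult:
  assumes "bounded_F s X" "bounded_F s Y"
  shows "bounded_F s (\<lambda>\<omega>. X \<omega> * Y \<omega>)"
proof -
  obtain K L where KL: "\<And>\<omega>. \<omega> \<in> space M \<Longrightarrow> \<bar>X \<omega>\<bar> \<le> K" "\<And>\<omega>. \<omega> \<in> space M \<Longrightarrow> \<bar>Y \<omega>\<bar> \<le> L"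
    using assms unfolding bounded_F_def by blast
  have "\<bar>X \<omega> * Y \<omega>\<bar> \<le> K * L" if "\<omega> \<in> space M" for \<omega>
    unfolding abs_mult
    by (rule mult_mono[OF KL(1)[OF that] KL(2)[OF that] order_trans[OF abs_ge_zero KL(1)[OF that]] abs_ge_zero])
  moreover have "(\<lambda>\<omega>. X \<omega> * Y \<omega>) \<in> borel_measurable (F s)"
    using assms unfolding bounded_F_def by (intro borel_measurable_times) blast+
  ultimately show ?thesis unfolding bounded_F_def by blast
qed

lemma bounded_F_integrable:
  assumes "bounded_F s X" "0 \<le> s" "s \<le> T"
  shows "integrable M X"
proof -
  obtain K where "\<And>\<omega>. \<omega> \<in> space M \<Longrightarrow> \<bar>X \<omega>\<bar> \<le> K"
    using assms unfolding bounded_F_def by blast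
  moreover have "X \<in> borel_measurable M"
    using assms measurable_F_M[of s X] unfolding bounded_F_def by blast
  ultimately show ?thesis by (intro integrable_const_bound[of _ K]) auto
qed

text \<open>If the first interval ends before the second one starts, the last increment is centred and
  independent of all other factors. Otherwise the intervals are cut at \<open>c\<close> and at \<open>m = min b d\<close>;
  in each mixed term one increment lies after all other factors and kills the expectation, and
  only the square over \<open>(c, m]\<close> survives.\<close>

lemma increment_covariance_ordered:
  assumes ab: "0 \<le> a" "a \<le> b" "b \<le> T" and cd: "a \<le> c" "c \<le> d" "d \<le> T"
    and \<xi>: "bounded_F a \<xi>" and \<eta>: "bounded_F c \<eta>"
  shows "has_bochner_integral M (\<lambda>\<omega>. (\<xi> \<omega> * incr a b \<omega>) * (\<eta> \<omega> * incr c d \<omega>))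
    (expectation (\<lambda>\<omega>. \<xi> \<omega> * \<eta> \<omega>) * measure lborel ({a<..b} \<inter> {c<..d}))"
proof -
  have c0: "0 \<le> c" "c \<le> T" using ab cd by auto
  define Y where "Y = (\<lambda>\<omega>. \<xi> \<omega> * \<eta> \<omega>)"
  have \<xi>c: "bounded_F c \<xi>" using bounded_F_mono[OF \<xi>] ab cd by simp
  have Y: "bounded_F c Y" unfolding Y_def using bounded_F_mult[OF \<xi>c \<eta>] .
  have [measurable]: "\<xi> \<in> borel_measurable (F c)" "\<eta> \<in> borel_measurable (F c)"
    using \<xi>c \<eta> unfolding bounded_F_def by blast+
  have Ym[measurable]: "Y \<in> borel_measurable (F c)" unfolding Y_def by measurable
  have Yi: "integrable M Y" using bounded_F_integrable[OF Y c0] .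
  have zero: "has_bochner_integral M (\<lambda>\<omega>. Y \<omega> * incr q r \<omega> * incr u v \<omega>) 0"
    if q: "0 \<le> q" "q \<le> r" "r \<le> u" "u \<le> v" "v \<le> T" "a \<le> q" "c \<le> u" and "q = a \<or> c \<le> q" for q r u v
  proof -
    have bnds: "0 \<le> r" "r \<le> T" "0 \<le> u" "u \<le> T" "q \<le> u" "q \<le> T" "r \<le> u" using that by auto
    have [measurable]: "B r \<in> borel_measurable (F u)" "B q \<in> borel_measurable (F u)"
      by (rule measurable_F_mono[OF _ _ _ B_adapted]; use bnds that in blast)+
    have Yu[measurable]: "Y \<in> borel_measurable (F u)"
      by (rule measurable_F_mono[OF c0(1) _ _ Ym]; use that bnds in blast)
    have "integrable M (\<lambda>\<omega>. Y \<omega> * incr q r \<omega>)"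
    proof (cases "c \<le> q")
      case True
      then have "Y \<in> borel_measurable (F q)"
        by (rule measurable_F_mono[OF c0(1) _ bnds(6) Ym])
      then show ?thesis
        by (intro integrable_increment that(1,2) bnds Yi)
    next
      case False
      then have qa: "q = a" using that by simp
      have i: "integrable M (\<lambda>\<omega>. \<xi> \<omega> * incr a r \<omega>)"
        using integrable_increment[of a r \<xi>] \<xi> bounded_F_integrable[OF \<xi>] that(1,2) bnds qa
        unfolding bounded_F_def by blast
      obtain K where K: "\<forall>\<omega>\<in>space M. \<bar>\<eta> \<omega>\<bar> \<le> K" using \<eta> unfolding bounded_F_def by blast
      have "integrable M (\<lambda>\<omega>. K * \<bar>\<xi> \<omega> * incr a r \<omega>\<bar>)" using i by auto
      moreover have "(\<lambda>\<omega>. Y \<omega> * incr q r \<omega>) \<in> borel_measurable M"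
        by (rule measurable_F_M[OF bnds(3,4)]) measurable
      ultimately show ?thesis
      proof (rule Bochner_Integration.integrable_bound, intro AE_I2)
        fix \<omega> assume "\<omega> \<in> space M"
        then have "\<bar>\<eta> \<omega>\<bar> * \<bar>\<xi> \<omega> * incr a r \<omega>\<bar> \<le> K * \<bar>\<xi> \<omega> * incr a r \<omega>\<bar>"
          using K by (intro mult_right_mono) auto
        also have "\<dots> \<le> \<bar>K * \<bar>\<xi> \<omega> * incr a r \<omega>\<bar>\<bar>" by (rule abs_ge_self)
        finally show "norm (Y \<omega> * incr q r \<omega>) \<le> norm (K * \<bar>\<xi> \<omega> * incr a r \<omega>\<bar>)"
          by (simp add: Y_def qa abs_mult mult.assoc mult.left_commute)
      qed
    qed
    moreover have "(\<lambda>\<omega>. Y \<omega> * incr q r \<omega>) \<in> borel_measurable (F u)" by measurable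
    ultimately show ?thesis
      unfolding has_bochner_integral_iff using that(4,5) bnds
        integrable_increment[of u v "\<lambda>\<omega>. Y \<omega> * incr q r \<omega>"]
        expectation_increment[of u v "\<lambda>\<omega>. Y \<omega> * incr q r \<omega>"] by blast
  qed
  have square: "has_bochner_integral M (\<lambda>\<omega>. Y \<omega> * (incr c m \<omega>)\<^sup>2) (expectation Y * (m - c))"
    if "c \<le> m" "m \<le> T" for m
    unfolding has_bochner_integral_iff using that c0 Yi Ym
    by (intro conjI integrable_increment_square expectation_increment_square)
  have "has_bochner_integral M (\<lambda>\<omega>. Y \<omega> * incr a b \<omega> * incr c d \<omega>)
    (expectation Y * measure lborel ({a<..b} \<inter> {c<..d}))"
  proof (cases "b \<le> c")
    case True
    then have "{a<..b} \<inter> {c<..d} = {}" by auto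
    then show ?thesis using zero[of a b c d] True ab cd by simp
  next
    case False
    define m where "m = min b d"
    have m: "c \<le> m" "m \<le> b" "m \<le> d" "m \<le> T" using False ab cd by (auto simp: m_def)
    have "{a<..b} \<inter> {c<..d} = {c<..m}" using False ab cd by (auto simp: m_def)
    then have meas: "measure lborel ({a<..b} \<inter> {c<..d}) = m - c" using m by simp
    have s: "has_bochner_integral M (\<lambda>\<omega>. Y \<omega> * incr a c \<omega> * incr c d \<omega> +
        (Y \<omega> * (incr c m \<omega>)\<^sup>2 + (Y \<omega> * incr c m \<omega> * incr m d \<omega> +
        Y \<omega> * incr c m \<omega> * incr m b \<omega>))) (0 + (expectation Y * (m - c) + (0 + 0)))"
      by (intro has_bochner_integral_add zero square) (use m ab cd c0 in auto)
    have e: "Y \<omega> * incr a c \<omega> * incr c d \<omega> +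
        (Y \<omega> * (incr c m \<omega>)\<^sup>2 + (Y \<omega> * incr c m \<omega> * incr m d \<omega> +
        Y \<omega> * incr c m \<omega> * incr m b \<omega>)) = Y \<omega> * incr a b \<omega> * incr c d \<omega>" for \<omega>
      unfolding m_def min_def by (simp add: algebra_simps power2_eq_square)
    show ?thesis using s unfolding e meas by simp
  qed
  then show ?thesis unfolding Y_def by (simp add: mult.assoc mult.commute mult.left_commute)
qed

lemma increment_covariance:
  assumes ab: "0 \<le> a" "a \<le> b" "b \<le> T" and cd: "0 \<le> c" "c \<le> d" "d \<le> T"
    and \<xi>: "bounded_F a \<xi>" and \<eta>: "bounded_F c \<eta>"
  shows "has_bochner_integral M (\<lambda>\<omega>. (\<xi> \<omega> * incr a b \<omega>) * (\<eta> \<omega> * incr c d \<omega>))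
    (expectation (\<lambda>\<omega>. \<xi> \<omega> * \<eta> \<omega>) * measure lborel ({a<..b} \<inter> {c<..d}))"
proof (cases "a \<le> c")
  case True then show ?thesis using increment_covariance_ordered assms by blast
next
  case False
  then have "has_bochner_integral M (\<lambda>\<omega>. (\<eta> \<omega> * incr c d \<omega>) * (\<xi> \<omega> * incr a b \<omega>))
    (expectation (\<lambda>\<omega>. \<eta> \<omega> * \<xi> \<omega>) * measure lborel ({c<..d} \<inter> {a<..b}))"
    using increment_covariance_ordered assms by force
  then show ?thesis by (simp add: Int_commute mult.commute)
qed

text \<open>The intervals may overlap. Therefore differences of simple processes over different
  partitions are covered, and no common refinement is needed.\<close>

lemma isometry_finite_sum:
  assumes I: "finite I" and ab: "\<And>i. i \<in> I \<Longrightarrow> 0 \<le> a i \<and> a i \<le> b i \<and> b i \<le> T"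
    and \<xi>: "\<And>i. i \<in> I \<Longrightarrow> bounded_F (a i) (\<xi> i)"
  shows "(\<integral>\<^sup>+\<omega>. ennreal ((\<Sum>i\<in>I. \<xi> i \<omega> * incr (a i) (b i) \<omega>)\<^sup>2) \<partial>M) =
    (\<integral>\<^sup>+\<omega>. (\<integral>\<^sup>+s. ennreal ((\<Sum>i\<in>I. \<xi> i \<omega> * indicator {a i<..b i} s)\<^sup>2) \<partial>lborel) \<partial>M)"
proof -
  let ?m = "\<lambda>i j. measure lborel ({a i<..b i} \<inter> {a j<..b j})"
  have "has_bochner_integral M
      (\<lambda>\<omega>. \<Sum>i\<in>I. \<Sum>j\<in>I. (\<xi> i \<omega> * incr (a i) (b i) \<omega>) * (\<xi> j \<omega> * incr (a j) (b j) \<omega>))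
      (\<Sum>i\<in>I. \<Sum>j\<in>I. expectation (\<lambda>\<omega>. \<xi> i \<omega> * \<xi> j \<omega>) * ?m i j)"
    using ab \<xi> by (intro has_bochner_integral_sum increment_covariance) auto
  then have L: "has_bochner_integral M (\<lambda>\<omega>. (\<Sum>i\<in>I. \<xi> i \<omega> * incr (a i) (b i) \<omega>)\<^sup>2)
      (\<Sum>i\<in>I. \<Sum>j\<in>I. expectation (\<lambda>\<omega>. \<xi> i \<omega> * \<xi> j \<omega>) * ?m i j)"
    by (simp add: power2_eq_square sum_product)
  have prod_int: "integrable M (\<lambda>\<omega>. \<xi> i \<omega> * \<xi> j \<omega>)" if "i \<in> I" "j \<in> I" for i j
  proof -
    define u where "u = max (a i) (a j)"
    have u: "0 \<le> u" "a i \<le> u" "a j \<le> u" "u \<le> T" using ab[OF that(1)] ab[OF that(2)] by (auto simp: u_def)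
    have "bounded_F u (\<lambda>\<omega>. \<xi> i \<omega> * \<xi> j \<omega>)"
      using bounded_F_mono[OF \<xi>[OF that(1)] _ u(2,4)] bounded_F_mono[OF \<xi>[OF that(2)] _ u(3,4)]
        ab[OF that(1)] ab[OF that(2)] by (intro bounded_F_mult) blast+
    then show ?thesis by (rule bounded_F_integrable[OF _ u(1,4)])
  qed
  have R: "has_bochner_integral M (\<lambda>\<omega>. \<Sum>i\<in>I. \<Sum>j\<in>I. (\<xi> i \<omega> * \<xi> j \<omega>) * ?m i j)
      (\<Sum>i\<in>I. \<Sum>j\<in>I. expectation (\<lambda>\<omega>. \<xi> i \<omega> * \<xi> j \<omega>) * ?m i j)"
    using prod_int
    by (intro has_bochner_integral_sum has_bochner_integral_mult_left) (auto simp: has_bochner_integral_iff)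
  have inner: "has_bochner_integral lborel (\<lambda>s. (\<Sum>i\<in>I. \<xi> i \<omega> * indicator {a i<..b i} s)\<^sup>2)
       (\<Sum>i\<in>I. \<Sum>j\<in>I. (\<xi> i \<omega> * \<xi> j \<omega>) * ?m i j)" for \<omega>
  proof -
    have "emeasure lborel ({a i<..b i} \<inter> {a j<..b j}) < \<infinity>" if "i \<in> I" for i j
    proof -
      have "emeasure lborel ({a i<..b i} \<inter> {a j<..b j}) \<le> emeasure lborel {a i<..b i}"
        by (intro emeasure_mono) auto
      also have "\<dots> < \<infinity>" using ab[OF that] by simp
      finally show ?thesis .
    qed
    then have "has_bochner_integral lborel
       (\<lambda>s. \<Sum>i\<in>I. \<Sum>j\<in>I. (\<xi> i \<omega> * \<xi> j \<omega>) * indicator ({a i<..b i} \<inter> {a j<..b j}) s)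
       (\<Sum>i\<in>I. \<Sum>j\<in>I. (\<xi> i \<omega> * \<xi> j \<omega>) * ?m i j)"
      by (intro has_bochner_integral_sum has_bochner_integral_mult_right
          has_bochner_integral_real_indicator) auto
    moreover have "(\<Sum>i\<in>I. \<xi> i \<omega> * indicator {a i<..b i} s)\<^sup>2 = (\<Sum>i\<in>I. \<Sum>j\<in>I.
        (\<xi> i \<omega> * \<xi> j \<omega>) * indicator ({a i<..b i} \<inter> {a j<..b j}) s)" for s
      unfolding power2_eq_square sum_product
      by (intro sum.cong refl) (simp add: indicator_inter_arith del: Int_greaterThanAtMost)
    ultimately show ?thesis by presburger
  qed
  have "(\<integral>\<^sup>+s. ennreal ((\<Sum>i\<in>I. \<xi> i \<omega> * indicator {a i<..b i} s)\<^sup>2) \<partial>lborel) =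
      ennreal (\<Sum>i\<in>I. \<Sum>j\<in>I. (\<xi> i \<omega> * \<xi> j \<omega>) * ?m i j)" for \<omega>
    using nn_integral_eq_integral[of lborel "\<lambda>s. (\<Sum>i\<in>I. \<xi> i \<omega> * indicator {a i<..b i} s)\<^sup>2"] inner[of \<omega>]
    by (simp add: has_bochner_integral_iff)
  moreover have "0 \<le> (\<Sum>i\<in>I. \<Sum>j\<in>I. (\<xi> i \<omega> * \<xi> j \<omega>) * ?m i j)" for \<omega>
    using inner[of \<omega>] Bochner_Integration.integral_nonneg[of lborel
        "\<lambda>s. (\<Sum>i\<in>I. \<xi> i \<omega> * indicator {a i<..b i} s)\<^sup>2"]
    by (simp add: has_bochner_integral_iff)
  ultimately show ?thesis
    using nn_integral_eq_integral[of M "\<lambda>\<omega>. (\<Sum>i\<in>I. \<xi> i \<omega> * incr (a i) (b i) \<omega>)\<^sup>2"] L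
      nn_integral_eq_integral[of M "\<lambda>\<omega>. \<Sum>i\<in>I. \<Sum>j\<in>I. (\<xi> i \<omega> * \<xi> j \<omega>) * ?m i j"] R
    by (simp add: has_bochner_integral_iff)
qed

end

section \<open>Mean square distances\<close>

text \<open>The constants 2 and 4 in these triangle inequalities are harmless: the inequalities are
  applied to quantities that tend to zero, or in front of a factor that can be chosen small.\<close>

lemma square_dist_triangle:
  fixes a b c :: real
  shows "(a - c)\<^sup>2 \<le> 2 * ((a - b)\<^sup>2 + (b - c)\<^sup>2)"
proof -
  have "0 \<le> ((a - b) - (b - c))\<^sup>2" by simp
  then show ?thesis by (simp add: power2_eq_square algebra_simps)
qed

abbreviation ms_dist :: "'b measure \<Rightarrow> ('b \<Rightarrow> real) \<Rightarrow> ('b \<Rightarrow> real) \<Rightarrow> ennreal" where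
  "ms_dist N f g \<equiv> (\<integral>\<^sup>+x. ennreal ((f x - g x)\<^sup>2) \<partial>N)"

lemma nn_integral_square_triangle:
  fixes f g h :: "'b \<Rightarrow> real"
  assumes [measurable]: "f \<in> borel_measurable N" "g \<in> borel_measurable N" "h \<in> borel_measurable N"
  shows "ms_dist N f h \<le>
    2 * (ms_dist N f g + ms_dist N g h)"
proof -
  have "ms_dist N f h \<le>
    (\<integral>\<^sup>+x. ennreal 2 * (ennreal ((f x - g x)\<^sup>2) + ennreal ((g x - h x)\<^sup>2)) \<partial>N)"
    by (intro nn_integral_mono)
      (simp add: square_dist_triangle del: ennreal_numeral distrib_left_numeral
        flip: ennreal_plus ennreal_mult')
  also have "\<dots> = 2 * (ms_dist N f g + ms_dist N g h)"
    by (subst nn_integral_cmult, measurable, subst nn_integral_add) auto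
  finally show ?thesis .
qed

lemma nn_integral_square_quadrilateral:
  fixes f g h :: "'b \<Rightarrow> real"
  assumes [measurable]: "f \<in> borel_measurable N" "g \<in> borel_measurable N" "h \<in> borel_measurable N"
    "k \<in> borel_measurable N"
  shows "ms_dist N f k \<le>
    4 * (ms_dist N f g + ms_dist N g h
      + ms_dist N h k)"
    (is "?fk \<le> 4 * (?fg + ?gh + ?hk)")
proof -
  let ?gk = "ms_dist N g k"
  have "?fk \<le> 2 * (?fg + ?gk)" by (rule nn_integral_square_triangle) measurable
  also have "\<dots> \<le> 2 * (?fg + 2 * (?gh + ?hk))"
    by (intro mult_left_mono add_left_mono nn_integral_square_triangle) auto
  also have "\<dots> = 2 * ?fg + 4 * (?gh + ?hk)" by (simp add: distrib_left flip: mult.assoc)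
  also have "\<dots> \<le> 4 * ?fg + 4 * (?gh + ?hk)" by (intro add_right_mono mult_right_mono) auto
  finally show ?thesis by (simp add: distrib_left add.assoc)
qed

lemma AE_eq_if_square_dist_zero:
  fixes f g :: "'b \<Rightarrow> real"
  assumes [measurable]: "f \<in> borel_measurable N" "g \<in> borel_measurable N"
    and "ms_dist N f g = 0"
  shows "AE x in N. f x = g x"
proof -
  have "AE x in N. ennreal ((f x - g x)\<^sup>2) = 0"
    using assms(3) by (subst (asm) nn_integral_0_iff_AE) auto
  then show ?thesis by eventually_elim (simp add: ennreal_eq_0_iff)
qed

lemma suminf_geometric_ennreal:
  assumes "0 \<le> c" shows "(\<Sum>k. ennreal (c / 2 ^ k)) = ennreal (2 * c)"
proof -
  have "(\<lambda>k. c * (1 / 2) ^ k) sums (c * (1 / (1 - 1 / 2)))"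
    by (intro sums_mult geometric_sums) simp
  then have "(\<lambda>k. c / 2 ^ k) sums (2 * c)" by (simp add: power_one_over field_simps)
  then show ?thesis using assms by (intro suminf_ennreal_eq) auto
qed

lemma AE_tendsto_of_fast_ms_dist:
  fixes f :: "nat \<Rightarrow> 'b \<Rightarrow> real"
  assumes [measurable]: "\<And>k. f k \<in> borel_measurable N" "g \<in> borel_measurable N"
    and c: "0 \<le> c" and d: "\<And>k. ms_dist N (f k) g \<le> ennreal (c / 2 ^ k)"
  shows "AE x in N. (\<lambda>k. f k x) \<longlonglongrightarrow> g x"
proof -
  have "(\<integral>\<^sup>+x. (\<Sum>k. ennreal ((f k x - g x)\<^sup>2)) \<partial>N) = (\<Sum>k. ms_dist N (f k) g)"
    by (rule nn_integral_suminf) measurable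
  also have "\<dots> \<le> (\<Sum>k. ennreal (c / 2 ^ k))" by (intro suminf_le d) auto
  also have "\<dots> < \<infinity>" unfolding suminf_geometric_ennreal[OF c] by simp
  finally have "AE x in N. (\<Sum>k. ennreal ((f k x - g x)\<^sup>2)) \<noteq> \<infinity>"
    by (intro nn_integral_PInf_AE) auto
  then show ?thesis
  proof eventually_elim
    case (elim x)
    then have "summable (\<lambda>k. (f k x - g x)\<^sup>2)"
      by (intro summable_suminf_not_top) auto
    then have "(\<lambda>k. sqrt ((f k x - g x)\<^sup>2)) \<longlonglongrightarrow> sqrt 0"
      by (intro tendsto_real_sqrt summable_LIMSEQ_zero)
    then have "(\<lambda>k. f k x - g x) \<longlonglongrightarrow> 0" by (simp add: tendsto_rabs_zero_iff)
    then show ?case by (rule LIM_zero_cancel)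
  qed
qed

text \<open>A sequence that is Cauchy in mean square at a geometric rate converges almost surely, and
  its pointwise limit inherits every measurability property of the sequence; this
  version of the completeness of L2 is used wherever adaptedness has to survive the limit.\<close>

lemma (in prob_space)
  fixes f :: "nat \<Rightarrow> 'a \<Rightarrow> real"
  assumes [measurable]: "\<And>k. f k \<in> borel_measurable M"
    and c: "0 \<le> c"
    and d: "\<And>k. ms_dist M (f (Suc k)) (f k) \<le> ennreal (c / 4 ^ k)"
  shows AE_convergent_of_fast_Cauchy: "AE x in M. convergent (\<lambda>k. f k x)"
    and lim_square_dist_of_fast_Cauchy:
      "(\<integral>\<^sup>+x. ennreal ((lim (\<lambda>n. f n x) - f k x)\<^sup>2) \<partial>M) \<le> ennreal (4 * c / 4 ^ k)"
proof -
  have l1: "(\<integral>\<^sup>+x. ennreal \<bar>f (Suc k) x - f k x\<bar> \<partial>M) \<le> ennreal ((1 + c) / 2 ^ k)" for k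
  proof -
    have le: "y \<le> 1 / 2 ^ k + 2 ^ k * y\<^sup>2" if "0 \<le> y" for y :: real
    proof (cases "y \<le> 1 / 2 ^ k")
      case False
      then have "1 * y \<le> (2 ^ k * y) * y" using that by (intro mult_right_mono) (auto simp: field_simps)
      then show ?thesis by (simp add: power2_eq_square add_increasing mult.assoc)
    qed (simp add: add_increasing2)
    \<comment> \<open>On a probability space this trades the second moment for the first one at rate
      \<open>1 / 2 ^ k\<close>.\<close>
    have "(\<integral>\<^sup>+x. ennreal \<bar>f (Suc k) x - f k x\<bar> \<partial>M) \<le>
      (\<integral>\<^sup>+x. ennreal (1 / 2 ^ k) + ennreal (2 ^ k) * ennreal ((f (Suc k) x - f k x)\<^sup>2) \<partial>M)"
    proof (intro nn_integral_mono)
      fix x show "ennreal \<bar>f (Suc k) x - f k x\<bar> \<le>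
          ennreal (1 / 2 ^ k) + ennreal (2 ^ k) * ennreal ((f (Suc k) x - f k x)\<^sup>2)"
        using le[of "\<bar>f (Suc k) x - f k x\<bar>"]
        by (simp flip: ennreal_plus ennreal_mult' del: ennreal_power ennreal_numeral)
    qed
    also have "\<dots> = ennreal (1 / 2 ^ k) + ennreal (2 ^ k) * ms_dist M (f (Suc k)) (f k)"
      by (subst nn_integral_add, measurable, subst nn_integral_cmult) (auto simp: emeasure_space_1)
    also have "\<dots> \<le> ennreal (1 / 2 ^ k) + ennreal (2 ^ k) * ennreal (c / 4 ^ k)"
      by (intro add_left_mono mult_left_mono d) auto
    also have "\<dots> = ennreal (1 / 2 ^ k + 2 ^ k * (c / 4 ^ k))"
      using c by (simp flip: ennreal_plus ennreal_mult' del: ennreal_power ennreal_numeral)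
    also have "1 / 2 ^ k + 2 ^ k * (c / 4 ^ k) = (1 + c) / 2 ^ k"
    proof -
      have "(4::real) ^ k = 2 ^ k * 2 ^ k" by (simp flip: power_mult_distrib)
      then show ?thesis by (simp add: field_simps)
    qed
    finally show ?thesis .
  qed
  have "(\<integral>\<^sup>+x. (\<Sum>k. ennreal \<bar>f (Suc k) x - f k x\<bar>) \<partial>M) = (\<Sum>k. \<integral>\<^sup>+x. ennreal \<bar>f (Suc k) x - f k x\<bar> \<partial>M)"
    by (rule nn_integral_suminf) measurable
  also have "\<dots> \<le> (\<Sum>k. ennreal ((1 + c) / 2 ^ k))" by (intro suminf_le l1) auto
  also have "\<dots> < \<infinity>" using c by (subst suminf_geometric_ennreal) auto
  finally have "AE x in M. (\<Sum>k. ennreal \<bar>f (Suc k) x - f k x\<bar>) \<noteq> \<infinity>"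
    by (intro nn_integral_PInf_AE) auto
  then show conv: "AE x in M. convergent (\<lambda>k. f k x)"
  proof eventually_elim
    case (elim x)
    then have "summable (\<lambda>k. \<bar>f (Suc k) x - f k x\<bar>)"
      by (intro summable_suminf_not_top) auto
    then have "summable (\<lambda>k. f (Suc k) x - f k x)" by (rule summable_rabs_cancel)
    then have "convergent (\<lambda>n. \<Sum>k<n. f (Suc k) x - f k x)" by (simp add: summable_iff_convergent)
    moreover have "(\<lambda>n. \<Sum>k<n. f (Suc k) x - f k x) = (\<lambda>n. f n x - f 0 x)"
      by (rule ext) (rule sum_lessThan_telescope)
    ultimately have "convergent (\<lambda>n. f n x - f 0 x)" by simp
    then show ?case using convergent_add_const_right_iff[of "\<lambda>n. f n x" "- f 0 x"] by simp
  qed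
  have fin: "ms_dist M (f (k + m)) (f k) \<le> ennreal (4 * c / 4 ^ k)" for k m
  proof (induction m arbitrary: k)
    case (Suc m)
    have "ms_dist M (f (k + Suc m)) (f k) \<le>
      2 * (ms_dist M (f (Suc k + m)) (f (Suc k)) + ms_dist M (f (Suc k)) (f k))"
      using nn_integral_square_triangle[of "f (Suc k + m)" M "f (Suc k)" "f k"] by simp
    also have "\<dots> \<le> ennreal 2 * (ennreal (4 * c / 4 ^ Suc k) + ennreal (c / 4 ^ k))"
      using Suc[of "Suc k"] d[of k] by (intro mult_mono add_mono) auto
    also have "\<dots> = ennreal (4 * c / 4 ^ k)"
      using c by (simp add: field_simps flip: ennreal_plus ennreal_mult' del: ennreal_numeral)
    finally show ?case .
  qed (use c in simp)
  have "(\<integral>\<^sup>+x. ennreal ((lim (\<lambda>n. f n x) - f k x)\<^sup>2) \<partial>M) =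
      (\<integral>\<^sup>+x. liminf (\<lambda>m. ennreal ((f (k + m) x - f k x)\<^sup>2)) \<partial>M)"
  proof (rule nn_integral_cong_AE)
    show "AE x in M. ennreal ((lim (\<lambda>n. f n x) - f k x)\<^sup>2) = liminf (\<lambda>m. ennreal ((f (k +
        m) x - f k x)\<^sup>2))"
      using conv
    proof eventually_elim
      case (elim x)
      then have "(\<lambda>n. f n x) \<longlonglongrightarrow> lim (\<lambda>n. f n x)" by (simp add: convergent_LIMSEQ_iff)
      then have "(\<lambda>m. f (k + m) x) \<longlonglongrightarrow> lim (\<lambda>n. f n x)"
        using LIMSEQ_ignore_initial_segment[of "\<lambda>n. f n x" _ k] by (simp add: add.commute)
      then have "(\<lambda>m. ennreal ((f (k + m) x - f k x)\<^sup>2)) \<longlonglongrightarrow> ennreal ((lim (\<lambda>n. f n x) - f k x)\<^sup>2)"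
        by (intro tendsto_ennrealI tendsto_power tendsto_diff) auto
      then show ?case by (intro lim_imp_Liminf[symmetric]) auto
    qed
  qed
  also have "\<dots> \<le> liminf (\<lambda>m. ms_dist M (f (k + m)) (f k))"
    by (rule nn_integral_liminf) measurable
  also have "\<dots> \<le> ennreal (4 * c / 4 ^ k)"
    by (rule Liminf_le) (auto intro: always_eventually fin)
  finally show "(\<integral>\<^sup>+x. ennreal ((lim (\<lambda>n. f n x) - f k x)\<^sup>2) \<partial>M) \<le> ennreal (4 * c / 4 ^ k)" .
qed

section \<open>Processes as functions on the product space\<close>

text \<open>Extension by zero outside \<open>[0, t]\<close> makes a process a function on all of \<open>lborel \<Otimes>\<^sub>M M\<close>,
  where Tonelli applies.\<close>

definition cut :: "real \<Rightarrow> (real \<Rightarrow> 'a \<Rightarrow> real) \<Rightarrow> real \<times> 'a \<Rightarrow> real" where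
  "cut t H = (\<lambda>(s, \<omega>). indicator {0..t} s * H s \<omega>)"

lemma measurable_process_iff_cut:
  "measurable_process M t H \<longleftrightarrow> cut t H \<in> borel_measurable (lborel \<Otimes>\<^sub>M M)"
proof
  assume H: "measurable_process M t H"
  let ?R = "restrict_space (lborel \<Otimes>\<^sub>M M) ({0..t} \<times> space M)"
  have "fst \<in> ?R \<rightarrow>\<^sub>M lborel" by (rule measurable_restrict_space1) measurable
  then have 1: "fst \<in> ?R \<rightarrow>\<^sub>M restrict_space borel {0..t}"
    by (intro measurable_restrict_space2) (auto simp: space_restrict_space)
  have 2: "snd \<in> ?R \<rightarrow>\<^sub>M M" by (rule measurable_restrict_space1) measurable
  have "(\<lambda>z. (fst z, snd z)) \<in> ?R \<rightarrow>\<^sub>M (restrict_space borel {0..t} \<Otimes>\<^sub>M M)"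
    by (intro measurable_Pair 1 2)
  from measurable_compose[OF this H[unfolded measurable_process_def case_prod_beta]]
  have "(\<lambda>z. H (fst z) (snd z)) \<in> borel_measurable ?R"
    unfolding fst_conv snd_conv .
  then have "(\<lambda>z. indicator ({0..t} \<times> space M) z *\<^sub>R H (fst z) (snd z)) \<in> borel_measurable (lborel \<Otimes>\<^sub>M M)"
    by (subst (asm) borel_measurable_restrict_space_iff) auto
  then show "cut t H \<in> borel_measurable (lborel \<Otimes>\<^sub>M M)"
    by (rule measurable_cong[THEN iffD1, rotated])
      (auto simp: cut_def space_pair_measure indicator_def)
next
  assume H: "cut t H \<in> borel_measurable (lborel \<Otimes>\<^sub>M M)"
  have "(\<lambda>z. (fst z, snd z)) \<in> (restrict_space borel {0..t} \<Otimes>\<^sub>M M) \<rightarrow>\<^sub>M (lborel \<Otimes>\<^sub>M M)"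
  proof (intro measurable_Pair)
    have "id \<in> restrict_space borel {0..t} \<rightarrow>\<^sub>M (borel :: real measure)"
      by (intro measurable_restrict_space1) simp
    from measurable_compose[OF measurable_fst this]
    show "fst \<in> restrict_space borel {0..t} \<Otimes>\<^sub>M M \<rightarrow>\<^sub>M lborel"
      unfolding id_def measurable_lborel1 .
  qed measurable
  from measurable_compose[OF this H]
  have "(\<lambda>z. cut t H z) \<in> borel_measurable (restrict_space borel {0..t} \<Otimes>\<^sub>M M)" by simp
  then show "measurable_process M t H"
    unfolding measurable_process_def
    by (rule measurable_cong[THEN iffD1, rotated])
      (auto simp: cut_def space_pair_measure space_restrict_space indicator_def)
qed

definition sq_dist :: "'a measure \<Rightarrow> real \<Rightarrow> (real \<Rightarrow> 'a \<Rightarrow> real) \<Rightarrow> (real \<Rightarrow> 'a \<Rightarrow> real) \<Rightarrow> ennreal" where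
  "sq_dist M t H G = (\<integral>\<^sup>+\<omega>. (\<integral>\<^sup>+s\<in>{0..t}. ennreal ((H s \<omega> - G s \<omega>)\<^sup>2) \<partial>lborel) \<partial>M)"

lemma cut_diff_square:
  "ennreal ((cut t H (s, \<omega>) - cut t G (s, \<omega>))\<^sup>2) = ennreal ((H s \<omega> - G s \<omega>)\<^sup>2) * indicator {0..t} s"
  by (auto simp: cut_def indicator_def)

lemma (in prob_space) 
  assumes H: "measurable_process M t H" and G: "measurable_process M t G"
  shows sq_dist_pair: "sq_dist M t H G = (\<integral>\<^sup>+z. ennreal ((cut t H z - cut t G z)\<^sup>2) \<partial>(lborel \<Otimes>\<^sub>M M))"
    and sq_dist_Fubini: "sq_dist M t H G = (\<integral>\<^sup>+s\<in>{0..t}. ms_dist M (H s) (G s) \<partial>lborel)"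
proof -
  interpret p: pair_sigma_finite lborel M ..
  have m[measurable]: "cut t H \<in> borel_measurable (lborel \<Otimes>\<^sub>M M)" "cut t G \<in> borel_measurable (lborel \<Otimes>\<^sub>M M)"
    using H G measurable_process_iff_cut by auto
  have mm: "(\<lambda>z. ennreal ((cut t H z - cut t G z)\<^sup>2)) \<in> borel_measurable (lborel \<Otimes>\<^sub>M M)" by measurable
  show 1: "sq_dist M t H G = (\<integral>\<^sup>+z. ennreal ((cut t H z - cut t G z)\<^sup>2) \<partial>(lborel \<Otimes>\<^sub>M M))"
    unfolding sq_dist_def using p.nn_integral_snd[OF mm] by (simp add: cut_diff_square)
  have "(\<integral>\<^sup>+z. ennreal ((cut t H z - cut t G z)\<^sup>2) \<partial>(lborel \<Otimes>\<^sub>M M)) =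
      (\<integral>\<^sup>+s. (\<integral>\<^sup>+\<omega>. ennreal ((cut t H (s, \<omega>) - cut t G (s, \<omega>))\<^sup>2) \<partial>M) \<partial>lborel)"
    by (rule nn_integral_fst[OF mm, symmetric])
  also have "\<dots> = (\<integral>\<^sup>+s\<in>{0..t}. ms_dist M (H s) (G s) \<partial>lborel)"
    by (intro nn_integral_cong) (auto simp: cut_def indicator_def)
  finally show "sq_dist M t H G = (\<integral>\<^sup>+s\<in>{0..t}. ms_dist M (H s) (G s) \<partial>lborel)"
    unfolding 1 .
qed

lemma sq_dist_commute: "sq_dist M t H G = sq_dist M t G H"
  unfolding sq_dist_def by (simp add: power2_commute)

lemma (in prob_space) sq_dist_triangle:
  assumes "measurable_process M t H" "measurable_process M t G" "measurable_process M t K"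
  shows "sq_dist M t H K \<le> 2 * (sq_dist M t H G + sq_dist M t G K)"
  unfolding sq_dist_pair[OF assms(1,2)] sq_dist_pair[OF assms(2,3)] sq_dist_pair[OF assms(1,3)]
  by (rule nn_integral_square_triangle) (use assms in \<open>simp_all add: measurable_process_iff_cut\<close>)

lemma (in prob_space) sq_dist_quadrilateral:
  assumes "measurable_process M t H" "measurable_process M t G" "measurable_process M t K" "measurable_process M t L"
  shows "sq_dist M t H L \<le> 4 * (sq_dist M t H G + sq_dist M t G K + sq_dist M t K L)"
  unfolding sq_dist_pair[OF assms(1,2)] sq_dist_pair[OF assms(2,3)] sq_dist_pair[OF assms(1,4)] sq_dist_pair[OF assms(3,4)]
  by (rule nn_integral_square_quadrilateral) (use assms in \<open>simp_all add: measurable_process_iff_cut\<close>)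

section \<open>The quasi-isometry of the Ito integral\<close>

lemma simple_data_mono:
  "simple_data M F u n \<tau> \<xi> \<Longrightarrow> u \<le> t \<Longrightarrow> simple_data M F t n \<tau> \<xi>"
  unfolding simple_data_def by force

lemma simple_data_node: "simple_data M F t n \<tau> \<xi> \<Longrightarrow> i \<le> n \<Longrightarrow> 0 \<le> \<tau> i \<and> \<tau> i \<le> t"
  unfolding simple_data_def by auto

lemma simple_data_step: "simple_data M F t n \<tau> \<xi> \<Longrightarrow> i < n \<Longrightarrow> \<tau> i \<le> \<tau> (Suc i)"
  unfolding simple_data_def by auto

lemma simple_process_outside:
  assumes "simple_data M F t n \<tau> \<xi>" "s \<notin> {0..t}"
  shows "simple_process n \<tau> \<xi> s \<omega> = 0"
proof -
  have "s \<notin> {\<tau> i<..\<tau> (Suc i)}" if "i < n" for i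
    using simple_data_node[OF assms(1), of i] simple_data_node[OF assms(1), of "Suc i"] assms(2) that
    by auto
  then show ?thesis unfolding simple_process_def by (intro sum.neutral) auto
qed

context brownian
begin

lemma simple_data_bounded_F:
  assumes "simple_data M F t n \<tau> \<xi>" "i < n" shows "bounded_F (\<tau> i) (\<xi> i)"
  using assms unfolding simple_data_def bounded_F_def by blast

lemma simple_data_measurable:
  assumes "simple_data M F t n \<tau> \<xi>" "i < n" "t \<le> T" shows "\<xi> i \<in> borel_measurable M"
  using simple_data_bounded_F[OF assms(1,2)] simple_data_node[OF assms(1), of i] assms(2,3)
    measurable_F_M[of "\<tau> i" "\<xi> i"]
  unfolding bounded_F_def by force

lemma simple_process_measurable:
  assumes sd: "simple_data M F u n \<tau> \<xi>" and "u \<le> T"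
  shows "measurable_process M t (simple_process n \<tau> \<xi>)"
proof -
  have [measurable]: "\<xi> i \<in> borel_measurable M" if "i < n" for i
    using simple_data_measurable[OF sd that assms(2)] .
  have "cut t (simple_process n \<tau> \<xi>) = (\<lambda>z. indicator {0..t} (fst z) *
      (\<Sum>i<n. \<xi> i (snd z) * indicator {\<tau> i<..\<tau> (Suc i)} (fst z)))"
    unfolding cut_def simple_process_def by auto
  also have "\<dots> \<in> borel_measurable (lborel \<Otimes>\<^sub>M M)"
    by (intro borel_measurable_times borel_measurable_sum) auto
  finally show ?thesis unfolding measurable_process_iff_cut .
qed

lemma simple_integral_measurable:
  assumes sd: "simple_data M F u n \<tau> \<xi>" and "u \<le> t" "t \<le> T" and "m \<le> n"
  shows "simple_integral B m \<tau> \<xi> \<in> borel_measurable (F t)"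
  unfolding simple_integral_def
proof (intro borel_measurable_sum borel_measurable_times borel_measurable_diff)
  fix i assume i: "i \<in> {..<m}"
  have b: "0 \<le> \<tau> i" "\<tau> i \<le> t" "0 \<le> \<tau> (Suc i)" "\<tau> (Suc i) \<le> t" "\<tau> i \<le> T" "\<tau> (Suc i) \<le> T"
    using simple_data_node[OF sd, of i] simple_data_node[OF sd, of "Suc i"] i assms by auto
  have "\<xi> i \<in> borel_measurable (F (\<tau> i))"
    using simple_data_bounded_F[OF sd, of i] i assms(4) unfolding bounded_F_def by auto
  then show "\<xi> i \<in> borel_measurable (F t)" by (rule measurable_F_mono[OF b(1,2) assms(3)])
  show "B (\<tau> i) \<in> borel_measurable (F t)" "B (\<tau> (Suc i)) \<in> borel_measurable (F t)"
    by (rule measurable_F_mono[OF b(1,2) assms(3) B_adapted[OF b(1,5)]]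
       measurable_F_mono[OF b(3,4) assms(3) B_adapted[OF b(3,6)]])+
qed

lemma simple_integral_measurable_M:
  assumes sd: "simple_data M F t n \<tau> \<xi>" and "0 \<le> t" "t \<le> T"
  shows "simple_integral B n \<tau> \<xi> \<in> borel_measurable M"
  by (rule measurable_F_M[OF assms(2,3) simple_integral_measurable[OF sd _ assms(3)]]) auto

lemma simple_isometry:
  assumes sd: "simple_data M F t n \<tau> \<xi>" and sd': "simple_data M F t m \<upsilon> \<eta>" and "t \<le> T"
  shows "ms_dist M (simple_integral B n \<tau> \<xi>) (simple_integral B m \<upsilon> \<eta>) =
    sq_dist M t (simple_process n \<tau> \<xi>) (simple_process m \<upsilon> \<eta>)"
proof -
  let ?I = "{..<n} <+> {..<m}"
  define a where "a = case_sum \<tau> \<upsilon>"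
  define b where "b = case_sum (\<lambda>i. \<tau> (Suc i)) (\<lambda>i. \<upsilon> (Suc i))"
  define \<zeta> where "\<zeta> = case_sum \<xi> (\<lambda>i \<omega>. - \<eta> i \<omega>)"
  have bnds: "0 \<le> a i \<and> a i \<le> b i \<and> b i \<le> T" if "i \<in> ?I" for i
    using that
  proof (rule PlusE)
    fix k assume k: "k \<in> {..<n}" "i = Inl k"
    then show ?thesis
      using simple_data_node[OF sd, of k] simple_data_step[OF sd, of k] simple_data_node[OF sd, of "Suc k"]
        assms(3) by (simp add: a_def b_def)
  next
    fix k assume k: "k \<in> {..<m}" "i = Inr k"
    then show ?thesis
      using simple_data_node[OF sd', of k] simple_data_step[OF sd', of k] simple_data_node[OF sd', of "Suc k"]
        assms(3) by (simp add: a_def b_def)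
  qed
  have neg: "bounded_F (\<upsilon> i) (\<lambda>\<omega>. - \<eta> i \<omega>)" if "i < m" for i
  proof -
    have "\<eta> i \<in> borel_measurable (F (\<upsilon> i))" "\<exists>K. \<forall>\<omega>\<in>space M. \<bar>- \<eta> i \<omega>\<bar> \<le> K"
      using simple_data_bounded_F[OF sd' that] unfolding bounded_F_def abs_minus_cancel by blast+
    then show ?thesis unfolding bounded_F_def by (intro conjI borel_measurable_uminus)
  qed
  have bF: "bounded_F (a i) (\<zeta> i)" if "i \<in> ?I" for i
    using that
  proof (rule PlusE)
    fix k assume k: "k \<in> {..<n}" "i = Inl k"
    then show ?thesis using simple_data_bounded_F[OF sd, of k] by (simp add: a_def \<zeta>_def)
  next
    fix k assume k: "k \<in> {..<m}" "i = Inr k"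
    then show ?thesis using neg[of k] by (simp add: a_def \<zeta>_def)
  qed
  have 1: "(\<Sum>i\<in>?I. \<zeta> i \<omega> * (B (b i) \<omega> - B (a i) \<omega>)) =
      simple_integral B n \<tau> \<xi> \<omega> - simple_integral B m \<upsilon> \<eta> \<omega>" for \<omega>
    unfolding simple_integral_def \<zeta>_def a_def b_def sum.Plus[OF finite_lessThan finite_lessThan]
      comp_def sum.case mult_minus_left sum_negf by (rule diff_conv_add_uminus[symmetric])
  have 2: "(\<Sum>i\<in>?I. \<zeta> i \<omega> * indicator {a i<..b i} s) =
      simple_process n \<tau> \<xi> s \<omega> - simple_process m \<upsilon> \<eta> s \<omega>" for s \<omega>
    unfolding simple_process_def \<zeta>_def a_def b_def sum.Plus[OF finite_lessThan finite_lessThan]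
      comp_def sum.case mult_minus_left sum_negf by (rule diff_conv_add_uminus[symmetric])
  have 3: "ennreal ((simple_process n \<tau> \<xi> s \<omega> - simple_process m \<upsilon> \<eta> s \<omega>)\<^sup>2) =
     ennreal ((simple_process n \<tau> \<xi> s \<omega> - simple_process m \<upsilon> \<eta> s \<omega>)\<^sup>2) * indicator {0..t} s" for s \<omega>
    by (cases "s \<in> {0..t}") (simp_all add: simple_process_outside[OF sd] simple_process_outside[OF sd'])
  have "finite ?I" by simp
  from isometry_finite_sum[of ?I a b \<zeta>, OF this bnds bF]
  show ?thesis unfolding 1 2 sq_dist_def 3[symmetric] .
qed

text \<open>The isometry holds for the approximating simple integrals and passes to the limit. The
  factor \<open>16 = 4 * 4\<close> stems from two quadrilateral inequalities, one for the integrals and one for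
  the integrands.\<close>

lemma has_ito_integral_square_dist:
  assumes H: "has_ito_integral M F B t H I" and G: "has_ito_integral M F B t G J"
    and t: "0 \<le> t" "t \<le> T"
  shows "ms_dist M I J \<le> 16 * sq_dist M t H G"
proof -
  obtain n \<tau> \<xi> where sd: "\<And>k. simple_data M F t (n k) (\<tau> k) (\<xi> k)"
    and e: "(\<lambda>k. sq_dist M t H (simple_process (n k) (\<tau> k) (\<xi> k))) \<longlonglongrightarrow> 0"
    and a: "(\<lambda>k. ms_dist M I (simple_integral B (n k) (\<tau> k) (\<xi> k))) \<longlonglongrightarrow> 0"
    using H unfolding has_ito_integral_def sq_dist_def by blast
  obtain m \<upsilon> \<eta> where sd': "\<And>k. simple_data M F t (m k) (\<upsilon> k) (\<eta> k)"
    and e': "(\<lambda>k. sq_dist M t G (simple_process (m k) (\<upsilon> k) (\<eta> k))) \<longlonglongrightarrow> 0"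
    and b: "(\<lambda>k. ms_dist M J (simple_integral B (m k) (\<upsilon> k) (\<eta> k))) \<longlonglongrightarrow> 0"
    using G unfolding has_ito_integral_def sq_dist_def by blast
  have mp: "measurable_process M t H" "measurable_process M t G"
    and [measurable]: "I \<in> borel_measurable M" "J \<in> borel_measurable M"
    using H G unfolding has_ito_integral_def by blast+
  let ?D = "sq_dist M t H G"
  let ?a = "\<lambda>k. ms_dist M I (simple_integral B (n k) (\<tau> k) (\<xi> k))"
  let ?b = "\<lambda>k. ms_dist M J (simple_integral B (m k) (\<upsilon> k) (\<eta> k))"
  let ?e = "\<lambda>k. sq_dist M t H (simple_process (n k) (\<tau> k) (\<xi> k))"
  let ?e' = "\<lambda>k. sq_dist M t G (simple_process (m k) (\<upsilon> k) (\<eta> k))"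
  have le: "ms_dist M I J \<le> 4 * (?a k + 4 * (?e k + ?D + ?e' k) + ?b k)" for k
  proof -
    have [measurable]: "simple_integral B (n k) (\<tau> k) (\<xi> k) \<in> borel_measurable M"
      "simple_integral B (m k) (\<upsilon> k) (\<eta> k) \<in> borel_measurable M"
      using simple_integral_measurable_M sd sd' t by blast+
    have s: "measurable_process M t (simple_process (n k) (\<tau> k) (\<xi> k))"
      "measurable_process M t (simple_process (m k) (\<upsilon> k) (\<eta> k))"
      using simple_process_measurable sd sd' t(2) by blast+
    have "ms_dist M I J \<le> 4 * (?a k +
        ms_dist M (simple_integral B (n k) (\<tau> k) (\<xi> k)) (simple_integral B (m k) (\<upsilon> k) (\<eta> k))
        + ms_dist M (simple_integral B (m k) (\<upsilon> k) (\<eta> k)) J)"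
      by (rule nn_integral_square_quadrilateral) measurable
    also have "\<dots> = 4 * (?a k + sq_dist M t (simple_process (n k) (\<tau> k) (\<xi> k)) (simple_process (m k) (\<upsilon> k) (\<eta> k)) + ?b k)"
      unfolding simple_isometry[OF sd sd' t(2)] by (simp add: power2_commute)
    also have "\<dots> \<le> 4 * (?a k + 4 * (sq_dist M t (simple_process (n k) (\<tau> k) (\<xi> k)) H + ?D + ?e' k) +
        ?b k)"
      by (intro mult_left_mono add_left_mono add_right_mono sq_dist_quadrilateral mp s) auto
    finally show ?thesis by (simp add: sq_dist_commute)
  qed
  have "(\<lambda>k. 4 * (?a k + 4 * (?e k + ?D + ?e' k) + ?b k)) \<longlonglongrightarrow> 4 * (0 + 4 * (0 + ?D + 0) + 0)"
    by (intro ennreal_tendsto_cmult tendsto_add a b e e' tendsto_const) auto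
  then have "ms_dist M I J \<le> 4 * (0 + 4 * (0 + ?D + 0) + 0)"
    by (rule LIMSEQ_le_const) (use le in blast)
  then show ?thesis by (simp flip: mult.assoc)
qed

lemma has_ito_integral_AE_unique:
  assumes "has_ito_integral M F B t H I" "has_ito_integral M F B t H J" "0 \<le> t" "t \<le> T"
  shows "AE \<omega> in M. I \<omega> = J \<omega>"
proof (rule AE_eq_if_square_dist_zero)
  show "ms_dist M I J = 0"
    using has_ito_integral_square_dist[OF assms] by (simp add: sq_dist_def)
qed (use assms in \<open>simp_all add: has_ito_integral_def\<close>)

text \<open>This puts integrals over \<open>[0, u]\<close> and over \<open>[0, t]\<close> on a common interval, so that their
  distance can be estimated.\<close>

lemma has_ito_integral_extend:
  assumes H: "has_ito_integral M F B u H I" and ut: "0 \<le> u" "u \<le> t" "t \<le> T"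
  shows "has_ito_integral M F B t (\<lambda>s \<omega>. indicator {0..u} s * H s \<omega>) I"
proof -
  obtain n \<tau> \<xi> where sd: "\<And>k. simple_data M F u (n k) (\<tau> k) (\<xi> k)"
    and e: "(\<lambda>k. sq_dist M u H (simple_process (n k) (\<tau> k) (\<xi> k))) \<longlonglongrightarrow> 0"
    and a: "(\<lambda>k. ms_dist M I (simple_integral B (n k) (\<tau> k) (\<xi> k))) \<longlonglongrightarrow> 0"
    and I: "I \<in> borel_measurable M"
    and mp: "measurable_process M u H" and ad: "adapted_process F u H"
    using H unfolding has_ito_integral_def sq_dist_def by blast
  have "cut t (\<lambda>s \<omega>. indicator {0..u} s * H s \<omega>) = cut u H"
    using ut by (auto simp: cut_def indicator_def fun_eq_iff)
  then have 1: "measurable_process M t (\<lambda>s \<omega>. indicator {0..u} s * H s \<omega>)"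
    using mp unfolding measurable_process_iff_cut by simp
  have 2: "adapted_process F t (\<lambda>s \<omega>. indicator {0..u} s * H s \<omega>)"
    unfolding adapted_process_def
  proof
    fix s assume "s \<in> {0..t}"
    show "(\<lambda>\<omega>. indicator {0..u} s * H s \<omega>) \<in> borel_measurable (F s)"
    proof (cases "s \<in> {0..u}")
      case True
      then have "H s \<in> borel_measurable (F s)" using ad unfolding adapted_process_def by blast
      then show ?thesis by (intro borel_measurable_times) auto
    qed simp
  qed
  have "sq_dist M t (\<lambda>s \<omega>. indicator {0..u} s * H s \<omega>) (simple_process (n k) (\<tau> k) (\<xi> k)) =
     sq_dist M u H (simple_process (n k) (\<tau> k) (\<xi> k))" for k
    unfolding sq_dist_def
  proof (intro nn_integral_cong)
    fix \<omega> s
    show "ennreal ((indicator {0..u} s * H s \<omega> - simple_process (n k) (\<tau> k) (\<xi> k) s \<omega>)\<^sup>2) * indicator {0..t} s =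
      ennreal ((H s \<omega> - simple_process (n k) (\<tau> k) (\<xi> k) s \<omega>)\<^sup>2) * indicator {0..u} s"
    proof (cases "s \<in> {0..u}")
      case False
      then show ?thesis using simple_process_outside[OF sd False] by simp
    qed (use ut in auto)
  qed
  then have "(\<lambda>k. sq_dist M t (\<lambda>s \<omega>. indicator {0..u} s * H s \<omega>) (simple_process (n k) (\<tau> k) (\<xi> k))) \<longlonglongrightarrow> 0"
    using e by simp
  moreover have "\<And>k. simple_data M F t (n k) (\<tau> k) (\<xi> k)" using sd ut(2) simple_data_mono by blast
  ultimately show ?thesis
    unfolding has_ito_integral_def using 1 2 I a unfolding sq_dist_def by blast
qed

end

section \<open>Exponential moments\<close>

text \<open>The right-hand side is the chord of a convex function. Its merit is that it is affine in
  \<open>z\<close>: the random coefficient and the Brownian increment separate into products of independent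
  factors.\<close>

lemma exp_le_chord:
  fixes c z x :: real
  assumes "0 < c" "\<bar>z\<bar> \<le> c"
  shows "exp (z * x) \<le> cosh (c * x) + z / c * sinh (c * x)"
proof -
  let ?t = "(c - z) / (2 * c)"
  have "exp ((1 - ?t) *\<^sub>R (c * x) + ?t *\<^sub>R (- (c * x))) \<le> (1 - ?t) * exp (c * x) + ?t * exp (- (c * x))"
    using assms by (intro convex_onD[OF exp_convex]) (auto simp: field_simps)
  moreover have "(1 - ?t) *\<^sub>R (c * x) + ?t *\<^sub>R (- (c * x)) = z * x"
    using assms by (simp add: field_simps)
  moreover have "(1 - ?t) * exp (c * x) + ?t * exp (- (c * x)) = cosh (c * x) + z / c * sinh (c * x)"
    using assms by (simp add: cosh_field_def sinh_field_def field_simps)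
  ultimately show ?thesis by simp
qed

lemma has_bochner_integral_normal_exp:
  assumes "0 < \<sigma>"
  shows "has_bochner_integral lborel (\<lambda>x. normal_density 0 \<sigma> x * exp (c * x)) (exp (c\<^sup>2 * \<sigma>\<^sup>2 / 2))"
proof -
  have "normal_density 0 \<sigma> x * exp (c * x) = exp (c\<^sup>2 * \<sigma>\<^sup>2 / 2) * normal_density (c * \<sigma>\<^sup>2) \<sigma> x" for x
  proof -
    \<comment> \<open>Completing the square.\<close>
    have "- (x - 0)\<^sup>2 / (2 * \<sigma>\<^sup>2) + c * x = c\<^sup>2 * \<sigma>\<^sup>2 / 2 + - (x - c * \<sigma>\<^sup>2)\<^sup>2 / (2 * \<sigma>\<^sup>2)"
      using assms by (simp add: field_simps power2_eq_square)
    then have "exp (- (x - 0)\<^sup>2 / (2 * \<sigma>\<^sup>2)) * exp (c * x) =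
        exp (c\<^sup>2 * \<sigma>\<^sup>2 / 2) * exp (- (x - c * \<sigma>\<^sup>2)\<^sup>2 / (2 * \<sigma>\<^sup>2))"
      by (simp only: flip: exp_add)
    then show ?thesis unfolding normal_density_def by (simp add: mult.left_commute mult.commute)
  qed
  moreover have "has_bochner_integral lborel (\<lambda>x. exp (c\<^sup>2 * \<sigma>\<^sup>2 / 2) * normal_density (c * \<sigma>\<^sup>2) \<sigma> x)
      (exp (c\<^sup>2 * \<sigma>\<^sup>2 / 2) * 1)"
    using assms by (intro has_bochner_integral_mult_right) (simp add: has_bochner_integral_iff)
  ultimately show ?thesis by simp
qed

lemma
  assumes "0 < \<sigma>"
  shows has_bochner_integral_normal_cosh:
      "has_bochner_integral lborel (\<lambda>x. normal_density 0 \<sigma> x * cosh (c * x)) (exp (c\<^sup>2 * \<sigma>\<^sup>2 / 2))"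
    and has_bochner_integral_normal_sinh:
      "has_bochner_integral lborel (\<lambda>x. normal_density 0 \<sigma> x * sinh (c * x)) 0"
proof -
  note e = has_bochner_integral_normal_exp[OF assms, of c] has_bochner_integral_normal_exp[OF assms, of "- c"]
  have "has_bochner_integral lborel (\<lambda>x. (normal_density 0 \<sigma> x * exp (c * x) +
      normal_density 0 \<sigma> x * exp (- c * x)) / 2)
     ((exp (c\<^sup>2 * \<sigma>\<^sup>2 / 2) + exp ((- c)\<^sup>2 * \<sigma>\<^sup>2 / 2)) / 2)"
    by (intro has_bochner_integral_divide_zero has_bochner_integral_add e)
  then show "has_bochner_integral lborel (\<lambda>x. normal_density 0 \<sigma> x * cosh (c * x)) (exp (c\<^sup>2 * \<sigma>\<^sup>2 / 2))"
    by (simp add: cosh_field_def distrib_left)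
  have "has_bochner_integral lborel (\<lambda>x. (normal_density 0 \<sigma> x * exp (c * x) - normal_density 0 \<sigma> x * exp (- c * x)) / 2)
     ((exp (c\<^sup>2 * \<sigma>\<^sup>2 / 2) - exp ((- c)\<^sup>2 * \<sigma>\<^sup>2 / 2)) / 2)"
    by (intro has_bochner_integral_divide_zero has_bochner_integral_diff e)
  then show "has_bochner_integral lborel (\<lambda>x. normal_density 0 \<sigma> x * sinh (c * x)) 0"
    by (simp add: sinh_field_def right_diff_distrib)
qed

lemma powr_le_exp:
  fixes p y :: real
  assumes "0 < p" "0 \<le> y" shows "y powr p \<le> p powr p * exp y"
proof -
  have "y / p \<le> exp (y / p)" by (rule order_trans[OF _ exp_ge_add_one_self]) simp
  then have "y \<le> p * exp (y / p)" using assms by (simp add: field_simps)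
  then have "y powr p \<le> (p * exp (y / p)) powr p" using assms by (intro powr_mono2) auto
  also have "\<dots> = p powr p * exp y" using assms by (simp add: powr_mult exp_powr_real)
  finally show ?thesis .
qed

context brownian
begin

text \<open>Each step multiplies the exponential moment by at most
  \<open>exp ((c i)\<^sup>2 * (\<tau> (Suc i) - \<tau> i) / 2)\<close>, which is the value for the constant coefficient \<open>c i\<close>:
  of the two terms of the chord, the one with \<open>sinh\<close> has mean zero.\<close>

lemma simple_integral_exp_moment:
  assumes sd: "simple_data M F t n \<tau> \<xi>" and "t \<le> T"
    and c: "\<And>i \<omega>. i < n \<Longrightarrow> \<omega> \<in> space M \<Longrightarrow> \<bar>\<xi> i \<omega>\<bar> \<le> c i" "\<And>i. i < n \<Longrightarrow> 0 < c i"
    and "m \<le> n"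
  shows "integrable M (\<lambda>\<omega>. exp (simple_integral B m \<tau> \<xi> \<omega>)) \<and>
    expectation (\<lambda>\<omega>. exp (simple_integral B m \<tau> \<xi> \<omega>)) \<le> exp (\<Sum>i<m. (c i)\<^sup>2 * (\<tau> (Suc i) - \<tau> i) / 2)"
  using \<open>m \<le> n\<close>
proof (induction m)
  case 0
  then show ?case by (simp add: simple_integral_def prob_space)
next
  case (Suc m)
  define Y where "Y = (\<lambda>\<omega>. exp (simple_integral B m \<tau> \<xi> \<omega>))"
  define D where "D = (\<lambda>\<omega>. B (\<tau> (Suc m)) \<omega> - B (\<tau> m) \<omega>)"
  have m: "m < n" "m \<le> n" "Suc m \<le> n" using Suc.prems by auto
  have b: "0 \<le> \<tau> m" "\<tau> m \<le> \<tau> (Suc m)" "\<tau> (Suc m) \<le> T" "\<tau> m \<le> T" "0 \<le> \<tau> (Suc m)"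
    using simple_data_node[OF sd m(2)] simple_data_node[OF sd m(3)] simple_data_step[OF sd m(1)] assms(2)
    by auto
  have Yi: "integrable M Y" and YE: "expectation Y \<le> exp (\<Sum>i<m. (c i)\<^sup>2 * (\<tau> (Suc i) - \<tau> i) / 2)"
    using Suc.IH m(2) by (auto simp: Y_def)
  have S: "exp (simple_integral B (Suc m) \<tau> \<xi> \<omega>) = Y \<omega> * exp (\<xi> m \<omega> * D \<omega>)" for \<omega>
    by (simp add: simple_integral_def Y_def D_def exp_add)
  show ?case
  proof (cases "\<tau> m = \<tau> (Suc m)")
    case True
    then have "D = (\<lambda>\<omega>. 0)" by (simp add: D_def)
    then show ?thesis unfolding S using Yi YE True by simp
  next
    case False
    then have lt: "\<tau> m < \<tau> (Suc m)" using b by simp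
    let ?\<sigma> = "sqrt (\<tau> (Suc m) - \<tau> m)"
    have \<sigma>: "0 < ?\<sigma>" using lt by simp
    have "simple_data M F (\<tau> m) m \<tau> \<xi>"
    proof -
      have "\<tau> i \<le> \<tau> m" if "i \<le> m" for i
        using that m(1)
      proof (induction m)
        case (Suc k)
        then show ?case using simple_data_step[OF sd, of k] by (cases "i =
            Suc k") (auto intro: order_trans)
      qed simp
      then show ?thesis using sd m unfolding simple_data_def by auto
    qed
    then have "simple_integral B m \<tau> \<xi> \<in> borel_measurable (F (\<tau> m))"
      by (rule simple_integral_measurable) (use b in auto)
    then have Ym: "Y \<in> borel_measurable (F (\<tau> m))" unfolding Y_def by measurable
    have \<xi>m: "\<xi> m \<in> borel_measurable (F (\<tau> m))"
      using simple_data_bounded_F[OF sd m(1)] unfolding bounded_F_def by blast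
    define Z where "Z = (\<lambda>\<omega>. Y \<omega> * (\<xi> m \<omega> / c m))"
    have Zm: "Z \<in> borel_measurable (F (\<tau> m))" unfolding Z_def
      by (intro borel_measurable_times borel_measurable_divide Ym \<xi>m) auto
    have [measurable]: "Y \<in> borel_measurable M" "\<xi> m \<in> borel_measurable M" "Z \<in> borel_measurable M" "D \<in> borel_measurable M"
      using measurable_F_M[OF b(1,4)] Ym \<xi>m Zm B_measurable[OF b(1,4)] B_measurable[OF b(5,3)]
      by (auto simp: D_def intro!: borel_measurable_diff)
    have Zi: "integrable M Z"
    proof (rule Bochner_Integration.integrable_bound[OF Yi])
      show "AE \<omega> in M. norm (Z \<omega>) \<le> norm (Y \<omega>)"
      proof (intro AE_I2)
        fix \<omega> assume w: "\<omega> \<in> space M"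
        have "\<bar>\<xi> m \<omega> / c m\<bar> \<le> 1" using c(1)[OF m(1) w] c(2)[OF m(1)] by (simp add: abs_divide)
        then have "\<bar>Y \<omega>\<bar> * \<bar>\<xi> m \<omega> / c m\<bar> \<le> \<bar>Y \<omega>\<bar> * 1" by (intro mult_left_mono) auto
        then show "norm (Z \<omega>) \<le> norm (Y \<omega>)" by (simp add: Z_def abs_mult)
      qed
    qed simp
    have mc: "(\<lambda>x::real. cosh (c m * x)) \<in> borel_measurable borel" "(\<lambda>x::real. sinh (c m * x)) \<in> borel_measurable borel"
      by (intro borel_measurable_continuous_onI continuous_intros)+
    have ic: "integrable lborel (\<lambda>x. normal_density 0 ?\<sigma> x * cosh (c m * x))"
      "(\<integral>x. normal_density 0 ?\<sigma> x * cosh (c m * x) \<partial>lborel) = exp ((c m)\<^sup>2 * ?\<sigma>\<^sup>2 / 2)"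
      using has_bochner_integral_normal_cosh[OF \<sigma>] unfolding has_bochner_integral_iff by blast+
    have sh: "integrable lborel (\<lambda>x. normal_density 0 ?\<sigma> x * sinh (c m * x))"
      "(\<integral>x. normal_density 0 ?\<sigma> x * sinh (c m * x) \<partial>lborel) = 0"
      using has_bochner_integral_normal_sinh[OF \<sigma>] unfolding has_bochner_integral_iff by blast+
    note i1 = integrable_increment_product[OF b(1) lt b(3) Ym Yi mc(1) ic(1), folded D_def]
    note e1 = expectation_increment_product[OF b(1) lt b(3) Ym Yi mc(1) ic(1), folded D_def]
    note i2 = integrable_increment_product[OF b(1) lt b(3) Zm Zi mc(2) sh(1), folded D_def]
    note e2 = expectation_increment_product[OF b(1) lt b(3) Zm Zi mc(2) sh(1), folded D_def]
    have i1': "integrable M (\<lambda>\<omega>. Y \<omega> * cosh (c m * D \<omega>))" using i1 by (simp add: D_def)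
    have i2': "integrable M (\<lambda>\<omega>. Z \<omega> * sinh (c m * D \<omega>))" using i2 by (simp add: D_def)
    have le: "Y \<omega> * exp (\<xi> m \<omega> * D \<omega>) \<le> Y \<omega> * cosh (c m * D \<omega>) + Z \<omega> * sinh (c m * D \<omega>)"
      if "\<omega> \<in> space M" for \<omega>
    proof -
      have "Y \<omega> * exp (\<xi> m \<omega> * D \<omega>) \<le> Y \<omega> * (cosh (c m * D \<omega>) + \<xi> m \<omega> / c m * sinh (c m * D \<omega>))"
        using exp_le_chord[OF c(2)[OF m(1)] c(1)[OF m(1) that]]
            by (intro mult_left_mono) (auto simp: Y_def)
      then show ?thesis by (simp add: Z_def algebra_simps)
    qed
    have int: "integrable M (\<lambda>\<omega>. Y \<omega> * exp (\<xi> m \<omega> * D \<omega>))"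
    proof (rule Bochner_Integration.integrable_bound[OF Bochner_Integration.integrable_add[OF i1' i2']])
      show "AE \<omega> in M. norm (Y \<omega> * exp (\<xi> m \<omega> * D \<omega>)) \<le> norm (Y \<omega> * cosh (c m * D \<omega>) +
          Z \<omega> * sinh (c m * D \<omega>))"
      proof (intro AE_I2)
        fix \<omega> assume "\<omega> \<in> space M"
        moreover have "0 \<le> Y \<omega> * exp (\<xi> m \<omega> * D \<omega>)" by (simp add: Y_def)
        ultimately show "norm (Y \<omega> * exp (\<xi> m \<omega> * D \<omega>)) \<le> norm (Y \<omega> * cosh (c m * D \<omega>) +
            Z \<omega> * sinh (c m * D \<omega>))"
          using le[of \<omega>] unfolding real_norm_def by linarith
      qed
    qed simp
    have "expectation (\<lambda>\<omega>. Y \<omega> * exp (\<xi> m \<omega> * D \<omega>)) \<le>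
        expectation (\<lambda>\<omega>. Y \<omega> * cosh (c m * D \<omega>) + Z \<omega> * sinh (c m * D \<omega>))"
      by (rule integral_mono[OF int Bochner_Integration.integrable_add[OF i1' i2'] le])
    also have "\<dots> = expectation (\<lambda>\<omega>. Y \<omega> * cosh (c m * D \<omega>)) + expectation (\<lambda>\<omega>. Z \<omega> * sinh (c m * D \<omega>))"
      by (rule Bochner_Integration.integral_add[OF i1' i2'])
    also have "\<dots> = expectation Y * exp ((c m)\<^sup>2 * ?\<sigma>\<^sup>2 / 2)"
      using e1 e2 unfolding ic(2) sh(2) by (simp add: D_def)
    also have "?\<sigma>\<^sup>2 = \<tau> (Suc m) - \<tau> m" using lt by simp
    also have "expectation Y * exp ((c m)\<^sup>2 * (\<tau> (Suc m) - \<tau> m) / 2) \<le>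
        exp (\<Sum>i<m. (c i)\<^sup>2 * (\<tau> (Suc i) - \<tau> i) / 2) * exp ((c m)\<^sup>2 * (\<tau> (Suc m) - \<tau> m) / 2)"
      by (intro mult_right_mono YE) auto
    also have "\<dots> = exp (\<Sum>i<Suc m. (c i)\<^sup>2 * (\<tau> (Suc i) - \<tau> i) / 2)"
      by (simp add: exp_add)
    finally show ?thesis unfolding S using int by blast
  qed
qed

text \<open>The bound depends on the integrand only through \<open>V\<close>, for every order \<open>p\<close>; this is what makes
  the constant of the moment estimate uniform.\<close>

lemma simple_integral_abs_moment:
  assumes sd: "simple_data M F t n \<tau> \<xi>" and t: "0 \<le> t" "t \<le> T"
    and c: "\<And>i \<omega>. i < n \<Longrightarrow> \<omega> \<in> space M \<Longrightarrow> \<bar>\<xi> i \<omega>\<bar> \<le> c i" "\<And>i. i < n \<Longrightarrow> 0 < c i"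
    and V: "(\<Sum>i<n. (c i)\<^sup>2 * (\<tau> (Suc i) - \<tau> i)) \<le> V" and p: "0 < p"
  shows "abs_moment M p (simple_integral B n \<tau> \<xi>) \<le> ennreal (2 * p powr p * exp (V / 2))"
proof -
  define S where "S = simple_integral B n \<tau> \<xi>"
  have Sm[measurable]: "S \<in> borel_measurable M"
    unfolding S_def using simple_integral_measurable_M[OF sd t] .
  have V': "exp (\<Sum>i<n. (c i)\<^sup>2 * (\<tau> (Suc i) - \<tau> i) / 2) \<le> exp (V / 2)"
    using V by (simp flip: sum_divide_distrib)
  have 1: "integrable M (\<lambda>\<omega>. exp (S \<omega>))" "expectation (\<lambda>\<omega>. exp (S \<omega>)) \<le> exp (V / 2)"
    using simple_integral_exp_moment[OF sd t(2) c, of n] order_trans[OF _ V'] unfolding S_def by blast+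
  have sd': "simple_data M F t n \<tau> (\<lambda>i \<omega>. - \<xi> i \<omega>)"
    using sd unfolding simple_data_def abs_minus_cancel
    by (intro conjI) (blast intro: borel_measurable_uminus)+
  have neg: "simple_integral B n \<tau> (\<lambda>i \<omega>. - \<xi> i \<omega>) = (\<lambda>\<omega>. - S \<omega>)"
    unfolding S_def simple_integral_def by (simp add: sum_negf)
  have 2: "integrable M (\<lambda>\<omega>. exp (- S \<omega>))" "expectation (\<lambda>\<omega>. exp (- S \<omega>)) \<le> exp (V / 2)"
    using simple_integral_exp_moment[OF sd' t(2), of c n] c order_trans[OF _ V']
    unfolding neg abs_minus_cancel by blast+
  have "abs_moment M p S \<le> (\<integral>\<^sup>+\<omega>. ennreal (p powr p * (exp (S \<omega>) + exp (- S \<omega>))) \<partial>M)"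
    unfolding abs_moment_def
  proof (intro nn_integral_mono ennreal_leI)
    fix \<omega>
    have "exp \<bar>S \<omega>\<bar> \<le> exp (S \<omega>) + exp (- S \<omega>)" by (cases "0 \<le> S \<omega>") auto
    then have "p powr p * exp \<bar>S \<omega>\<bar> \<le> p powr p * (exp (S \<omega>) + exp (- S \<omega>))"
      by (intro mult_left_mono) auto
    with powr_le_exp[OF p, of "\<bar>S \<omega>\<bar>"]
    show "\<bar>S \<omega>\<bar> powr p \<le> p powr p * (exp (S \<omega>) + exp (- S \<omega>))" by simp
  qed
  also have "\<dots> = ennreal (expectation (\<lambda>\<omega>. p powr p * (exp (S \<omega>) + exp (- S \<omega>))))"
    using 1 2 by (intro nn_integral_eq_integral) auto
  also have "expectation (\<lambda>\<omega>. p powr p * (exp (S \<omega>) + exp (- S \<omega>))) =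
      p powr p * (expectation (\<lambda>\<omega>. exp (S \<omega>)) + expectation (\<lambda>\<omega>. exp (- S \<omega>)))"
    using 1 2 by simp
  also have "ennreal \<dots> \<le> ennreal (2 * p powr p * exp (V / 2))"
  proof (intro ennreal_leI)
    have "p powr p * (expectation (\<lambda>\<omega>. exp (S \<omega>)) + expectation (\<lambda>\<omega>. exp (- S \<omega>))) \<le>
        p powr p * (exp (V / 2) + exp (V / 2))"
      using 1 2 by (intro mult_left_mono add_mono) auto
    then show "p powr p * (expectation (\<lambda>\<omega>. exp (S \<omega>)) + expectation (\<lambda>\<omega>. exp (- S \<omega>))) \<le>
        2 * p powr p * exp (V / 2)" by simp
  qed
  finally show ?thesis unfolding S_def .
qed

end

section \<open>Mean square continuity of translations\<close>

lemma nn_integral_lborel_shift: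
  assumes [measurable]: "f \<in> borel_measurable (borel :: real measure)"
  shows "(\<integral>\<^sup>+x. f (x + v) \<partial>lborel) = (\<integral>\<^sup>+x. f x \<partial>lborel)"
  using nn_integral_real_affine[of f 1 v] by (simp add: add.commute)

lemma square_diff_le_of_bounded:
  fixes a b K :: real
  assumes "\<bar>a\<bar> \<le> K" "\<bar>b\<bar> \<le> K" shows "(a - b)\<^sup>2 \<le> (2 * K)\<^sup>2"
proof -
  have "\<bar>a - b\<bar> \<le> \<bar>2 * K\<bar>" using assms by linarith
  then show ?thesis by (rule abs_le_square_iff[THEN iffD1])
qed

lemma bounded_continuous_approximation:
  fixes f :: "real \<Rightarrow> real"
  assumes f[measurable]: "f \<in> borel_measurable borel" and K: "\<And>x. \<bar>f x\<bar> \<le> K"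
    and supp: "\<And>x. x \<notin> {0..t} \<Longrightarrow> f x = 0" and "0 \<le> t"
  obtains g where "\<And>n. continuous_on UNIV (g n)" "\<And>n x. \<bar>g n x\<bar> \<le> K"
    "\<And>n x. x \<notin> {-1..t+1} \<Longrightarrow> g n x = 0"
    "(\<lambda>n. ms_dist lborel f (g n)) \<longlonglongrightarrow> 0"
proof -
  have "f measurable_on UNIV"
    by (rule lebesgue_measurable_imp_measurable_on) (simp_all add: measurable_completion)
  then obtain N h where N: "negligible N" and h: "\<And>n. continuous_on UNIV (h n)"
    and lim: "\<And>x. x \<notin> N \<Longrightarrow> (\<lambda>n. h n x) \<longlonglongrightarrow> f x"
    unfolding measurable_on_def by auto
  have K0: "0 \<le> K" using K[of 0] by linarith
  \<comment> \<open>A trapezoid: 1 on \<open>[0, t]\<close> and 0 outside \<open>[-1, t + 1]\<close>.\<close>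
  define \<theta> where "\<theta> = (\<lambda>x. max 0 (min 1 (1 + min x (t - x))))"
  define g where "g = (\<lambda>n x. \<theta> x * max (-K) (min K (h n x)))"
  have \<theta>: "0 \<le> \<theta> x" "\<theta> x \<le> 1" for x by (auto simp: \<theta>_def)
  have gc: "continuous_on UNIV (g n)" for n
    unfolding g_def \<theta>_def
    by (intro continuous_intros continuous_on_max continuous_on_min h)
  have gK: "\<bar>g n x\<bar> \<le> K" for n x
  proof -
    have "\<bar>max (-K) (min K (h n x))\<bar> \<le> K" using K0 by auto
    then have "\<theta> x * \<bar>max (-K) (min K (h n x))\<bar> \<le> 1 * K" using \<theta>[of x] by (intro mult_mono) auto
    then show ?thesis using \<theta>[of x] by (simp add: g_def abs_mult)
  qed
  have g0: "g n x = 0" if "x \<notin> {-1..t+1}" for n x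
    using that by (auto simp: g_def \<theta>_def)
  have [measurable]: "g n \<in> borel_measurable borel" for n
    using gc by (rule borel_measurable_continuous_onI)
  have "AE x in lebesgue. x \<notin> N"
    using N unfolding negligible_iff_null_sets by (rule AE_not_in)
  then have "AE x in lborel. x \<notin> N" unfolding AE_completion_iff .
  then have "AE x in lborel. (\<lambda>n. ennreal ((f x - g n x)\<^sup>2)) \<longlonglongrightarrow> ennreal 0"
  proof eventually_elim
    case (elim x)
    have "(\<lambda>n. g n x) \<longlonglongrightarrow> \<theta> x * max (-K) (min K (f x))"
      unfolding g_def by (intro tendsto_intros tendsto_max tendsto_min lim[OF elim])
    moreover have "max (-K) (min K (f x)) = f x" using K[of x] by auto
    moreover have "\<theta> x * f x = f x"
      using supp[of x] by (cases "x \<in> {0..t}") (auto simp: \<theta>_def)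
    ultimately have "(\<lambda>n. g n x) \<longlonglongrightarrow> f x" by simp
    then have "(\<lambda>n. (f x - g n x)\<^sup>2) \<longlonglongrightarrow> (f x - f x)\<^sup>2" by (intro tendsto_intros)
    then show ?case by (intro tendsto_ennrealI) simp
  qed
  moreover have "(\<integral>\<^sup>+x. ennreal ((2 * K)\<^sup>2) * indicator {-1..t+1} x \<partial>lborel) < \<infinity>"
    by (subst nn_integral_cmult_indicator) (use \<open>0 \<le> t\<close> in \<open>auto simp: ennreal_mult_less_top\<close>)
  moreover have "ennreal ((f x - g n x)\<^sup>2) \<le> ennreal ((2 * K)\<^sup>2) * indicator {-1..t+1} x" for n x
  proof (cases "x \<in> {-1..t+1}")
    case True
    then show ?thesis using square_diff_le_of_bounded[OF K gK] by (simp add: ennreal_leI)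
  next
    case False
    then show ?thesis using supp[of x] g0[of x n] by auto
  qed
  ultimately have "(\<lambda>n. ms_dist lborel f (g n)) \<longlonglongrightarrow> (\<integral>\<^sup>+x. ennreal 0 \<partial>(lborel :: real measure))"
    by (intro nn_integral_dominated_convergence[where w =
        "\<lambda>x. ennreal ((2 * K)\<^sup>2) * indicator {-1..t+1} x"]) auto
  then have "(\<lambda>n. ms_dist lborel f (g n)) \<longlonglongrightarrow> 0" by simp
  from that[OF gc gK g0 this] show thesis .
qed

text \<open>Translations are isometries, so it suffices to consider a continuous function of compact
  support that is close to \<open>f\<close> in mean square; for such a function dominated convergence applies.\<close>

lemma translation_square_continuous:
  fixes f :: "real \<Rightarrow> real"
  assumes f[measurable]: "f \<in> borel_measurable borel" and K: "\<And>x. \<bar>f x\<bar> \<le> K"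
    and supp: "\<And>x. x \<notin> {0..t} \<Longrightarrow> f x = 0" and "0 \<le> t" and v: "v \<longlonglongrightarrow> 0"
  shows "(\<lambda>n. \<integral>\<^sup>+x. ennreal ((f x - f (x + v n))\<^sup>2) \<partial>lborel) \<longlonglongrightarrow> 0"
proof -
  obtain g where gc: "\<And>m. continuous_on UNIV (g m)" and gK: "\<And>m x. \<bar>g m x\<bar> \<le> K"
    and g0: "\<And>m x. x \<notin> {-1..t+1} \<Longrightarrow> g m x = 0"
    and lim: "(\<lambda>m. ms_dist lborel f (g m)) \<longlonglongrightarrow> 0"
    using bounded_continuous_approximation[OF f K supp \<open>0 \<le> t\<close>] by blast
  have [measurable]: "g n \<in> borel_measurable borel" for n
    using gc by (rule borel_measurable_continuous_onI)
  have gt: "(\<lambda>n. \<integral>\<^sup>+x. ennreal ((g m x - g m (x + v n))\<^sup>2) \<partial>lborel) \<longlonglongrightarrow> 0" for m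
  proof -
    obtain n0 where n0: "\<And>n. n0 \<le> n \<Longrightarrow> \<bar>v n\<bar> < 1"
      using v LIMSEQ_D[of v 0 1] by auto
    let ?w = "\<lambda>x. ennreal ((2 * K)\<^sup>2) * indicator {-2..t+2} x"
    have le: "ennreal ((g m x - g m (x + v (n + n0)))\<^sup>2) \<le> ?w x" for n x
    proof (cases "x \<in> {-2..t+2}")
      case True
      then show ?thesis using square_diff_le_of_bounded[OF gK gK] by (simp add: ennreal_leI)
    next
      case False
      then have "x \<notin> {-1..t+1}" "x + v (n + n0) \<notin> {-1..t+1}" using n0[of "n + n0"] by auto
      then show ?thesis using g0 by auto
    qed
    have fin: "(\<integral>\<^sup>+x. ?w x \<partial>lborel) < \<infinity>"
      by (subst nn_integral_cmult_indicator) (use \<open>0 \<le> t\<close> in \<open>auto simp: ennreal_mult_less_top\<close>)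
    have pt: "(\<lambda>n. ennreal ((g m x - g m (x + v (n + n0)))\<^sup>2)) \<longlonglongrightarrow> ennreal 0" for x
    proof -
      have "(\<lambda>n. x + v (n + n0)) \<longlonglongrightarrow> x + 0"
        using LIMSEQ_ignore_initial_segment[OF v] by (intro tendsto_intros)
      moreover have "isCont (g m) x" using gc[of m] continuous_on_eq_continuous_at by blast
      ultimately have "(\<lambda>n. g m (x + v (n + n0))) \<longlonglongrightarrow> g m x"
        using isCont_tendsto_compose[of x "g m" "\<lambda>n. x + v (n + n0)"] by simp
      then have "(\<lambda>n. (g m x - g m (x + v (n + n0)))\<^sup>2) \<longlonglongrightarrow> (g m x - g m x)\<^sup>2" by (intro tendsto_intros)
      then show ?thesis by (intro tendsto_ennrealI) simp
    qed
    have "(\<lambda>n. \<integral>\<^sup>+x. ennreal ((g m x - g m (x + v (n +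
        n0)))\<^sup>2) \<partial>lborel) \<longlonglongrightarrow> (\<integral>\<^sup>+x. ennreal 0 \<partial>(lborel :: real measure))"
      by (rule nn_integral_dominated_convergence[where w = ?w]) (use le fin pt in auto)
    then have "(\<lambda>n. \<integral>\<^sup>+x. ennreal ((g m x - g m (x + v (n + n0)))\<^sup>2) \<partial>lborel) \<longlonglongrightarrow> 0" by simp
    then show ?thesis by (rule LIMSEQ_offset)
  qed
  have le: "(\<integral>\<^sup>+x. ennreal ((f x - f (x + u))\<^sup>2) \<partial>lborel) \<le>
      4 * (2 * ms_dist lborel f (g m) + (\<integral>\<^sup>+x. ennreal ((g m x - g m (x + u))\<^sup>2) \<partial>lborel))" for m u
  proof -
    have "(\<integral>\<^sup>+x. ennreal ((f x - f (x + u))\<^sup>2) \<partial>lborel) \<le> 4 * (ms_dist lborel f (g m) +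
        (\<integral>\<^sup>+x. ennreal ((g m x - g m (x + u))\<^sup>2) \<partial>lborel) + (\<integral>\<^sup>+x. ennreal ((g m (x + u) - f (x +
            u))\<^sup>2) \<partial>lborel))"
      by (rule nn_integral_square_quadrilateral) measurable
    also have "(\<integral>\<^sup>+x. ennreal ((g m (x + u) - f (x + u))\<^sup>2) \<partial>lborel) = ms_dist lborel f (g m)"
      using nn_integral_lborel_shift[of "\<lambda>x. ennreal ((f x - g m x)\<^sup>2)" u] by (simp add: power2_commute)
    finally show ?thesis by (simp add: mult_2 ac_simps)
  qed
  show ?thesis
  proof (rule tendsto_zero_ennreal)
    fix e :: real assume "0 < e"
    then have e: "0 < ennreal (e / 16)" by simp
    obtain m where m: "ms_dist lborel f (g m) < ennreal (e / 16)"
      using order_tendstoD(2)[OF lim e] by (auto simp: eventually_sequentially)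
    have "\<forall>\<^sub>F n in sequentially. (\<integral>\<^sup>+x. ennreal ((g m x - g m (x + v n))\<^sup>2) \<partial>lborel) < ennreal (e / 16)"
      using order_tendstoD(2)[OF gt e] .
    then show "\<forall>\<^sub>F n in sequentially. (\<integral>\<^sup>+x. ennreal ((f x - f (x + v n))\<^sup>2) \<partial>lborel) < ennreal e"
    proof eventually_elim
      case (elim n)
      have "(\<integral>\<^sup>+x. ennreal ((f x - f (x + v n))\<^sup>2) \<partial>lborel) \<le>
          ennreal 4 * (ennreal 2 * ennreal (e / 16) + ennreal (e / 16))"
        by (rule order_trans[OF le[of "v n" m]]) (use m elim in \<open>auto intro!: mult_left_mono add_mono\<close>)
      also have "\<dots> = ennreal (4 * (2 * (e / 16) + e / 16))"
        using \<open>0 < e\<close> by (simp flip: ennreal_plus ennreal_mult' del: ennreal_numeral distrib_left_numeral)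
      also have "\<dots> < ennreal e" using \<open>0 < e\<close> by (intro ennreal_lessI) auto
      finally show ?case .
    qed
  qed
qed

context prob_space
begin

lemma process_translation_continuous:
  fixes f :: "real \<times> 'a \<Rightarrow> real"
  assumes f[measurable]: "f \<in> borel_measurable (lborel \<Otimes>\<^sub>M M)"
    and K: "\<And>x \<omega>. \<omega> \<in> space M \<Longrightarrow> \<bar>f (x, \<omega>)\<bar> \<le> K"
    and supp: "\<And>x \<omega>. x \<notin> {0..t} \<Longrightarrow> f (x, \<omega>) = 0" and "0 \<le> t" and "0 < e"
  obtains d where "0 < d"
    "\<And>v. 0 \<le> v \<Longrightarrow> v \<le> d \<Longrightarrow> (\<integral>\<^sup>+x. (\<integral>\<^sup>+\<omega>. ennreal ((f (x, \<omega>) - f (x + v, \<omega>))\<^sup>2) \<partial>M) \<partial>lborel) \<le> ennreal e"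
proof -
  interpret p: pair_sigma_finite lborel M ..
  let ?W = "\<lambda>v. \<integral>\<^sup>+x. (\<integral>\<^sup>+\<omega>. ennreal ((f (x, \<omega>) - f (x + v, \<omega>))\<^sup>2) \<partial>M) \<partial>lborel"
  have shift[measurable]: "(\<lambda>z. f (fst z + v, snd z)) \<in> borel_measurable (lborel \<Otimes>\<^sub>M M)" for v
    by measurable
  have W: "?W v = (\<integral>\<^sup>+\<omega>. (\<integral>\<^sup>+x. ennreal ((f (x, \<omega>) - f (x + v, \<omega>))\<^sup>2) \<partial>lborel) \<partial>M)" for v
    by (rule p.Fubini'[symmetric]) measurable
  have lim: "(\<lambda>n. ?W (v n)) \<longlonglongrightarrow> 0" if v: "v \<longlonglongrightarrow> 0" "\<And>n. \<bar>v n\<bar> \<le> 1" for v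
  proof -
    have m: "(\<lambda>x. f (x, \<omega>)) \<in> borel_measurable borel" if "\<omega> \<in> space M" for \<omega>
      using that by measurable
    have le: "(\<integral>\<^sup>+x. ennreal ((f (x, \<omega>) - f (x + v n, \<omega>))\<^sup>2) \<partial>lborel) \<le>
        ennreal ((2 * K)\<^sup>2) * ennreal (t + 2)"
      if "\<omega> \<in> space M" for n \<omega>
    proof -
      have "(\<integral>\<^sup>+x. ennreal ((f (x, \<omega>) - f (x + v n, \<omega>))\<^sup>2) \<partial>lborel) \<le>
          (\<integral>\<^sup>+x. ennreal ((2 * K)\<^sup>2) * indicator {-1..t+1} x \<partial>lborel)"
      proof (rule nn_integral_mono)
        fix x
        show "ennreal ((f (x, \<omega>) - f (x + v n, \<omega>))\<^sup>2) \<le> ennreal ((2 * K)\<^sup>2) * indicator {-1..t+1} x"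
        proof (cases "x \<in> {-1..t+1}")
          case True
          then show ?thesis
            using square_diff_le_of_bounded[OF K K] that by (simp add: ennreal_leI)
        next
          case False
          then have "x \<notin> {0..t}" "x + v n \<notin> {0..t}" using v(2)[of n] by auto
          then show ?thesis using supp by auto
        qed
      qed
      then show ?thesis using \<open>0 \<le> t\<close> by (subst (asm) nn_integral_cmult_indicator) (auto simp: add.commute)
    qed
    have "(\<lambda>n. \<integral>\<^sup>+\<omega>. (\<integral>\<^sup>+x. ennreal ((f (x, \<omega>) - f (x + v n, \<omega>))\<^sup>2) \<partial>lborel) \<partial>M) \<longlonglongrightarrow> (\<integral>\<^sup>+\<omega>. 0 \<partial>M)"
    proof (rule nn_integral_dominated_convergence[where w = "\<lambda>_. ennreal ((2 * K)\<^sup>2) * ennreal (t + 2)"])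
      show "AE \<omega> in M. (\<lambda>n. \<integral>\<^sup>+x. ennreal ((f (x, \<omega>) - f (x + v n, \<omega>))\<^sup>2) \<partial>lborel) \<longlonglongrightarrow> 0"
        by (intro AE_I2 translation_square_continuous[where K = K and t = t] m K supp v \<open>0 \<le> t\<close>)
    qed (use le in \<open>auto simp: emeasure_space_1 ennreal_mult_less_top\<close>)
    then show ?thesis unfolding W by simp
  qed
  have "\<exists>d>0. \<forall>v. 0 \<le> v \<longrightarrow> v \<le> d \<longrightarrow> ?W v \<le> ennreal e"
  proof (rule ccontr)
    assume n: "\<not> (\<exists>d>0. \<forall>v. 0 \<le> v \<longrightarrow> v \<le> d \<longrightarrow> ?W v \<le> ennreal e)"
    have "\<exists>v. 0 \<le> v \<and> v \<le> 1 / real (Suc n) \<and> ennreal e < ?W v" for n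
    proof -
      have "0 < 1 / real (Suc n)" by simp
      then show ?thesis using n unfolding not_le[symmetric] by blast
    qed
    then have "\<forall>n. \<exists>v. 0 \<le> v \<and> v \<le> 1 / real (Suc n) \<and> ennreal e < ?W v" by blast
    from choice[OF this] obtain v where "\<forall>n. 0 \<le> v n \<and> v n \<le> 1 / real (Suc n) \<and> ennreal e < ?W (v n)"
      by blast
    then have v: "\<And>n. 0 \<le> v n" "\<And>n. v n \<le> 1 / real (Suc n)" "\<And>n. ennreal e < ?W (v n)"
      by simp_all
    have "v \<longlonglongrightarrow> 0"
      by (rule tendsto_sandwich[OF _ _ tendsto_const LIMSEQ_inverse_real_of_nat])
        (use v(1,2) in \<open>auto simp: divide_inverse\<close>)
    moreover have "\<bar>v n\<bar> \<le> 1" for n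
    proof -
      have "1 / real (Suc n) \<le> 1" by simp
      then show ?thesis using v(1,2)[of n] by linarith
    qed
    ultimately have "(\<lambda>n. ?W (v n)) \<longlonglongrightarrow> 0" by (rule lim)
    then have "\<forall>\<^sub>F n in sequentially. ?W (v n) < ennreal e"
      by (rule order_tendstoD(2)) (use \<open>0 < e\<close> in simp)
    then obtain n where "?W (v n) < ennreal e" by (auto simp: eventually_sequentially)
    with v(3)[of n] show False by (meson less_asym)
  qed
  then show thesis using that by blast
qed

end

section \<open>Approximation by simple processes\<close>

lemma sum_indicator_grid:
  fixes \<delta> :: real assumes "0 \<le> \<delta>"
  shows "(\<Sum>j<n. indicator {real j * \<delta>..<real (Suc j) * \<delta>} x) = (indicator {0..<real n * \<delta>} x :: ennreal)"
proof (induction n)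
  case (Suc n)
  have "real n * \<delta> \<le> real (Suc n) * \<delta>" "0 \<le> real n * \<delta>" using assms by (auto intro: mult_right_mono)
  then show ?case using Suc by (auto simp: indicator_def)
qed simp

text \<open>As \<open>a\<close> runs through \<open>[0, \<delta>)\<close>, the points \<open>a + j \<delta>\<close> sweep out a line segment exactly once.
  Hence the integral of the sum over \<open>a\<close> is at most \<open>\<delta> e\<close>, and the sum cannot exceed \<open>2 e\<close> for all
  shifts.\<close>

lemma exists_good_grid_shift:
  fixes q :: "real \<Rightarrow> real \<Rightarrow> ennreal"
  assumes q[measurable]: "case_prod q \<in> borel_measurable (borel \<Otimes>\<^sub>M borel)"
    and \<delta>: "0 < \<delta>" and e: "0 < e"
    and W: "\<And>v. 0 \<le> v \<Longrightarrow> v \<le> \<delta> \<Longrightarrow> (\<integral>\<^sup>+x. q x v \<partial>lborel) \<le> ennreal e"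
  shows "\<exists>a. 0 \<le> a \<and> a < \<delta> \<and>
    (\<Sum>j<N. \<integral>\<^sup>+v. q (a + real j * \<delta>) v * indicator {0<..\<delta>} v \<partial>lborel) \<le> ennreal (2 * e)"
proof -
  let ?cell = "\<lambda>j. {real j * \<delta>..<real (Suc j) * \<delta>}" and ?V = "{0<..\<delta>}" and ?A = "{0..<\<delta>}"
  define Q where "Q = (\<lambda>a. \<Sum>j<N. \<integral>\<^sup>+v. q (a + real j * \<delta>) v * indicator ?V v \<partial>lborel)"
  have [measurable]: "Q \<in> borel_measurable borel" unfolding Q_def by measurable
  have shift: "(\<integral>\<^sup>+a. q (a + real j * \<delta>) v * indicator ?A a \<partial>lborel) =
      (\<integral>\<^sup>+x. q x v * indicator (?cell j) x \<partial>lborel)" for j v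
  proof -
    have "(\<integral>\<^sup>+x. q x v * indicator (?cell j) x \<partial>lborel) =
      (\<integral>\<^sup>+a. q (a + real j * \<delta>) v * indicator (?cell j) (a + real j * \<delta>) \<partial>lborel)"
      by (rule nn_integral_lborel_shift[symmetric]) measurable
    also have "\<dots> = (\<integral>\<^sup>+a. q (a + real j * \<delta>) v * indicator ?A a \<partial>lborel)"
      by (intro nn_integral_cong) (auto simp: indicator_def algebra_simps)
    finally show ?thesis by simp
  qed
  have "(\<integral>\<^sup>+a. Q a * indicator ?A a \<partial>lborel) =
      (\<Sum>j<N. \<integral>\<^sup>+a. (\<integral>\<^sup>+v. q (a + real j * \<delta>) v * indicator ?V v * indicator ?A a \<partial>lborel) \<partial>lborel)"
    unfolding Q_def sum_distrib_right
    by (subst nn_integral_sum) (simp_all add: nn_integral_multc)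
  also have "\<dots> = (\<Sum>j<N. \<integral>\<^sup>+v. (\<integral>\<^sup>+a. q (a + real j * \<delta>) v * indicator ?V v * indicator ?A a \<partial>lborel) \<partial>lborel)"
    by (intro sum.cong refl lborel_pair.Fubini') measurable
  also have "\<dots> = (\<Sum>j<N. \<integral>\<^sup>+v. (\<integral>\<^sup>+x. q x v * indicator (?cell j) x \<partial>lborel) * indicator ?V v \<partial>lborel)"
  proof (intro sum.cong refl nn_integral_cong)
    fix j v
    have "(\<integral>\<^sup>+a. q (a + real j * \<delta>) v * indicator ?V v * indicator ?A a \<partial>lborel) =
       (\<integral>\<^sup>+a. q (a + real j * \<delta>) v * indicator ?A a * indicator ?V v \<partial>lborel)"
      by (simp add: ac_simps)
    also have "\<dots> = (\<integral>\<^sup>+a. q (a + real j * \<delta>) v * indicator ?A a \<partial>lborel) * indicator ?V v"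
      by (rule nn_integral_multc) measurable
    finally show "(\<integral>\<^sup>+a. q (a + real j * \<delta>) v * indicator ?V v * indicator ?A a \<partial>lborel) =
      (\<integral>\<^sup>+x. q x v * indicator (?cell j) x \<partial>lborel) * indicator ?V v"
      unfolding shift .
  qed
  also have "\<dots> = (\<integral>\<^sup>+v. (\<Sum>j<N. (\<integral>\<^sup>+x. q x v * indicator (?cell j) x \<partial>lborel)) * indicator ?V v \<partial>lborel)"
    unfolding sum_distrib_right by (rule nn_integral_sum[symmetric]) measurable
  also have "\<dots> \<le> (\<integral>\<^sup>+v. ennreal (e) * indicator ?V v \<partial>lborel)"
  proof (intro nn_integral_mono)
    fix v
    have "(\<Sum>j<N. (\<integral>\<^sup>+x. q x v * indicator (?cell j) x \<partial>lborel)) =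
       (\<integral>\<^sup>+x. q x v * (\<Sum>j<N. indicator (?cell j) x) \<partial>lborel)"
      unfolding sum_distrib_left by (rule nn_integral_sum[symmetric]) measurable
    also have "\<dots> \<le> (\<integral>\<^sup>+x. q x v * 1 \<partial>lborel)"
      unfolding sum_indicator_grid[OF less_imp_le[OF \<delta>]]
      by (intro nn_integral_mono mult_left_mono) (auto simp: indicator_def)
    finally show "(\<Sum>j<N. (\<integral>\<^sup>+x. q x v * indicator (?cell j) x \<partial>lborel)) * indicator ?V v
        \<le> ennreal (e) * indicator ?V v"
      using W[of v] by (cases "v \<in> ?V") auto
  qed
  also have "\<dots> = ennreal (e * \<delta>)"
    using \<delta> e by (simp add: nn_integral_cmult_indicator flip: ennreal_mult')
  finally have intQ: "(\<integral>\<^sup>+a. Q a * indicator ?A a \<partial>lborel) \<le> ennreal (e * \<delta>)" .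
  have "\<exists>a. 0 \<le> a \<and> a < \<delta> \<and> Q a \<le> ennreal (2 * e)"
  proof (rule ccontr)
    assume "\<not> (\<exists>a. 0 \<le> a \<and> a < \<delta> \<and> Q a \<le> ennreal (2 * e))"
    then have "ennreal (2 * e) * indicator ?A a \<le> Q a * indicator ?A a" for a
      by (cases "a \<in> ?A") (auto simp: not_le)
    then have "(\<integral>\<^sup>+a. ennreal (2 * e) * indicator ?A a \<partial>lborel) \<le> (\<integral>\<^sup>+a. Q a * indicator ?A a \<partial>lborel)"
      by (rule nn_integral_mono)
    also note intQ
    finally have "ennreal (2 * e * \<delta>) \<le> ennreal (e * \<delta>)"
      using \<delta> e by (simp add: nn_integral_cmult_indicator flip: ennreal_mult')
    then have "2 * e * \<delta> \<le> e * \<delta>"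
      by (subst (asm) ennreal_le_iff) (use \<delta> e in auto)
    moreover have "0 < e * \<delta>" using \<delta> e by simp
    ultimately show False by (simp add: field_simps)
  qed
  then show ?thesis unfolding Q_def .
qed

context brownian
begin

text \<open>Averages of \<open>H\<close> over past time windows need not be adapted when \<open>H\<close> is merely measurable and
  adapted, but the values \<open>H (\<tau> i)\<close> at the left ends of the cells are admissible coefficients.
  With \<open>q x v = E \<bar>H\<^sub>x - H\<^sub>x\<^sub>+\<^sub>v\<bar>\<^sup>2\<close> (where \<open>H\<close> is zero outside \<open>[0, t]\<close>) the error is at most the
  sum of the integrals of \<open>q (a + j \<delta>)\<close> over \<open>(0, \<delta>]\<close> plus the contribution of the initial piece
  before the first grid point \<open>a\<close>, where the simple process is zero.\<close>

lemma shifted_grid_approximation: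
  assumes H: "measurable_process M t H" and ad: "adapted_process F t H" and t: "0 < t" "t \<le> T"
    and K: "\<And>s \<omega>. s \<in> {0..t} \<Longrightarrow> \<omega> \<in> space M \<Longrightarrow> \<bar>H s \<omega>\<bar> \<le> K" and e: "0 < e"
  obtains N \<tau> where "simple_data M F t N \<tau> (\<lambda>i. H (\<tau> i))" "\<And>i. i < N \<Longrightarrow> \<tau> i < t"
    "sq_dist M t H (simple_process N \<tau> (\<lambda>i. H (\<tau> i))) \<le> ennreal e"
proof -
  define f where "f = cut t H"
  have f[measurable]: "f \<in> borel_measurable (lborel \<Otimes>\<^sub>M M)"
    using H unfolding f_def measurable_process_iff_cut .
  have supp: "f (x, \<omega>) = 0" if "x \<notin> {0..t}" for x \<omega> using that by (simp add: f_def cut_def)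
  have fH: "f (x, \<omega>) = H x \<omega>" if "x \<in> {0..t}" for x \<omega> using that by (simp add: f_def cut_def)
  obtain \<omega>0 where "\<omega>0 \<in> space M" using not_empty by blast
  then have K0: "0 \<le> K" using K[of 0 \<omega>0] t by force
  have fK: "\<bar>f (x, \<omega>)\<bar> \<le> K" if "\<omega> \<in> space M" for x \<omega>
    using K[OF _ that] K0 supp fH by (cases "x \<in> {0..t}") auto
  have "0 < e / 4" using e by simp
  then obtain d where d: "0 < d"
    "\<And>v. 0 \<le> v \<Longrightarrow> v \<le> d \<Longrightarrow> (\<integral>\<^sup>+x. (\<integral>\<^sup>+\<omega>. ennreal ((f (x, \<omega>) - f (x + v, \<omega>))\<^sup>2) \<partial>M) \<partial>lborel) \<le>
        ennreal (e / 4)"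
    using process_translation_continuous[OF f fK supp less_imp_le[OF t(1)]] by blast
  \<comment> \<open>The mesh \<open>t / N\<close> is at most \<open>d\<close>, and the initial piece costs at most \<open>e / 4\<close>.\<close>
  define N where "N = nat \<lceil>max (t / d) (4 * K\<^sup>2 * t / e)\<rceil> + 1"
  define \<delta> where "\<delta> = t / real N"
  have N: "0 < N" "t / d \<le> real N" "4 * K\<^sup>2 * t / e \<le> real N"
    unfolding N_def by linarith+
  have \<delta>: "0 < \<delta>" "\<delta> \<le> d" "K\<^sup>2 * \<delta> \<le> e / 4" "real N * \<delta> = t"
    using N d(1) e t by (auto simp: \<delta>_def field_simps)
  define q where "q = (\<lambda>x v. \<integral>\<^sup>+\<omega>. ennreal ((f (x, \<omega>) - f (x + v, \<omega>))\<^sup>2) \<partial>M)"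
  have "case_prod q \<in> borel_measurable (lborel \<Otimes>\<^sub>M lborel)"
    unfolding q_def split_beta' by measurable
  then have q[measurable]: "case_prod q \<in> borel_measurable (borel \<Otimes>\<^sub>M borel)"
    by (simp cong: measurable_cong_sets sets_pair_measure_cong)
  have W: "(\<integral>\<^sup>+x. q x v \<partial>lborel) \<le> ennreal (e / 4)" if "0 \<le> v" "v \<le> \<delta>" for v
    unfolding q_def using d(2) that \<delta>(2) by simp
  define Q where "Q = (\<lambda>a. \<Sum>j<N. \<integral>\<^sup>+v. q (a + real j * \<delta>) v * indicator {0<..\<delta>} v \<partial>lborel)"
  have "\<exists>a. 0 \<le> a \<and> a < \<delta> \<and> Q a \<le> ennreal (2 * (e / 4))"
    unfolding Q_def by (rule exists_good_grid_shift[OF q \<delta>(1) \<open>0 < e / 4\<close> W])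
  then obtain a where a: "0 \<le> a" "a < \<delta>" "Q a \<le> ennreal (e / 2)" by auto
  \<comment> \<open>The last cell is truncated at \<open>t\<close>; the bound below integrates over the full cell.\<close>
  define \<tau> where "\<tau> = (\<lambda>j. if j < N then a + real j * \<delta> else t)"
  have below: "a + real j * \<delta> < t" if "j < N" for j
  proof -
    have "real (Suc j) * \<delta> \<le> real N * \<delta>" using that \<delta>(1) by (intro mult_right_mono) auto
    then show ?thesis using a(2) \<delta>(4) by (simp add: algebra_simps)
  qed
  have \<tau>t: "\<tau> i < t" if "i < N" for i using that below by (simp add: \<tau>_def)
  have \<tau>in: "\<tau> i \<in> {0..t}" for i using below a(1) \<delta>(1) t by (auto simp: \<tau>_def less_imp_le)
  have sd: "simple_data M F t N \<tau> (\<lambda>i. H (\<tau> i))"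
    unfolding simple_data_def
  proof (intro conjI allI impI)
    fix i assume "i < N"
    show "\<tau> i \<le> \<tau> (Suc i)"
      using below[OF \<open>i < N\<close>] \<delta>(1) \<open>i < N\<close> by (auto simp: \<tau>_def algebra_simps)
    show "H (\<tau> i) \<in> borel_measurable (F (\<tau> i))" using ad \<tau>in unfolding adapted_process_def by blast
    show "\<exists>K. \<forall>\<omega>\<in>space M. \<bar>H (\<tau> i) \<omega>\<bar> \<le> K" using K[OF \<tau>in] by blast
  qed (rule \<tau>in)
  let ?S = "simple_process N \<tau> (\<lambda>i. H (\<tau> i))"
  let ?b = "\<lambda>j. a + real j * \<delta>"
  let ?q = "\<lambda>j s. q (?b j) (s - ?b j) * indicator {0<..\<delta>} (s - ?b j)"
  have S0: "?S s \<omega> = 0" if "s \<le> a" for s \<omega>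
  proof -
    have "s \<notin> {\<tau> i<..\<tau> (Suc i)}" if "i < N" for i
    proof -
      have "0 \<le> real i * \<delta>" using \<delta>(1) by simp
      then show ?thesis using \<open>s \<le> a\<close> that by (simp add: \<tau>_def)
    qed
    then show ?thesis unfolding simple_process_def by (intro sum.neutral) auto
  qed
  have S1: "?S s \<omega> = H (?b j) \<omega>" if j: "j < N" and s: "?b j < s" "s \<le> ?b j + \<delta>" "s \<le> t" for j s \<omega>
  proof -
    have "indicator {\<tau> i<..\<tau> (Suc i)} s = (if i = j then 1 else 0 :: real)" if "i < N" for i
    proof (cases i j rule: linorder_cases)
      case less
      then have "real (Suc i) * \<delta> \<le> real j * \<delta>" using \<delta>(1) by (intro mult_right_mono) auto
      then have "\<tau> (Suc i) < s" using less j s(1) by (simp add: \<tau>_def)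
      then show ?thesis using less by simp
    next
      case equal
      then have "\<tau> i < s \<and> s \<le> \<tau> (Suc i)" using j s by (simp add: \<tau>_def algebra_simps)
      then show ?thesis using equal by simp
    next
      case greater
      then have "real (Suc j) * \<delta> \<le> real i * \<delta>" using \<delta>(1) by (intro mult_right_mono) auto
      then have "s \<le> \<tau> i" using that s(2) by (simp add: \<tau>_def algebra_simps)
      then show ?thesis using greater by simp
    qed
    then have "?S s \<omega> = (\<Sum>i<N. H (\<tau> i) \<omega> * (if i = j then 1 else 0))"
      unfolding simple_process_def by (intro sum.cong) auto
    also have "\<dots> = H (\<tau> j) \<omega>" using j by (simp add: if_distrib cong: if_cong)
    finally show ?thesis using j by (simp add: \<tau>_def)
  qed
  have pt: "ms_dist M (H s) (?S s) * indicator {0..t} s \<le>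
      ennreal (K\<^sup>2) * indicator {0..\<delta>} s + (\<Sum>j<N. ?q j s)" for s
  proof (cases "s \<in> {0..t}")
    case True
    show ?thesis
    proof (cases "s \<le> a")
      case True
      have "ms_dist M (H s) (?S s) \<le> (\<integral>\<^sup>+\<omega>. ennreal (K\<^sup>2) \<partial>M)"
      proof (intro nn_integral_mono ennreal_leI)
        fix \<omega> assume "\<omega> \<in> space M"
        then have "\<bar>H s \<omega>\<bar> \<le> \<bar>K\<bar>" using K[OF \<open>s \<in> {0..t}\<close>, of \<omega>] by linarith
        then have "(H s \<omega>)\<^sup>2 \<le> K\<^sup>2" by (rule abs_le_square_iff[THEN iffD1])
        then show "(H s \<omega> - ?S s \<omega>)\<^sup>2 \<le> K\<^sup>2" using S0[OF True] by simp
      qed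
      also have "\<dots> = ennreal (K\<^sup>2)" by (simp add: emeasure_space_1)
      finally show ?thesis using True \<open>s \<in> {0..t}\<close> a by (simp add: add_increasing2)
    next
      case False
      \<comment> \<open>The index of the half-open cell that contains \<open>s\<close>.\<close>
      define m where "m = nat (\<lceil>(s - a) / \<delta>\<rceil> - 1)"
      have pos: "0 < (s - a) / \<delta>" using False \<delta>(1) by simp
      have m: "real m < (s - a) / \<delta>" "(s - a) / \<delta> \<le> real m + 1" using pos unfolding m_def by linarith+
      have m1: "?b m < s" and m2: "s \<le> ?b m + \<delta>" using m \<delta>(1) by (simp_all add: field_simps)
      have "real m * \<delta> < real N * \<delta>" using m1 a(1) True \<delta>(4) by simp
      then have mN: "m < N" using \<delta>(1) by simp
      have bm: "?b m \<in> {0..t}" using below[OF mN] a(1) \<delta>(1) by simp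
      have "ms_dist M (H s) (?S s) = ?q m s"
        unfolding q_def using S1[OF mN m1 m2] True fH[OF True] fH[OF bm] m1 m2
        by (simp add: power2_commute)
      also have "\<dots> \<le> (\<Sum>j<N. ?q j s)" by (rule member_le_sum) (use mN in auto)
      finally show ?thesis using True by (simp add: add_increasing)
    qed
  qed simp
  have "sq_dist M t H ?S = (\<integral>\<^sup>+s\<in>{0..t}. ms_dist M (H s) (?S s) \<partial>lborel)"
    by (rule sq_dist_Fubini[OF H simple_process_measurable[OF sd t(2)]])
  also have "\<dots> \<le> (\<integral>\<^sup>+s. ennreal (K\<^sup>2) * indicator {0..\<delta>} s + (\<Sum>j<N. ?q j s) \<partial>lborel)"
    by (rule nn_integral_mono) (rule pt)
  also have "\<dots> = ennreal (K\<^sup>2) * ennreal \<delta> + (\<Sum>j<N. \<integral>\<^sup>+s. ?q j s \<partial>lborel)"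
  proof -
    have [measurable]: "?q j \<in> borel_measurable borel" for j by measurable
    have "(\<integral>\<^sup>+s. ennreal (K\<^sup>2) * indicator {0..\<delta>} s + (\<Sum>j<N. ?q j s) \<partial>lborel) =
      (\<integral>\<^sup>+s. ennreal (K\<^sup>2) * indicator {0..\<delta>} s \<partial>lborel) + (\<integral>\<^sup>+s. (\<Sum>j<N. ?q j s) \<partial>lborel)"
      by (rule nn_integral_add) measurable
    also have "(\<integral>\<^sup>+s. (\<Sum>j<N. ?q j s) \<partial>lborel) = (\<Sum>j<N. \<integral>\<^sup>+s. ?q j s \<partial>lborel)"
      by (rule nn_integral_sum) measurable
    also have "(\<integral>\<^sup>+s. ennreal (K\<^sup>2) * indicator {0..\<delta>} s \<partial>lborel) = ennreal (K\<^sup>2) * ennreal \<delta>"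
      using \<delta>(1) by (simp add: nn_integral_cmult_indicator)
    finally show ?thesis .
  qed
  also have "(\<Sum>j<N. \<integral>\<^sup>+s. ?q j s \<partial>lborel) = Q a"
  proof -
    have "(\<integral>\<^sup>+s. ?q j s \<partial>lborel) = (\<integral>\<^sup>+v. q (?b j) v * indicator {0<..\<delta>} v \<partial>lborel)" for j
    proof -
      have "(\<lambda>v. q (?b j) v * indicator {0<..\<delta>} v) \<in> borel_measurable borel" by measurable
      from nn_integral_lborel_shift[OF this, of "- ?b j"]
      show ?thesis unfolding add_uminus_conv_diff .
    qed
    then show ?thesis unfolding Q_def by simp
  qed
  also have "ennreal (K\<^sup>2) * ennreal \<delta> + Q a \<le> ennreal (e / 4) + ennreal (e / 2)"
    using \<delta>(3) a(3) by (intro add_mono) (simp_all add: ennreal_leI flip: ennreal_mult')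
  also have "\<dots> \<le> ennreal e" using e by (simp flip: ennreal_plus add: ennreal_leI)
  finally have "sq_dist M t H ?S \<le> ennreal e" .
  with that[OF sd \<tau>t] show thesis by blast
qed

end

lemma sum_indicator_cells:
  fixes \<tau> :: "nat \<Rightarrow> real"
  assumes "\<And>i. i < n \<Longrightarrow> \<tau> i \<le> \<tau> (Suc i)"
  shows "\<tau> 0 \<le> \<tau> n \<and> (\<Sum>i<n. indicator {\<tau> i<..\<tau> (Suc i)} s) = (indicator {\<tau> 0<..\<tau> n} s :: ennreal)"
  using assms
proof (induction n)
  case (Suc n)
  then have "\<tau> 0 \<le> \<tau> n" "\<tau> n \<le> \<tau> (Suc n)"
    "(\<Sum>i<n. indicator {\<tau> i<..\<tau> (Suc i)} s) = (indicator {\<tau> 0<..\<tau> n} s :: ennreal)" by auto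
  then show ?case by (auto simp: indicator_def)
qed simp

text \<open>For an increasing envelope the left-endpoint sums of the square stay below its integral.
  Thus the simple integrals inherit the variance bound of the integrand that they approximate.\<close>

lemma left_sum_le_integral_of_mono:
  fixes \<phi> :: "real \<Rightarrow> real"
  assumes mono: "\<And>s u. 0 \<le> s \<Longrightarrow> s \<le> u \<Longrightarrow> u < t \<Longrightarrow> \<phi> s \<le> \<phi> u"
    and pos: "\<And>s. 0 \<le> s \<Longrightarrow> s < t \<Longrightarrow> 0 < \<phi> s"
    and V: "(\<integral>\<^sup>+s\<in>{0..<t}. ennreal ((\<phi> s)\<^sup>2) \<partial>lborel) \<le> ennreal V" "0 \<le> V"
    and \<tau>: "\<And>i. i \<le> n \<Longrightarrow> 0 \<le> \<tau> i \<and> \<tau> i \<le> t" "\<And>i. i < n \<Longrightarrow> \<tau> i \<le> \<tau> (Suc i)" "\<And>i. i < n \<Longrightarrow> \<tau> i < t"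
  shows "(\<Sum>i<n. (\<phi> (\<tau> i))\<^sup>2 * (\<tau> (Suc i) - \<tau> i)) \<le> V"
proof -
  have "ennreal (\<Sum>i<n. (\<phi> (\<tau> i))\<^sup>2 * (\<tau> (Suc i) - \<tau> i)) =
      (\<Sum>i<n. ennreal ((\<phi> (\<tau> i))\<^sup>2) * ennreal (\<tau> (Suc i) - \<tau> i))"
    using \<tau>(2) by (subst sum_ennreal[symmetric]) (auto simp: ennreal_mult)
  also have "\<dots> = (\<Sum>i<n. \<integral>\<^sup>+s. ennreal ((\<phi> (\<tau> i))\<^sup>2) * indicator {\<tau> i<..\<tau> (Suc i)} s \<partial>lborel)"
    using \<tau>(2) by (intro sum.cong refl) (simp add: nn_integral_cmult_indicator)
  also have "\<dots> = (\<integral>\<^sup>+s. (\<Sum>i<n. ennreal ((\<phi> (\<tau> i))\<^sup>2) * indicator {\<tau> i<..\<tau> (Suc i)} s) \<partial>lborel)"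
    by (rule nn_integral_sum[symmetric]) measurable
  also have "\<dots> \<le> (\<integral>\<^sup>+s\<in>{0..<t}. ennreal ((\<phi> s)\<^sup>2) \<partial>lborel)"
  proof (rule nn_integral_mono_AE)
    have "AE s in lborel. s \<noteq> t" by (rule AE_lborel_singleton)
    then show "AE s in lborel. (\<Sum>i<n. ennreal ((\<phi> (\<tau> i))\<^sup>2) * indicator {\<tau> i<..\<tau> (Suc i)} s) \<le>
        ennreal ((\<phi> s)\<^sup>2) * indicator {0..<t} s"
    proof eventually_elim
      case (elim s)
      have "(\<Sum>i<n. ennreal ((\<phi> (\<tau> i))\<^sup>2) * indicator {\<tau> i<..\<tau> (Suc i)} s) \<le>
          (\<Sum>i<n. ennreal ((\<phi> s)\<^sup>2) * indicator {0..<t} s * indicator {\<tau> i<..\<tau> (Suc i)} s)"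
      proof (intro sum_mono)
        fix i assume i: "i \<in> {..<n}"
        show "ennreal ((\<phi> (\<tau> i))\<^sup>2) * indicator {\<tau> i<..\<tau> (Suc i)} s \<le>
            ennreal ((\<phi> s)\<^sup>2) * indicator {0..<t} s * indicator {\<tau> i<..\<tau> (Suc i)} s"
        proof (cases "s \<in> {\<tau> i<..\<tau> (Suc i)}")
          case True
          have b: "0 \<le> \<tau> i" "\<tau> (Suc i) \<le> t" "\<tau> i < t"
            using \<tau>(1)[of i] \<tau>(1)[of "Suc i"] \<tau>(3)[of i] i by auto
          then have s: "0 \<le> s" "s < t" using True elim by auto
          have "(\<phi> (\<tau> i))\<^sup>2 \<le> (\<phi> s)\<^sup>2"
            using mono[OF b(1) _ s(2)] pos[OF b(1,3)] True by (intro power_mono) auto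
          then show ?thesis using True s by (simp add: ennreal_leI)
        qed simp
      qed
      also have "\<dots> = ennreal ((\<phi> s)\<^sup>2) * indicator {0..<t} s * indicator {\<tau> 0<..\<tau> n} s"
        unfolding sum_distrib_left[symmetric] using sum_indicator_cells[of n \<tau> s] \<tau>(2) by simp
      also have "\<dots> \<le> ennreal ((\<phi> s)\<^sup>2) * indicator {0..<t} s * 1"
        by (intro mult_left_mono) (auto simp: indicator_def)
      finally show ?case by simp
    qed
  qed
  also note V(1)
  finally show ?thesis using V(2) by (simp add: ennreal_le_iff)
qed

context brownian
begin

text \<open>The envelope may blow up at \<open>t\<close>. Replacing \<open>H\<close> by zero shortly before \<open>t\<close> makes it bounded
  at the cost of the tail of the integral of \<open>\<phi>\<^sup>2\<close>, and since the coefficients are values of the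
  process at the left endpoints they stay below the envelope there.\<close>

lemma dominated_process_approximation:
  assumes H: "measurable_process M t H" and ad: "adapted_process F t H" and t: "0 < t" "t \<le> T"
    and \<phi>m[measurable]: "\<phi> \<in> borel_measurable borel"
    and mono: "\<And>s u. 0 \<le> s \<Longrightarrow> s \<le> u \<Longrightarrow> u < t \<Longrightarrow> \<phi> s \<le> \<phi> u"
    and bound: "\<And>s \<omega>. 0 \<le> s \<Longrightarrow> s < t \<Longrightarrow> \<omega> \<in> space M \<Longrightarrow> \<bar>H s \<omega>\<bar> \<le> \<phi> s"
    and V: "(\<integral>\<^sup>+s\<in>{0..<t}. ennreal ((\<phi> s)\<^sup>2) \<partial>lborel) < \<infinity>" and e: "0 < e"
  shows "\<exists>N \<tau> \<xi>. simple_data M F t N \<tau> \<xi> \<and> (\<forall>i<N. \<tau> i < t) \<and>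
    (\<forall>i<N. \<forall>\<omega>\<in>space M. \<bar>\<xi> i \<omega>\<bar> \<le> \<phi> (\<tau> i)) \<and> sq_dist M t H (simple_process N \<tau> \<xi>) \<le> ennreal e"
proof -
  define r where "r = (\<lambda>n. t - t / real (Suc n))"
  have r: "0 \<le> r n" "r n < t" for n using t by (auto simp: r_def field_simps)
  have rlim: "r \<longlonglongrightarrow> t"
  proof -
    have "(\<lambda>n. t - t * inverse (real (Suc n))) \<longlonglongrightarrow> t - t * 0"
      by (intro tendsto_intros LIMSEQ_inverse_real_of_nat)
    then show ?thesis by (simp add: r_def divide_inverse[abs_def])
  qed
  let ?tail = "\<lambda>n. \<integral>\<^sup>+s. ennreal ((\<phi> s)\<^sup>2) * indicator {0..<t} s * indicator {r n<..} s \<partial>lborel"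
  have "?tail \<longlonglongrightarrow> (\<integral>\<^sup>+s. 0 \<partial>(lborel :: real measure))"
  proof (rule nn_integral_dominated_convergence[where w = "\<lambda>s. ennreal ((\<phi> s)\<^sup>2) * indicator {0..<t} s"])
    show "AE s in lborel. (\<lambda>n. ennreal ((\<phi> s)\<^sup>2) * indicator {0..<t} s * indicator {r n<..} s) \<longlonglongrightarrow> 0"
    proof (intro AE_I2)
      fix s
      show "(\<lambda>n. ennreal ((\<phi> s)\<^sup>2) * indicator {0..<t} s * indicator {r n<..} s) \<longlonglongrightarrow> 0"
      proof (cases "s < t")
        case True
        have "\<forall>\<^sub>F n in sequentially. s < r n" using order_tendstoD(1)[OF rlim True] .
        then have "\<forall>\<^sub>F n in sequentially. ennreal ((\<phi> s)\<^sup>2) * indicator {0..<t} s * indicator {r n<..} s = 0"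
          by eventually_elim simp
        then show ?thesis by (rule tendsto_eventually)
      qed simp
    qed
  qed (use V in \<open>auto simp: indicator_def\<close>)
  then have "\<forall>\<^sub>F n in sequentially. ?tail n < ennreal (e / 4)"
    using e by (intro order_tendstoD(2)) auto
  then obtain n where n: "?tail n \<le> ennreal (e / 4)"
      by (auto simp: eventually_sequentially intro: less_imp_le)
  define G where "G = (\<lambda>s \<omega>. indicator {0..r n} s * H s \<omega>)"
  have [measurable]: "cut t H \<in> borel_measurable (lborel \<Otimes>\<^sub>M M)"
    using H unfolding measurable_process_iff_cut .
  have "cut t G = (\<lambda>z. indicator {0..r n} (fst z) * cut t H z)"
    by (auto simp: cut_def G_def fun_eq_iff)
  then have G: "measurable_process M t G" unfolding measurable_process_iff_cut by simp
  have adG: "adapted_process F t G"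
    unfolding adapted_process_def
  proof
    fix s assume "s \<in> {0..t}"
    then have "H s \<in> borel_measurable (F s)" using ad unfolding adapted_process_def by blast
    then show "G s \<in> borel_measurable (F s)" unfolding G_def by (intro borel_measurable_times) auto
  qed
  have GK: "\<bar>G s \<omega>\<bar> \<le> \<phi> (r n)" if "s \<in> {0..t}" "\<omega> \<in> space M" for s \<omega>
  proof (cases "s \<le> r n")
    case True
    then have "\<bar>H s \<omega>\<bar> \<le> \<phi> s" using bound[of s \<omega>] that r[of n] by simp
    also have "\<phi> s \<le> \<phi> (r n)" using mono[of s "r n"] that True r[of n] by simp
    finally show ?thesis using True that by (simp add: G_def)
  next
    case False
    then show ?thesis using bound[OF r that(2), of n] by (simp add: G_def order_trans[OF abs_ge_zero])
  qed
  have G\<phi>: "\<bar>G s \<omega>\<bar> \<le> \<phi> s" if "s \<in> {0..t}" "s < t" "\<omega> \<in> space M" for s \<omega>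
    using bound[of s \<omega>] that by (auto simp: G_def indicator_def order_trans[OF abs_ge_zero])
  have "0 < e / 4" using e by simp
  then obtain N \<tau> where sd: "simple_data M F t N \<tau> (\<lambda>i. G (\<tau> i))" and \<tau>: "\<And>i. i < N \<Longrightarrow> \<tau> i < t"
    and d: "sq_dist M t G (simple_process N \<tau> (\<lambda>i. G (\<tau> i))) \<le> ennreal (e / 4)"
    using shifted_grid_approximation[OF G adG t GK] by blast
  have "sq_dist M t H G \<le> (\<integral>\<^sup>+\<omega>. ?tail n \<partial>M)"
    unfolding sq_dist_def
  proof (rule nn_integral_mono, rule nn_integral_mono_AE)
    fix \<omega> assume \<omega>: "\<omega> \<in> space M"
    have "AE s in lborel. s \<noteq> t" by (rule AE_lborel_singleton)
    then show "AE s in lborel. ennreal ((H s \<omega> - G s \<omega>)\<^sup>2) * indicator {0..t} s \<le>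
        ennreal ((\<phi> s)\<^sup>2) * indicator {0..<t} s * indicator {r n<..} s"
    proof eventually_elim
      case (elim s)
      show ?case
      proof (cases "0 \<le> s \<and> s < t \<and> r n < s")
        case True
        then have "(H s \<omega>)\<^sup>2 \<le> (\<phi> s)\<^sup>2"
          using bound[of s \<omega>] \<omega> by (intro abs_le_square_iff[THEN iffD1]) auto
        then show ?thesis using True by (simp add: G_def ennreal_leI)
      next
        case False
        then show ?thesis using elim by (auto simp: G_def indicator_def)
      qed
    qed
  qed
  also have "\<dots> \<le> ennreal (e / 4)" using n by (simp add: emeasure_space_1)
  finally have d': "sq_dist M t H G \<le> ennreal (e / 4)" .
  have "sq_dist M t H (simple_process N \<tau> (\<lambda>i. G (\<tau> i))) \<le> ennreal 2 * (ennreal (e / 4) +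
      ennreal (e / 4))"
    using sq_dist_triangle[OF H G simple_process_measurable[OF sd t(2)]]
    by (rule order_trans) (use d d' in \<open>auto intro!: mult_left_mono add_mono\<close>)
  also have "\<dots> = ennreal e"
    using e by (simp flip: ennreal_plus ennreal_mult' del: ennreal_numeral distrib_left_numeral)
  finally have "sq_dist M t H (simple_process N \<tau> (\<lambda>i. G (\<tau> i))) \<le> ennreal e" .
  moreover have "\<bar>G (\<tau> i) \<omega>\<bar> \<le> \<phi> (\<tau> i)" if "i < N" "\<omega> \<in> space M" for i \<omega>
    using G\<phi> \<tau>[OF that(1)] simple_data_node[OF sd, of i] that by simp
  ultimately show ?thesis using sd \<tau> by blast
qed

lemma abs_moment_limit:
  assumes [measurable]: "\<And>k. J k \<in> borel_measurable M" "I \<in> borel_measurable M" and p: "0 < p"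
    and lim: "AE \<omega> in M. (\<lambda>k. J k \<omega>) \<longlonglongrightarrow> I \<omega>" and C: "\<And>k. abs_moment M p (J k) \<le> C"
  shows "abs_moment M p I \<le> C"
proof -
  have "abs_moment M p I = (\<integral>\<^sup>+\<omega>. liminf (\<lambda>k. ennreal (\<bar>J k \<omega>\<bar> powr p)) \<partial>M)"
    unfolding abs_moment_def
  proof (rule nn_integral_cong_AE)
    show "AE \<omega> in M. ennreal (\<bar>I \<omega>\<bar> powr p) = liminf (\<lambda>k. ennreal (\<bar>J k \<omega>\<bar> powr p))"
      using lim
    proof eventually_elim
      case (elim \<omega>)
      have "(\<lambda>k. \<bar>J k \<omega>\<bar> powr p) \<longlonglongrightarrow> \<bar>I \<omega>\<bar> powr p"
        using p by (intro tendsto_powr' tendsto_rabs elim tendsto_const) auto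
      then show ?case by (intro lim_imp_Liminf[symmetric] tendsto_ennrealI) auto
    qed
  qed
  also have "\<dots> \<le> liminf (\<lambda>k. abs_moment M p (J k))"
    unfolding abs_moment_def by (rule nn_integral_liminf) measurable
  also have "\<dots> \<le> C" by (rule Liminf_le) (auto intro: always_eventually C)
  finally show ?thesis .
qed

lemma has_ito_integral_zero_length:
  assumes "measurable_process M 0 H" "adapted_process F 0 H"
  shows "has_ito_integral M F B 0 H (\<lambda>_. 0)"
proof -
  have z: "(\<integral>\<^sup>+s\<in>{0..0}. h s \<partial>lborel) = 0" for h :: "real \<Rightarrow> ennreal"
  proof -
    have "(\<integral>\<^sup>+s\<in>{0..0}. h s \<partial>lborel) = (\<integral>\<^sup>+s. 0 \<partial>(lborel :: real measure))"
    proof (rule nn_integral_cong_AE)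
      have "AE s in lborel. s \<noteq> (0::real)" by (rule AE_lborel_singleton)
      then show "AE s in lborel. h s * indicator {0..0} s = 0" by eventually_elim simp
    qed
    then show ?thesis by simp
  qed
  have "simple_data M F 0 0 (\<lambda>_. 0) (\<lambda>_ _. 0)" by (simp add: simple_data_def)
  moreover have "Defs.simple_integral B 0 (\<lambda>_. 0) (\<lambda>_ _. 0) = (\<lambda>_. 0)"
      by (simp add: simple_integral_def fun_eq_iff)
  ultimately show ?thesis
    unfolding has_ito_integral_def z using assms
    by (intro conjI exI[of _ "\<lambda>_. 0"] exI[of _ "\<lambda>_ _. 0"] exI[of _ "\<lambda>_ _ _. 0"]) auto
qed

text \<open>The integral is the pointwise limit of \<open>F t\<close>-measurable simple integrals, hence itself
  \<open>F t\<close>-measurable although \<open>F t\<close> may lack null sets; the moment bounds pass to the limit by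
  Fatou's lemma.\<close>

lemma dominated_ito_integral:
  assumes H: "measurable_process M t H" and ad: "adapted_process F t H" and t: "0 \<le> t" "t \<le> T"
    and \<phi>m: "\<phi> \<in> borel_measurable borel"
    and mono: "\<And>s u. 0 \<le> s \<Longrightarrow> s \<le> u \<Longrightarrow> u < t \<Longrightarrow> \<phi> s \<le> \<phi> u"
    and pos: "\<And>s. 0 \<le> s \<Longrightarrow> s < t \<Longrightarrow> 0 < \<phi> s"
    and bound: "\<And>s \<omega>. 0 \<le> s \<Longrightarrow> s < t \<Longrightarrow> \<omega> \<in> space M \<Longrightarrow> \<bar>H s \<omega>\<bar> \<le> \<phi> s"
    and V: "(\<integral>\<^sup>+s\<in>{0..<t}. ennreal ((\<phi> s)\<^sup>2) \<partial>lborel) \<le> ennreal V" "0 \<le> V"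
  shows "\<exists>I. I \<in> borel_measurable (F t) \<and> has_ito_integral M F B t H I \<and>
    (\<forall>p>0. abs_moment M p I \<le> ennreal (2 * p powr p * exp (V / 2)))"
proof (cases "t = 0")
  case True
  have "abs_moment M p (\<lambda>_. 0) \<le> ennreal (2 * p powr p * exp (V / 2))" if "0 < p" for p
    using that by (simp add: abs_moment_def)
  then show ?thesis
    using has_ito_integral_zero_length H ad True by (intro exI[of _ "\<lambda>_. 0"]) simp
next
  case False
  then have t': "0 < t" using t by simp
  have Vfin: "(\<integral>\<^sup>+s\<in>{0..<t}. ennreal ((\<phi> s)\<^sup>2) \<partial>lborel) < \<infinity>"
    using V(1) by (rule le_less_trans) simp
  have "\<exists>N \<tau> \<xi>. simple_data M F t N \<tau> \<xi> \<and> (\<forall>i<N. \<tau> i < t) \<and>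
      (\<forall>i<N. \<forall>\<omega>\<in>space M. \<bar>\<xi> i \<omega>\<bar> \<le> \<phi> (\<tau> i)) \<and> sq_dist M t H (simple_process N \<tau> \<xi>) \<le>
          ennreal (1 / 4 ^ k)" for k
  proof -
    have pk: "(0::real) < 1 / 4 ^ k" by simp
    show ?thesis
      by (rule dominated_process_approximation[OF H ad t' t(2) \<phi>m _ _ Vfin pk]) (rule mono bound; assumption)+
  qed
  then have "\<forall>k. \<exists>N \<tau> \<xi>. simple_data M F t N \<tau> \<xi> \<and> (\<forall>i<N. \<tau> i < t) \<and>
      (\<forall>i<N. \<forall>\<omega>\<in>space M. \<bar>\<xi> i \<omega>\<bar> \<le> \<phi> (\<tau> i)) \<and> sq_dist M t H (simple_process N \<tau> \<xi>) \<le> ennreal (1 / 4 ^ k)"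
    by blast
  then obtain N \<tau> \<xi> where "\<forall>k. simple_data M F t (N k) (\<tau> k) (\<xi> k) \<and> (\<forall>i<N k. \<tau> k i < t) \<and>
      (\<forall>i<N k. \<forall>\<omega>\<in>space M. \<bar>\<xi> k i \<omega>\<bar> \<le> \<phi> (\<tau> k i)) \<and> sq_dist M t H (simple_process (N k) (\<tau> k) (\<xi> k)) \<le>
          ennreal (1 / 4 ^ k)"
    unfolding choice_iff by (elim exE)
  then have A: "\<And>k. simple_data M F t (N k) (\<tau> k) (\<xi> k)"
    "\<And>k i. i < N k \<Longrightarrow> \<tau> k i < t"
    "\<And>k i \<omega>. i < N k \<Longrightarrow> \<omega> \<in> space M \<Longrightarrow> \<bar>\<xi> k i \<omega>\<bar> \<le> \<phi> (\<tau> k i)"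
    "\<And>k. sq_dist M t H (simple_process (N k) (\<tau> k) (\<xi> k)) \<le> ennreal (1 / 4 ^ k)"
    by blast+
  define J where "J = (\<lambda>k. Defs.simple_integral B (N k) (\<tau> k) (\<xi> k))"
  define S where "S = (\<lambda>k. simple_process (N k) (\<tau> k) (\<xi> k))"
  define I where "I = (\<lambda>\<omega>. lim (\<lambda>k. J k \<omega>))"
  have JF[measurable]: "J k \<in> borel_measurable (F t)" for k
    unfolding J_def by (rule simple_integral_measurable[OF A(1) order_refl t(2) order_refl])
  have JM[measurable]: "J k \<in> borel_measurable M" for k
    by (rule measurable_F_M[OF t JF])
  have SM: "measurable_process M t (S k)" for k
    unfolding S_def by (rule simple_process_measurable[OF A(1) t(2)])
  have IF: "I \<in> borel_measurable (F t)" unfolding I_def by measurable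
  have IM[measurable]: "I \<in> borel_measurable M" by (rule measurable_F_M[OF t IF])
  have step: "ms_dist M (J (Suc k)) (J k) \<le> ennreal (4 / 4 ^ k)" for k
  proof -
    have "ms_dist M (J (Suc k)) (J k) = sq_dist M t (S (Suc k)) (S k)"
      unfolding J_def S_def by (rule simple_isometry[OF A(1) A(1) t(2)])
    also have "\<dots> \<le> 2 * (sq_dist M t (S (Suc k)) H + sq_dist M t H (S k))"
      by (rule sq_dist_triangle[OF SM H SM])
    also have "\<dots> \<le> ennreal 2 * (ennreal (1 / 4 ^ Suc k) + ennreal (1 / 4 ^ k))"
      using A(4)[of k] A(4)[of "Suc k"] unfolding S_def sq_dist_commute[of _ _ _ H]
      by (intro mult_mono add_mono) auto
    also have "\<dots> = ennreal (2 * (1 / 4 ^ Suc k + 1 / 4 ^ k))"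
      by (simp flip: ennreal_plus ennreal_mult' del: ennreal_numeral distrib_left_numeral)
    also have "\<dots> \<le> ennreal (4 / 4 ^ k)"
      by (intro ennreal_leI) (simp add: field_simps)
    finally show ?thesis .
  qed
  have conv: "AE \<omega> in M. (\<lambda>k. J k \<omega>) \<longlonglongrightarrow> I \<omega>"
    using AE_convergent_of_fast_Cauchy[of J 4, OF JM _ step]
    unfolding I_def convergent_LIMSEQ_iff by simp
  have dist: "ms_dist M I (J k) \<le> ennreal (16 / 4 ^ k)" for k
    using lim_square_dist_of_fast_Cauchy[of J 4, OF JM _ step, of k] unfolding I_def by simp
  have g0: "(\<lambda>k. ennreal (c / 4 ^ k)) \<longlonglongrightarrow> 0" for c
  proof -
    have "(\<lambda>k. ennreal (c * (1 / 4) ^ k)) \<longlonglongrightarrow> ennreal (c * 0)"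
      by (intro tendsto_ennrealI tendsto_intros LIMSEQ_power_zero) auto
    moreover have "c * (1 / 4) ^ k = c / 4 ^ k" for k by (simp add: power_one_over)
    ultimately show ?thesis by simp
  qed
  have "(\<lambda>k. sq_dist M t H (S k)) \<longlonglongrightarrow> 0"
    by (rule tendsto_sandwich[OF _ _ tendsto_const g0[of 1]]) (use A(4) in \<open>auto simp: S_def\<close>)
  moreover have "(\<lambda>k. ms_dist M I (J k)) \<longlonglongrightarrow> 0"
    by (rule tendsto_sandwich[OF _ _ tendsto_const g0[of 16]]) (use dist in auto)
  ultimately have "has_ito_integral M F B t H I"
    unfolding has_ito_integral_def using H ad IM A(1) unfolding S_def J_def sq_dist_def by blast
  moreover have "abs_moment M p I \<le> ennreal (2 * p powr p * exp (V / 2))" if "0 < p" for p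
  proof (rule abs_moment_limit[OF JM IM that conv])
    fix k
    show "abs_moment M p (J k) \<le> ennreal (2 * p powr p * exp (V / 2))"
      unfolding J_def
    proof (rule simple_integral_abs_moment[OF A(1) t, where c = "\<lambda>i. \<phi> (\<tau> k i)"])
      show "\<And>i. i < N k \<Longrightarrow> 0 < \<phi> (\<tau> k i)"
        using pos A(2) simple_data_node[OF A(1)[of k]] by simp
      show "(\<Sum>i<N k. (\<phi> (\<tau> k i))\<^sup>2 * (\<tau> k (Suc i) - \<tau> k i)) \<le> V"
        by (rule left_sum_le_integral_of_mono[OF mono pos V])
          (use A(2) simple_data_node[OF A(1)[of k]] simple_data_step[OF A(1)[of k]] in auto)
    qed (use A(3) that in auto)
  qed
  ultimately show ?thesis using IF by blast
qed

end

section \<open>Estimates for the power kernel\<close>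

lemma nn_integral_powr_kernel:
  assumes "0 < a" "u \<le> t"
  shows "(\<integral>\<^sup>+s\<in>{u..<t}. ennreal ((t - s) powr (a - 1)) \<partial>lborel) = ennreal ((t - u) powr a / a)"
proof -
  let ?f = "\<lambda>x. ennreal (x powr (a - 1)) * indicator {0..t - u} x"
  have "((\<lambda>x. x powr (a - 1)) has_integral ((t - u) powr (a - 1 + 1) / (a - 1 + 1))) {0..t - u}"
    using assms by (intro has_integral_powr_from_0) auto
  then have "(\<integral>\<^sup>+x. ?f x \<partial>lborel) = ennreal ((t - u) powr a / a)"
    using nn_integral_has_integral_lebesgue'[of "{0..t - u}" "\<lambda>x. x powr (a - 1)"] by simp
  also have "(\<integral>\<^sup>+x. ?f x \<partial>lborel) = (\<integral>\<^sup>+s. ?f (t + (-1) * s) \<partial>lborel)"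
    by (subst nn_integral_real_affine[of ?f "-1" t]) auto
  also have "\<dots> = (\<integral>\<^sup>+s\<in>{u..<t}. ennreal ((t - s) powr (a - 1)) \<partial>lborel)"
    by (intro nn_integral_cong) (auto simp: indicator_def)
  finally show ?thesis by simp
qed

lemma powr_le_bound:
  fixes r T w :: real
  assumes "0 < r" "r \<le> T" "0 \<le> w" "w \<le> 1" shows "r powr w \<le> 1 + T"
proof (cases "r \<le> 1")
  case True
  then have "r powr w \<le> 1" using assms by (intro powr_le1) auto
  then show ?thesis using assms by linarith
next
  case False
  then have "r powr w \<le> r powr 1" using assms by (intro powr_mono) auto
  then show ?thesis using assms by simp
qed

text \<open>Below, \<open>\<eta>\<close> is a lower bound of the Hurst exponents that is cut off at one half, so that the
  envelope \<open>r powr (\<eta> - 1/2)\<close> is antitone in \<open>r\<close>.\<close>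

lemma power_kernel_bound:
  fixes r T \<eta> v :: real
  assumes "0 < r" "r \<le> T" "\<eta> - 1/2 \<le> v" "v \<le> 1/2" "0 < \<eta>"
  shows "r powr v \<le> (1 + T) * r powr (\<eta> - 1/2)"
proof -
  have "r powr v = r powr (v - \<eta> + 1/2) * r powr (\<eta> - 1/2)" by (simp flip: powr_add)
  also have "\<dots> \<le> (1 + T) * r powr (\<eta> - 1/2)"
    using assms by (intro mult_right_mono powr_le_bound) auto
  finally show ?thesis .
qed

lemma abs_ln_powr_bound:
  fixes r T \<eta> :: real
  assumes "0 < r" "r \<le> T" "0 < \<eta>" "\<eta> \<le> 1"
  shows "\<bar>ln r\<bar> * r powr (\<eta> / 2) \<le> T * (1 + T) + 2 / \<eta>"
proof (cases "1 \<le> r")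
  case True
  have "\<bar>ln r\<bar> \<le> T" using True assms ln_le_minus_one[of r] by simp
  then have "\<bar>ln r\<bar> * r powr (\<eta> / 2) \<le> T * (1 + T)"
    using assms by (intro mult_mono powr_le_bound) auto
  then show ?thesis using assms by (simp add: add_increasing2)
next
  case False
  have "ln (r powr (- (\<eta> / 2))) \<le> r powr (- (\<eta> / 2))"
    using ln_le_minus_one[of "r powr (- (\<eta> / 2))"] assms by simp
  then have "- (\<eta> / 2) * ln r \<le> r powr (- (\<eta> / 2))" using assms by (simp add: ln_powr)
  then have "- ln r \<le> 2 / \<eta> * r powr (- (\<eta> / 2))" using assms by (simp add: field_simps)
  then have "\<bar>ln r\<bar> \<le> 2 / \<eta> * r powr (- (\<eta> / 2))" using False assms by simp
  then have "\<bar>ln r\<bar> * r powr (\<eta> / 2) \<le> 2 / \<eta> * r powr (- (\<eta> / 2)) * r powr (\<eta> / 2)"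
    by (intro mult_right_mono) auto
  also have "\<dots> = 2 / \<eta> * (r powr (- (\<eta> / 2)) * r powr (\<eta> / 2))" by simp
  also have "\<dots> = 2 / \<eta>" using assms unfolding powr_add[symmetric] by simp
  finally show ?thesis using assms by (simp add: add_increasing)
qed

text \<open>By the mean value theorem in the exponent. The logarithm is absorbed by \<open>r powr (\<eta> / 2)\<close>, so
  that the square is controlled by \<open>r powr (\<eta> - 1)\<close> instead of \<open>r powr (2 * \<eta> - 1)\<close>; this is still
  integrable at zero.\<close>

lemma power_kernel_exponent_Lipschitz_ordered:
  fixes r T \<eta> u v :: real
  assumes r: "0 < r" "r \<le> T" and "\<eta> - 1/2 \<le> u" "u < v" "v \<le> 1/2" and \<eta>: "0 < \<eta>" "\<eta> \<le> 1"
  shows "(r powr u - r powr v)\<^sup>2 \<le> ((1 + T) * (T * (1 + T) + 2 / \<eta>))\<^sup>2 * (u - v)\<^sup>2 * r powr (\<eta> - 1)"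
proof -
  let ?A = "1 + T" and ?D = "T * (1 + T) + 2 / \<eta>"
  have "\<exists>z>u. z < v \<and> r powr v - r powr u = (v - u) * (r powr z * ln r)"
    using r by (intro MVT2 \<open>u < v\<close>) (auto intro!: derivative_eq_intros)
  then obtain z where z: "u < z" "z < v" "r powr v - r powr u = (v - u) * (r powr z * ln r)" by blast
  have "r powr z * \<bar>ln r\<bar> \<le> ?A * r powr (\<eta> - 1/2) * \<bar>ln r\<bar>"
    using z assms by (intro mult_right_mono power_kernel_bound) auto
  also have "\<dots> = ?A * (\<bar>ln r\<bar> * r powr (\<eta> / 2)) * r powr (\<eta> / 2 - 1/2)"
  proof -
    have "r powr (\<eta> - 1/2) = r powr (\<eta> / 2) * r powr (\<eta> / 2 - 1/2)" by (simp flip: powr_add)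
    then show ?thesis by simp
  qed
  also have "\<dots> \<le> ?A * ?D * r powr (\<eta> / 2 - 1/2)"
    using r \<eta> by (intro mult_right_mono mult_left_mono abs_ln_powr_bound) auto
  finally have "\<bar>r powr z * ln r\<bar> \<le> ?A * ?D * r powr (\<eta> / 2 - 1/2)" by (simp add: abs_mult)
  moreover have "0 \<le> ?A * ?D * r powr (\<eta> / 2 - 1/2)" using r \<eta> by simp
  ultimately have "(r powr z * ln r)\<^sup>2 \<le> (?A * ?D * r powr (\<eta> / 2 - 1/2))\<^sup>2"
    by (intro abs_le_square_iff[THEN iffD1]) simp
  also have "\<dots> = (?A * ?D)\<^sup>2 * r powr (\<eta> - 1)"
    unfolding power_mult_distrib[of _ "r powr _"] by (simp add: power2_eq_square flip: powr_add)
  finally have "(v - u)\<^sup>2 * (r powr z * ln r)\<^sup>2 \<le> (v - u)\<^sup>2 * ((?A * ?D)\<^sup>2 * r powr (\<eta> - 1))"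
    by (intro mult_left_mono) auto
  moreover have "(r powr u - r powr v)\<^sup>2 = (v - u)\<^sup>2 * (r powr z * ln r)\<^sup>2"
    unfolding power2_commute[of "r powr u"] z(3) by (rule power_mult_distrib)
  ultimately show ?thesis by (simp only: power2_commute[of u v] ac_simps)
qed

lemma power_kernel_exponent_Lipschitz:
  fixes r T \<eta> u v :: real
  assumes "0 < r" "r \<le> T" and "u \<in> {\<eta> - 1/2..1/2}" "v \<in> {\<eta> - 1/2..1/2}" and "0 < \<eta>" "\<eta> \<le> 1"
  shows "(r powr u - r powr v)\<^sup>2 \<le> ((1 + T) * (T * (1 + T) + 2 / \<eta>))\<^sup>2 * (u - v)\<^sup>2 * r powr (\<eta> - 1)"
proof (cases u v rule: linorder_cases)
  case less
  then show ?thesis using power_kernel_exponent_Lipschitz_ordered[of r T \<eta> u v] assms by auto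
next
  case greater
  then show ?thesis using power_kernel_exponent_Lipschitz_ordered[of r T \<eta> v u] assms
    by (auto simp: power2_commute)
qed simp

lemma min_one_square_le_powr:
  fixes y \<eta> :: real
  assumes "0 \<le> y" "0 < \<eta>" "\<eta> \<le> 1" shows "(min 1 y)\<^sup>2 \<le> y powr \<eta>"
proof (cases "y \<le> 1")
  case True
  show ?thesis
  proof (cases "y = 0")
    case False
    then have "y powr 2 \<le> y powr \<eta>" using True assms by (intro powr_mono') auto
    then show ?thesis using True assms False by (simp add: powr_realpow)
  qed simp
next
  case False
  then have "1 \<le> y powr \<eta>" using assms by (intro ge_one_powr_ge_zero) auto
  then show ?thesis using False by simp
qed

text \<open>The increment is at most the envelope at \<open>r\<close>, and by the mean value theorem at most \<open>d / r\<close>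
  times this envelope. Interpolating with \<open>(min 1 y)\<^sup>2 \<le> y powr \<eta>\<close> leaves the integrable
  singularity \<open>r powr (\<eta> - 1)\<close>.\<close>

lemma power_kernel_time_Hoelder:
  fixes r d T \<eta> v :: real
  assumes r: "0 < r" "0 \<le> d" "r + d \<le> T" and v: "v \<in> {\<eta> - 1/2..1/2}" and \<eta>: "0 < \<eta>" "\<eta> \<le> 1/2"
  shows "((r + d) powr v - r powr v)\<^sup>2 \<le> (1 + T)\<^sup>2 * d powr \<eta> * r powr (\<eta> - 1)"
proof (cases "d = 0")
  case False
  then have d: "0 < d" using r by simp
  let ?m = "(1 + T) * r powr (\<eta> - 1/2)"
  have anti: "z powr (\<eta> - 1/2) \<le> r powr (\<eta> - 1/2)" if "r \<le> z" for z
    using that r \<eta> by (intro powr_mono2') auto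
  have bd: "z powr v \<le> ?m" if "r \<le> z" "z \<le> r + d" for z
  proof -
    have "z powr v \<le> (1 + T) * z powr (\<eta> - 1/2)"
      using that r v \<eta> by (intro power_kernel_bound) auto
    also have "\<dots> \<le> ?m" using anti that r by (intro mult_left_mono) auto
    finally show ?thesis .
  qed
  have "\<bar>(r + d) powr v - r powr v\<bar> \<le> ?m"
  proof -
    have "0 \<le> (r + d) powr v" "0 \<le> r powr v" "(r + d) powr v \<le> ?m" "r powr v \<le> ?m" using bd r by auto
    then show ?thesis by linarith
  qed
  moreover have "\<bar>(r + d) powr v - r powr v\<bar> \<le> ?m * (d / r)"
  proof -
    have "\<exists>z>r. z < r + d \<and> (r + d) powr v - r powr v = (r + d - r) * (v * z powr (v - 1))"
      using r d by (intro MVT2) (auto intro!: derivative_eq_intros)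
    then obtain z where z: "r < z" "z < r + d" "(r + d) powr v - r powr v = d * (v * z powr (v - 1))"
        by auto
    have "\<bar>v\<bar> \<le> 1" using v \<eta> by auto
    moreover have "z powr (v - 1) \<le> ?m / r"
    proof -
      have "z powr (v - 1) = z powr v / z" using z r by (simp add: powr_diff)
      also have "\<dots> \<le> ?m / r" using z r bd by (intro frac_le) auto
      finally show ?thesis .
    qed
    ultimately have "\<bar>v\<bar> * z powr (v - 1) \<le> 1 * (?m / r)" by (intro mult_mono) auto
    then have "d * (\<bar>v\<bar> * z powr (v - 1)) \<le> d * (?m / r)" using d by (intro mult_left_mono) auto
    moreover have "\<bar>d * (v * z powr (v - 1))\<bar> = d * (\<bar>v\<bar> * z powr (v - 1))" using d
        by (simp add: abs_mult)
    ultimately show ?thesis unfolding z(3) by (simp add: ac_simps)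
  qed
  moreover have "?m * min 1 (d / r) = min ?m (?m * (d / r))"
  proof -
    have "0 \<le> ?m" using r by simp
    then show ?thesis by (simp add: min_mult_distrib_left)
  qed
  ultimately have "\<bar>(r + d) powr v - r powr v\<bar> \<le> \<bar>?m * min 1 (d / r)\<bar>" by simp
  then have "((r + d) powr v - r powr v)\<^sup>2 \<le> (?m * min 1 (d / r))\<^sup>2"
    by (rule abs_le_square_iff[THEN iffD1])
  also have "\<dots> = ?m\<^sup>2 * (min 1 (d / r))\<^sup>2" by (rule power_mult_distrib)
  also have "\<dots> \<le> ?m\<^sup>2 * (d / r) powr \<eta>"
    using d r \<eta> by (intro mult_left_mono min_one_square_le_powr) auto
  also have "\<dots> = (1 + T)\<^sup>2 * d powr \<eta> * (r powr (\<eta> - 1/2) * r powr (\<eta> - 1/2) / r powr \<eta>)"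
    using d r by (simp add: powr_divide power2_eq_square)
  also have "r powr (\<eta> - 1/2) * r powr (\<eta> - 1/2) / r powr \<eta> = r powr (\<eta> - 1)"
    by (simp flip: powr_add powr_diff)
  finally show ?thesis .
qed simp

lemma square_le_powr:
  fixes d T \<eta> :: real
  assumes "0 \<le> d" "d \<le> T" "0 < \<eta>" "\<eta> \<le> 1" shows "d\<^sup>2 \<le> (1 + T)\<^sup>2 * d powr \<eta>"
proof (cases "d = 0")
  case False
  then have d: "0 < d" using assms by simp
  have "d\<^sup>2 = d * (d powr (1 - \<eta>) * d powr \<eta>)"
    using d by (simp add: power2_eq_square flip: powr_add)
  also have "\<dots> \<le> (1 + T) * ((1 + T) * d powr \<eta>)"
    using d assms by (intro mult_mono mult_right_mono powr_le_bound) auto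
  finally show ?thesis by (simp add: power2_eq_square)
qed simp

text \<open>The substitution \<open>r = t - s\<close> turns the integral into \<open>exp (l * t)\<close> times a truncated Laplace
  transform of \<open>r powr (\<eta> - 1)\<close>, which tends to zero as \<open>l\<close> grows.\<close>

lemma weighted_kernel_small:
  fixes \<eta> T e :: real
  assumes "0 < \<eta>" "0 \<le> T" "0 < e"
  obtains l where "0 < l" "\<And>t. 0 \<le> t \<Longrightarrow> t \<le> T \<Longrightarrow>
    (\<integral>\<^sup>+s\<in>{0..<t}. ennreal ((t - s) powr (\<eta> - 1) * exp (l * s)) \<partial>lborel) \<le> ennreal (e * exp (l * t))"
proof -
  let ?w = "\<lambda>r. ennreal (r powr (\<eta> - 1)) * indicator {0<..T} r"
  let ?h = "\<lambda>n r. ennreal (r powr (\<eta> - 1) * exp (- real n * r)) * indicator {0<..T} r"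
  have "(\<integral>\<^sup>+r. ?w r \<partial>lborel) \<le> (\<integral>\<^sup>+r. ennreal (r powr (\<eta> - 1)) * indicator {0..T} r \<partial>lborel)"
    by (intro nn_integral_mono) (auto simp: indicator_def)
  also have "\<dots> = ennreal (T powr \<eta> / \<eta>)"
    using nn_integral_has_integral_lebesgue'[OF _ has_integral_powr_from_0[of "\<eta> - 1" T]] assms by simp
  finally have w: "(\<integral>\<^sup>+r. ?w r \<partial>lborel) < \<infinity>" by (rule le_less_trans) simp
  have "(\<lambda>n. \<integral>\<^sup>+r. ?h n r \<partial>lborel) \<longlonglongrightarrow> (\<integral>\<^sup>+r. 0 \<partial>(lborel :: real measure))"
  proof (rule nn_integral_dominated_convergence[where w = ?w])
    fix n show "AE r in lborel. ?h n r \<le> ?w r"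
    proof (intro AE_I2)
      fix r :: real
      have "r powr (\<eta> - 1) * exp (- real n * r) \<le> r powr (\<eta> - 1) * 1" if "0 < r"
        using that by (intro mult_left_mono) auto
      then show "?h n r \<le> ?w r" by (auto simp: indicator_def intro!: ennreal_leI)
    qed
  next
    show "AE r in lborel. (\<lambda>n. ?h n r) \<longlonglongrightarrow> 0"
    proof (intro AE_I2)
      fix r :: real
      show "(\<lambda>n. ?h n r) \<longlonglongrightarrow> 0"
      proof (cases "0 < r")
        case True
        have "(\<lambda>n. exp (- r) ^ n) \<longlonglongrightarrow> 0" using True by (intro LIMSEQ_power_zero) simp
        moreover have "exp (- r) ^ n = exp (- real n * r)" for n
          using exp_of_nat_mult[of n "- r"] by simp
        ultimately have "(\<lambda>n. exp (- real n * r)) \<longlonglongrightarrow> 0" by simp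
        then have "(\<lambda>n. ennreal (r powr (\<eta> - 1) * exp (- real n * r))) \<longlonglongrightarrow> ennreal (r powr (\<eta> - 1) * 0)"
          by (intro tendsto_ennrealI tendsto_intros)
        then show ?thesis by (cases "r \<le> T") (auto simp: indicator_def)
      qed simp
    qed
  qed (use w in auto)
  then have "\<forall>\<^sub>F n in sequentially. (\<integral>\<^sup>+r. ?h n r \<partial>lborel) < ennreal e"
    using assms by (intro order_tendstoD(2)) auto
  then obtain n0 where n0: "\<And>n. n0 \<le> n \<Longrightarrow> (\<integral>\<^sup>+r. ?h n r \<partial>lborel) < ennreal e"
    by (auto simp: eventually_sequentially)
  have n: "(\<integral>\<^sup>+r. ?h (Suc n0) r \<partial>lborel) \<le> ennreal e"
    by (rule less_imp_le[OF n0[OF le_SucI[OF order_refl]]])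
  define l where "l = real (Suc n0)"
  show thesis
  proof (rule that[of l])
    show "0 < l" by (simp add: l_def)
    fix t assume t: "0 \<le> t" "t \<le> T"
    have "(\<integral>\<^sup>+s\<in>{0..<t}. ennreal ((t - s) powr (\<eta> - 1) * exp (l * s)) \<partial>lborel) \<le>
        (\<integral>\<^sup>+s. ennreal (exp (l * t)) * ?h (Suc n0) (t + (-1) * s) \<partial>lborel)"
    proof (rule nn_integral_mono)
      fix s
      show "ennreal ((t - s) powr (\<eta> - 1) * exp (l * s)) * indicator {0..<t} s \<le>
          ennreal (exp (l * t)) * ?h (Suc n0) (t + (-1) * s)"
      proof (cases "s \<in> {0..<t}")
        case True
        have "exp (l * s) = exp (l * t) * exp (- real (Suc n0) * (t - s))"
          by (simp add: l_def algebra_simps flip: exp_add)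
        then show ?thesis using True t by (simp add: ac_simps flip: ennreal_mult')
      qed simp
    qed
    also have "\<dots> = ennreal (exp (l * t)) * (\<integral>\<^sup>+s. ?h (Suc n0) (t + (-1) * s) \<partial>lborel)"
      by (rule nn_integral_cmult) measurable
    also have "(\<integral>\<^sup>+s. ?h (Suc n0) (t + (-1) * s) \<partial>lborel) = (\<integral>\<^sup>+r. ?h (Suc n0) r \<partial>lborel)"
    proof -
      have "(\<integral>\<^sup>+r. ?h (Suc n0) r \<partial>lborel) = ennreal \<bar>-1\<bar> * (\<integral>\<^sup>+s. ?h (Suc n0) (t + (-1) * s) \<partial>lborel)"
        by (rule nn_integral_real_affine) auto
      then show ?thesis by (simp only: abs_minus_cancel abs_one ennreal_1 mult_1)
    qed
    also have "ennreal (exp (l * t)) * (\<integral>\<^sup>+r. ?h (Suc n0) r \<partial>lborel) \<le> ennreal (exp (l * t)) * ennreal e"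
      using n by (intro mult_left_mono) auto
    finally show "(\<integral>\<^sup>+s\<in>{0..<t}. ennreal ((t - s) powr (\<eta> - 1) * exp (l * s)) \<partial>lborel) \<le>
        ennreal (e * exp (l * t))"
      using assms by (simp add: ac_simps flip: ennreal_mult')
  qed
qed

section \<open>The self-exciting kernel\<close>

locale sem_equation = brownian M T F B
  for M :: "'a measure" and T :: real and F :: "real \<Rightarrow> 'a measure" and B :: "real \<Rightarrow> 'a \<Rightarrow> real" +
  fixes h :: "real \<Rightarrow> real \<Rightarrow> real" and hl hu :: real
  assumes hurst: "hurst_function T hl hu h" and T_pos: "0 < T"
begin

definition \<eta> :: real where "\<eta> = min hl (1/2)"

lemma \<eta>: "0 < \<eta>" "\<eta> \<le> 1/2" "\<eta> \<le> 1"
  using hurst by (auto simp: \<eta>_def hurst_function_def)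

lemma hurst_exponent:
  assumes "0 \<le> t" "t \<le> T" shows "h t x - 1/2 \<in> {\<eta> - 1/2..1/2}"
proof -
  have "h t x \<in> {hl..hu}" "hu < 1" using hurst assms unfolding hurst_function_def by simp_all
  then show ?thesis by (simp add: \<eta>_def min_le_iff_disj)
qed

definition envelope :: "real \<Rightarrow> real \<Rightarrow> real" where
  "envelope t s = (1 + T) * (t - s) powr (\<eta> - 1/2)"

definition variance_bound :: real where
  "variance_bound = (1 + T)\<^sup>2 * (T powr (2 * \<eta>) / (2 * \<eta>))"

lemma sem_kernel_le_envelope:
  assumes "0 \<le> s" "s < t" "t \<le> T" shows "\<bar>sem_kernel h t s x\<bar> \<le> envelope t s"
  unfolding sem_kernel_def envelope_def
  using power_kernel_bound[of "t - s" T \<eta> "h t x - 1/2"] hurst_exponent[of t x] \<eta> assms by simp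

lemma envelope_mono:
  assumes "s \<le> u" "u < t" shows "envelope t s \<le> envelope t u"
  unfolding envelope_def using assms \<eta> T_pos by (intro mult_left_mono powr_mono2') auto

lemma envelope_pos: "s < t \<Longrightarrow> 0 < envelope t s"
  unfolding envelope_def using T_pos by simp

lemma envelope_measurable[measurable]: "envelope t \<in> borel_measurable borel"
  unfolding envelope_def by measurable

lemma nn_integral_envelope:
  assumes "u \<le> t"
  shows "(\<integral>\<^sup>+s\<in>{u..<t}. ennreal ((envelope t s)\<^sup>2) \<partial>lborel) =
    ennreal ((1 + T)\<^sup>2 * ((t - u) powr (2 * \<eta>) / (2 * \<eta>)))"
proof -
  have "(envelope t s)\<^sup>2 = (1 + T)\<^sup>2 * (t - s) powr (2 * \<eta> - 1)" for s
    unfolding envelope_def power_mult_distrib by (simp add: power2_eq_square flip: powr_add)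
  then have "(\<integral>\<^sup>+s\<in>{u..<t}. ennreal ((envelope t s)\<^sup>2) \<partial>lborel) =
      (\<integral>\<^sup>+s. ennreal ((1 + T)\<^sup>2) * (ennreal ((t - s) powr (2 * \<eta> - 1)) * indicator {u..<t} s) \<partial>lborel)"
    by (simp add: ennreal_mult' mult.assoc)
  also have "\<dots> = ennreal ((1 + T)\<^sup>2) * (\<integral>\<^sup>+s\<in>{u..<t}. ennreal ((t - s) powr (2 * \<eta> - 1)) \<partial>lborel)"
    by (rule nn_integral_cmult) measurable
  also have "\<dots> = ennreal ((1 + T)\<^sup>2) * ennreal ((t - u) powr (2 * \<eta>) / (2 * \<eta>))"
    using \<eta> assms by (subst nn_integral_powr_kernel) auto
  also have "\<dots> = ennreal ((1 + T)\<^sup>2 * ((t - u) powr (2 * \<eta>) / (2 * \<eta>)))"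
    by (rule ennreal_mult'[symmetric]) simp
  finally show ?thesis .
qed

lemma nn_integral_envelope_le_variance_bound:
  assumes "0 \<le> t" "t \<le> T"
  shows "(\<integral>\<^sup>+s\<in>{0..<t}. ennreal ((envelope t s)\<^sup>2) \<partial>lborel) \<le> ennreal variance_bound"
  unfolding nn_integral_envelope[OF assms(1)] variance_bound_def
  using assms \<eta> by (intro ennreal_leI mult_left_mono divide_right_mono powr_mono2) auto

lemma variance_bound_nonneg: "0 \<le> variance_bound"
  unfolding variance_bound_def using \<eta> by simp

lemma hurst_Lipschitz:
  obtains C where "0 < C"
    "\<And>t x y. 0 \<le> t \<Longrightarrow> t \<le> T \<Longrightarrow> \<bar>h t x - h t y\<bar> \<le> C * \<bar>x - y\<bar>"
    "\<And>t u x. 0 \<le> t \<Longrightarrow> t \<le> T \<Longrightarrow> 0 \<le> u \<Longrightarrow> u \<le> T \<Longrightarrow> \<bar>h t x - h u x\<bar> \<le> C * \<bar>t - u\<bar>"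
proof -
  from hurst obtain C where C: "0 < C" "\<forall>t\<in>{0..T}. \<forall>x y. \<bar>h t x - h t y\<bar> \<le> C * \<bar>x - y\<bar>"
    "\<forall>t\<in>{0..T}. \<forall>u\<in>{0..T}. \<forall>x. \<bar>h t x - h u x\<bar> \<le> C * \<bar>t - u\<bar>"
    unfolding hurst_function_def by (elim conjE exE)
  show thesis by (rule that[OF C(1)]) (simp_all add: C(2,3))
qed

lemma sem_kernel_Lipschitz:
  obtains L where "0 < L"
    "\<And>t s x y. 0 \<le> s \<Longrightarrow> s < t \<Longrightarrow> t \<le> T \<Longrightarrow>
      (sem_kernel h t s x - sem_kernel h t s y)\<^sup>2 \<le> L * (x - y)\<^sup>2 * (t - s) powr (\<eta> - 1)"
proof -
  obtain C where C: "0 < C" "\<And>t x y. 0 \<le> t \<Longrightarrow> t \<le> T \<Longrightarrow> \<bar>h t x - h t y\<bar> \<le> C * \<bar>x - y\<bar>"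
    "\<And>t u x. 0 \<le> t \<Longrightarrow> t \<le> T \<Longrightarrow> 0 \<le> u \<Longrightarrow> u \<le> T \<Longrightarrow> \<bar>h t x - h u x\<bar> \<le> C * \<bar>t - u\<bar>"
    using hurst_Lipschitz by blast
  let ?A = "((1 + T) * (T * (1 + T) + 2 / \<eta>))\<^sup>2"
  have A: "0 < ?A"
    using T_pos \<eta> by (intro zero_less_power mult_pos_pos add_pos_pos divide_pos_pos) auto
  show thesis
  proof (rule that[of "?A * C\<^sup>2"])
    show "0 < ?A * C\<^sup>2" using A C(1) by simp
    fix t s x y :: real assume a: "0 \<le> s" "s < t" "t \<le> T"
    have "\<bar>(h t x - 1/2) - (h t y - 1/2)\<bar> \<le> \<bar>C * (x - y)\<bar>" using C(2)[of t x y] C(1) a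
        by (simp add: abs_mult)
    then have "((h t x - 1/2) - (h t y - 1/2))\<^sup>2 \<le> (C * (x - y))\<^sup>2"
        by (rule abs_le_square_iff[THEN iffD1])
    then have "?A * ((h t x - 1/2) - (h t y - 1/2))\<^sup>2 * (t - s) powr (\<eta> - 1) \<le>
        ?A * (C * (x - y))\<^sup>2 * (t - s) powr (\<eta> - 1)"
      by (intro mult_right_mono mult_left_mono) auto
    with power_kernel_exponent_Lipschitz[of "t - s" T "h t x - 1/2" \<eta> "h t y - 1/2"] hurst_exponent[of t] \<eta> a
    have "(sem_kernel h t s x - sem_kernel h t s y)\<^sup>2 \<le> ?A * (C * (x - y))\<^sup>2 * (t - s) powr (\<eta> - 1)"
      unfolding sem_kernel_def by force
    then show "(sem_kernel h t s x - sem_kernel h t s y)\<^sup>2 \<le> ?A * C\<^sup>2 * (x - y)\<^sup>2 * (t - s) powr (\<eta> - 1)"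
      by (simp only: power_mult_distrib mult.assoc)
  qed
qed

text \<open>The time \<open>t\<close> enters through the base and through the Hurst exponent; the two are changed one
  after the other.\<close>

lemma sem_kernel_time_Hoelder:
  obtains L where "0 < L"
    "\<And>t u s x. 0 \<le> s \<Longrightarrow> s < u \<Longrightarrow> u \<le> t \<Longrightarrow> t \<le> T \<Longrightarrow>
      (sem_kernel h t s x - sem_kernel h u s x)\<^sup>2 \<le> L * (t - u) powr \<eta> * (u - s) powr (\<eta> - 1)"
proof -
  obtain C where C: "0 < C" "\<And>t x y. 0 \<le> t \<Longrightarrow> t \<le> T \<Longrightarrow> \<bar>h t x - h t y\<bar> \<le> C * \<bar>x - y\<bar>"
    "\<And>t u x. 0 \<le> t \<Longrightarrow> t \<le> T \<Longrightarrow> 0 \<le> u \<Longrightarrow> u \<le> T \<Longrightarrow> \<bar>h t x - h u x\<bar> \<le> C * \<bar>t - u\<bar>"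
    using hurst_Lipschitz by blast
  let ?A = "((1 + T) * (T * (1 + T) + 2 / \<eta>))\<^sup>2"
  let ?L1 = "?A * C\<^sup>2 * (1 + T)\<^sup>2" and ?L2 = "(1 + T)\<^sup>2"
  have "0 < ?L1" "0 < ?L2"
    using T_pos \<eta> C(1) by (intro zero_less_power mult_pos_pos add_pos_pos divide_pos_pos; simp)+
  show thesis
  proof (rule that[of "2 * (?L1 + ?L2)"])
    show "0 < 2 * (?L1 + ?L2)" using \<open>0 < ?L1\<close> \<open>0 < ?L2\<close>
      by (intro mult_pos_pos[OF zero_less_numeral] add_pos_pos)
    fix t u s x :: real assume a: "0 \<le> s" "s < u" "u \<le> t" "t \<le> T"
    let ?v = "h t x - 1/2" and ?w = "h u x - 1/2"
    have vw: "?v \<in> {\<eta> - 1/2..1/2}" "?w \<in> {\<eta> - 1/2..1/2}" using hurst_exponent a by auto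
    have "((t - s) powr ?v - (t - s) powr ?w)\<^sup>2 \<le> ?A * (?v - ?w)\<^sup>2 * (t - s) powr (\<eta> - 1)"
      using a \<eta> vw by (intro power_kernel_exponent_Lipschitz) auto
    also have "\<dots> \<le> ?A * (C\<^sup>2 * ((1 + T)\<^sup>2 * (t - u) powr \<eta>)) * (u - s) powr (\<eta> - 1)"
    proof (intro mult_mono mult_left_mono)
      have "\<bar>?v - ?w\<bar> \<le> \<bar>C * (t - u)\<bar>" using C(3)[of t u x] C(1) a by (simp add: abs_mult)
      then have "(?v - ?w)\<^sup>2 \<le> (C * (t - u))\<^sup>2" by (rule abs_le_square_iff[THEN iffD1])
      also have "\<dots> = C\<^sup>2 * (t - u)\<^sup>2" by (rule power_mult_distrib)
      also have "\<dots> \<le> C\<^sup>2 * ((1 + T)\<^sup>2 * (t - u) powr \<eta>)"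
        using a \<eta> by (intro mult_left_mono square_le_powr) auto
      finally show "(?v - ?w)\<^sup>2 \<le> C\<^sup>2 * ((1 + T)\<^sup>2 * (t - u) powr \<eta>)" .
      show "(t - s) powr (\<eta> - 1) \<le> (u - s) powr (\<eta> - 1)" using a \<eta> by (intro powr_mono2') auto
    qed auto
    finally have 1: "((t - s) powr ?v - (t - s) powr ?w)\<^sup>2 \<le> ?L1 * (t - u) powr \<eta> * (u - s) powr (\<eta> - 1)"
      by (simp only: mult.assoc)
    have 2: "((t - s) powr ?w - (u - s) powr ?w)\<^sup>2 \<le> ?L2 * (t - u) powr \<eta> * (u - s) powr (\<eta> - 1)"
      using power_kernel_time_Hoelder[of "u - s" "t - u" T ?w \<eta>] vw \<eta> a by simp
    have "(sem_kernel h t s x - sem_kernel h u s x)\<^sup>2 \<le>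
        2 * (((t - s) powr ?v - (t - s) powr ?w)\<^sup>2 + ((t - s) powr ?w - (u - s) powr ?w)\<^sup>2)"
      unfolding sem_kernel_def by (rule square_dist_triangle)
    also have "\<dots> \<le> 2 * (?L1 * (t - u) powr \<eta> * (u - s) powr (\<eta> - 1) +
        ?L2 * (t - u) powr \<eta> * (u - s) powr (\<eta> - 1))"
      by (intro mult_left_mono add_mono 1 2) simp
    also have "\<dots> = 2 * (?L1 + ?L2) * (t - u) powr \<eta> * (u - s) powr (\<eta> - 1)"
      by (simp only: distrib_right distrib_left mult.assoc)
    finally show "(sem_kernel h t s x - sem_kernel h u s x)\<^sup>2 \<le> 2 * (?L1 +
        ?L2) * (t - u) powr \<eta> * (u - s) powr (\<eta> - 1)" .
  qed
qed

definition admissible :: "(real \<Rightarrow> 'a \<Rightarrow> real) \<Rightarrow> bool" where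
  "admissible Z \<longleftrightarrow> measurable_process M T Z \<and> adapted_process F T Z"

abbreviation kernel :: "(real \<Rightarrow> 'a \<Rightarrow> real) \<Rightarrow> real \<Rightarrow> real \<Rightarrow> 'a \<Rightarrow> real" where
  "kernel Z t \<equiv> (\<lambda>s \<omega>. sem_kernel h t s (Z s \<omega>))"

lemma hurst_measurable:
  assumes "0 \<le> t" "t \<le> T" shows "h t \<in> borel_measurable borel"
proof -
  obtain C where "0 < C" "\<And>t x y. 0 \<le> t \<Longrightarrow> t \<le> T \<Longrightarrow> \<bar>h t x - h t y\<bar> \<le> C * \<bar>x - y\<bar>"
    "\<And>t u x. 0 \<le> t \<Longrightarrow> t \<le> T \<Longrightarrow> 0 \<le> u \<Longrightarrow> u \<le> T \<Longrightarrow> \<bar>h t x - h u x\<bar> \<le> C * \<bar>t - u\<bar>"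
    using hurst_Lipschitz by blast
  then have C: "0 < C" "\<And>x y. \<bar>h t x - h t y\<bar> \<le> C * \<bar>x - y\<bar>" using assms by auto
  have "C-lipschitz_on UNIV (h t)"
    using C by (intro lipschitz_onI) (auto simp: dist_real_def)
  then show ?thesis by (intro borel_measurable_continuous_onI lipschitz_on_continuous_on)
qed

lemma kernel_measurable:
  assumes Z: "admissible Z" and t: "0 \<le> t" "t \<le> T" shows "measurable_process M t (kernel Z t)"
proof -
  have [measurable]: "cut T Z \<in> borel_measurable (lborel \<Otimes>\<^sub>M M)"
    using Z unfolding admissible_def measurable_process_iff_cut by blast
  have [measurable]: "h t \<in> borel_measurable borel" using hurst_measurable[OF t] .
  have "cut t (kernel Z t) = (\<lambda>z. indicator {0..t} (fst z) * (t - fst z) powr (h t (cut T Z z) - 1/2))"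
    using t by (auto simp: cut_def sem_kernel_def fun_eq_iff indicator_def)
  also have "\<dots> \<in> borel_measurable (lborel \<Otimes>\<^sub>M M)" by measurable
  finally show ?thesis unfolding measurable_process_iff_cut .
qed

lemma kernel_adapted:
  assumes Z: "admissible Z" and t: "0 \<le> t" "t \<le> T" shows "adapted_process F t (kernel Z t)"
  unfolding adapted_process_def
proof
  fix s assume "s \<in> {0..t}"
  then have "Z s \<in> borel_measurable (F s)" using Z t unfolding admissible_def adapted_process_def by auto
  moreover have "(\<lambda>x. (t - s) powr (h t x - 1/2)) \<in> borel_measurable borel"
    using hurst_measurable[OF t] by measurable
  ultimately show "kernel Z t s \<in> borel_measurable (F s)"
    unfolding sem_kernel_def by (rule measurable_compose)
qed

definition moment_bound :: "real \<Rightarrow> real" where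
  "moment_bound p = 2 * p powr p * exp (variance_bound / 2)"

lemma kernel_integral:
  assumes Z: "admissible Z" and t: "0 \<le> t" "t \<le> T"
  shows "\<exists>I. I \<in> borel_measurable (F t) \<and> has_ito_integral M F B t (kernel Z t) I \<and>
    (\<forall>p>0. abs_moment M p I \<le> ennreal (moment_bound p))"
proof -
  have "\<bar>kernel Z t s \<omega>\<bar> \<le> envelope t s" if "0 \<le> s" "s < t" for s \<omega>
    using sem_kernel_le_envelope that t by blast
  then show ?thesis
    unfolding moment_bound_def
    by (intro dominated_ito_integral[where \<phi> = "envelope t"] kernel_measurable kernel_adapted Z t
        envelope_measurable envelope_mono envelope_pos nn_integral_envelope_le_variance_bound
        variance_bound_nonneg)
qed

lemma has_ito_integral_cong_AE:
  assumes "has_ito_integral M F B t H I" "AE \<omega> in M. I \<omega> = J \<omega>" "J \<in> borel_measurable M"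
  shows "has_ito_integral M F B t H J"
proof -
  have "ms_dist M J S = ms_dist M I S" for S
    by (rule nn_integral_cong_AE) (use assms(2) in eventually_elim, simp)
  then show ?thesis using assms(1,3) unfolding has_ito_integral_def by simp
qed

text \<open>Up to time \<open>u\<close> the integrands differ by the Hoelder estimate for the kernel; on \<open>(u, t]\<close>
  only the later one is present, and it is bounded by the envelope.\<close>

lemma kernel_integral_Hoelder:
  obtains L where "0 < L"
    "\<And>Z t u I J. admissible Z \<Longrightarrow> 0 \<le> u \<Longrightarrow> u \<le> t \<Longrightarrow> t \<le> T \<Longrightarrow>
      has_ito_integral M F B u (kernel Z u) I \<Longrightarrow> has_ito_integral M F B t (kernel Z t) J \<Longrightarrow>
      ms_dist M I J \<le> ennreal (L * (t - u) powr \<eta>)"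
proof -
  obtain C where C: "0 < C" "\<And>t u s x. 0 \<le> s \<Longrightarrow> s < u \<Longrightarrow> u \<le> t \<Longrightarrow> t \<le> T \<Longrightarrow>
      (sem_kernel h t s x - sem_kernel h u s x)\<^sup>2 \<le> C * (t - u) powr \<eta> * (u - s) powr (\<eta> - 1)"
    using sem_kernel_time_Hoelder by blast
  let ?L = "C * (T powr \<eta> / \<eta>) + (1 + T)\<^sup>2 * (T powr \<eta> / (2 * \<eta>))"
  have L: "0 < ?L" using C(1) T_pos \<eta> by (intro add_pos_nonneg) auto
  show thesis
  proof (rule that[of "16 * ?L"])
    show "0 < 16 * ?L" by (rule mult_pos_pos[OF zero_less_numeral L])
    fix Z t u I J
    assume Z: "admissible Z" and tu: "0 \<le> u" "u \<le> t" "t \<le> T"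
      and I: "has_ito_integral M F B u (kernel Z u) I" and J: "has_ito_integral M F B t (kernel Z t) J"
    let ?d = "(t - u) powr \<eta>"
    let ?G = "\<lambda>s \<omega>. indicator {0..u} s * kernel Z u s \<omega>"
    have pt: "AE s in lborel. ennreal ((?G s \<omega> - kernel Z t s \<omega>)\<^sup>2) * indicator {0..t} s \<le>
        ennreal (C * ?d) * (ennreal ((u - s) powr (\<eta> - 1)) * indicator {0..<u} s) +
        ennreal ((envelope t s)\<^sup>2) * indicator {u..<t} s" for \<omega>
    proof -
      have "AE s in lborel. s \<noteq> u" "AE s in lborel. s \<noteq> t" by (rule AE_lborel_singleton)+
      then show ?thesis
      proof eventually_elim
        case (elim s)
        consider "s < 0 \<or> t < s" | "0 \<le> s" "s < u" | "u < s" "s < t" using elim by linarith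
        then show ?case
        proof cases
          case 2
          then show ?thesis
            using C(2)[of s u t "Z s \<omega>"] C(1) tu
            by (simp add: power2_commute ennreal_leI flip: ennreal_mult')
        next
          case 3
          have "(kernel Z t s \<omega>)\<^sup>2 \<le> (envelope t s)\<^sup>2"
            using sem_kernel_le_envelope[of s t "Z s \<omega>"] 3 tu
            by (intro abs_le_square_iff[THEN iffD1]) auto
          then show ?thesis using 3 tu by (simp add: ennreal_leI)
        qed (use tu in auto)
      qed
    qed
    have inner: "(\<integral>\<^sup>+s\<in>{0..t}. ennreal ((?G s \<omega> - kernel Z t s \<omega>)\<^sup>2) \<partial>lborel) \<le> ennreal (?L * ?d)" for \<omega>
    proof -
      have "(\<integral>\<^sup>+s\<in>{0..t}. ennreal ((?G s \<omega> - kernel Z t s \<omega>)\<^sup>2) \<partial>lborel) \<le>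
        (\<integral>\<^sup>+s. ennreal (C * ?d) * (ennreal ((u - s) powr (\<eta> - 1)) * indicator {0..<u} s) +
        ennreal ((envelope t s)\<^sup>2) * indicator {u..<t} s \<partial>lborel)"
        by (rule nn_integral_mono_AE) (rule pt)
      also have "\<dots> = (\<integral>\<^sup>+s. ennreal (C * ?d) * (ennreal ((u - s) powr (\<eta> - 1)) * indicator {0..<u} s) \<partial>lborel) +
        (\<integral>\<^sup>+s\<in>{u..<t}. ennreal ((envelope t s)\<^sup>2) \<partial>lborel)"
        by (rule nn_integral_add) measurable
      also have "(\<integral>\<^sup>+s. ennreal (C * ?d) * (ennreal ((u - s) powr (\<eta> - 1)) * indicator {0..<u} s) \<partial>lborel) =
         ennreal (C * ?d) * (\<integral>\<^sup>+s\<in>{0..<u}. ennreal ((u - s) powr (\<eta> - 1)) \<partial>lborel)"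
        by (rule nn_integral_cmult) measurable
      also have "\<dots> = ennreal (C * ?d * (u powr \<eta> / \<eta>))"
        using nn_integral_powr_kernel[OF \<eta>(1) tu(1)] C(1) by (simp flip: ennreal_mult')
      also have "(\<integral>\<^sup>+s\<in>{u..<t}. ennreal ((envelope t s)\<^sup>2) \<partial>lborel) = ennreal ((1 +
          T)\<^sup>2 * ((t - u) powr (2 * \<eta>) / (2 * \<eta>)))"
        by (rule nn_integral_envelope[OF tu(2)])
      also have "ennreal (C * ?d * (u powr \<eta> / \<eta>)) + \<dots> =
          ennreal (C * ?d * (u powr \<eta> / \<eta>) + (1 + T)\<^sup>2 * ((t - u) powr (2 * \<eta>) / (2 * \<eta>)))"
        using C(1) \<eta> by (intro ennreal_plus[symmetric]) auto
      also have "\<dots> \<le> ennreal (?L * ?d)"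
      proof (intro ennreal_leI)
        have "C * ?d * (u powr \<eta> / \<eta>) \<le> C * ?d * (T powr \<eta> / \<eta>)"
          using C(1) \<eta> tu by (intro mult_left_mono divide_right_mono powr_mono2) auto
        moreover have "(t - u) powr (2 * \<eta>) \<le> T powr \<eta> * ?d"
        proof -
          have "(t - u) powr (2 * \<eta>) = ?d * ?d" by (simp flip: powr_add)
          also have "\<dots> \<le> T powr \<eta> * ?d" using tu \<eta> by (intro mult_right_mono powr_mono2) auto
          finally show ?thesis .
        qed
        then have "(1 + T)\<^sup>2 * ((t - u) powr (2 * \<eta>) / (2 * \<eta>)) \<le> (1 + T)\<^sup>2 * (T powr \<eta> * ?d / (2 * \<eta>))"
          using \<eta> by (intro mult_left_mono divide_right_mono) auto
        moreover have "?L * ?d = C * ?d * (T powr \<eta> / \<eta>) + (1 + T)\<^sup>2 * (T powr \<eta> * ?d / (2 * \<eta>))"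
          unfolding distrib_right by (simp add: mult.assoc mult.left_commute)
        ultimately show "C * ?d * (u powr \<eta> / \<eta>) + (1 + T)\<^sup>2 * ((t - u) powr (2 * \<eta>) / (2 * \<eta>)) \<le> ?L * ?d"
          by (simp only: add_mono)
      qed
      finally show ?thesis .
    qed
    have "ms_dist M I J \<le> 16 * sq_dist M t ?G (kernel Z t)"
      using has_ito_integral_square_dist[OF has_ito_integral_extend[OF I tu] J] tu by simp
    also have "sq_dist M t ?G (kernel Z t) \<le> (\<integral>\<^sup>+\<omega>. ennreal (?L * ?d) \<partial>M)"
      unfolding sq_dist_def by (intro nn_integral_mono inner)
    also have "\<dots> = ennreal (?L * ?d)" by (simp add: emeasure_space_1)
    finally have "ms_dist M I J \<le> ennreal 16 * ennreal (?L * ?d)"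
      by (simp add: mult_left_mono)
    also have "\<dots> = ennreal (16 * ?L * ?d)"
      using L by (simp only: mult.assoc flip: ennreal_mult')
    finally show "ms_dist M I J \<le> ennreal (16 * ?L * ?d)" .
  qed
qed

end

section \<open>A measurable adapted version of the stochastic convolution\<close>

lemma ennreal_zero_of_le_geometric:
  fixes x :: ennreal assumes "\<And>n. x \<le> ennreal (c / 4 ^ n)" shows "x = 0"
proof -
  have "(\<lambda>n. ennreal (c * (1 / 4) ^ n)) \<longlonglongrightarrow> ennreal (c * 0)"
    by (intro tendsto_ennrealI tendsto_intros LIMSEQ_power_zero) auto
  moreover have "c * (1 / 4) ^ n = c / 4 ^ n" for n by (simp add: power_one_over)
  ultimately have "(\<lambda>n. ennreal (c / 4 ^ n)) \<longlonglongrightarrow> 0" by simp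
  then have "x \<le> 0" by (rule LIMSEQ_le_const) (use assms in blast)
  then show ?thesis by simp
qed

context sem_equation
begin

lemma admissible_measurable:
  assumes "admissible Z" "0 \<le> t" "t \<le> T" shows "Z t \<in> borel_measurable (F t)" "Z t \<in> borel_measurable M"
proof -
  show "Z t \<in> borel_measurable (F t)" using assms unfolding admissible_def adapted_process_def by simp
  then show "Z t \<in> borel_measurable M" by (rule measurable_F_M[OF assms(2,3)])
qed

lemma admissible_add:
  assumes "admissible Z" "admissible Y" shows "admissible (\<lambda>t \<omega>. Z t \<omega> + Y t \<omega>)"
proof -
  have "cut T (\<lambda>t \<omega>. Z t \<omega> + Y t \<omega>) = (\<lambda>z. cut T Z z + cut T Y z)"
    by (auto simp: cut_def fun_eq_iff algebra_simps)
  moreover have "cut T Z \<in> borel_measurable (lborel \<Otimes>\<^sub>M M)" "cut T Y \<in> borel_measurable (lborel \<Otimes>\<^sub>M M)"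
    using assms unfolding admissible_def measurable_process_iff_cut by blast+
  ultimately have "measurable_process M T (\<lambda>t \<omega>. Z t \<omega> + Y t \<omega>)"
    unfolding measurable_process_iff_cut by (simp only: borel_measurable_add)
  moreover have "adapted_process F T (\<lambda>t \<omega>. Z t \<omega> + Y t \<omega>)"
    unfolding adapted_process_def using admissible_measurable(1) assms
    by (auto intro!: borel_measurable_add)
  ultimately show ?thesis unfolding admissible_def by blast
qed

lemma admissible_lim:
  assumes "\<And>n. admissible (Z n)" shows "admissible (\<lambda>t \<omega>. lim (\<lambda>n. Z n t \<omega>))"
proof -
  have "cut T (\<lambda>t \<omega>. lim (\<lambda>n. Z n t \<omega>)) = (\<lambda>z. lim (\<lambda>n. cut T (Z n) z))"
    by (auto simp: cut_def fun_eq_iff indicator_def)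
  moreover have "cut T (Z n) \<in> borel_measurable (lborel \<Otimes>\<^sub>M M)" for n
    using assms unfolding admissible_def measurable_process_iff_cut by blast
  ultimately have "measurable_process M T (\<lambda>t \<omega>. lim (\<lambda>n. Z n t \<omega>))"
    unfolding measurable_process_iff_cut by (simp only: borel_measurable_lim_metric)
  moreover have "adapted_process F T (\<lambda>t \<omega>. lim (\<lambda>n. Z n t \<omega>))"
    unfolding adapted_process_def
  proof
    fix t assume "t \<in> {0..T}"
    then have "Z n t \<in> borel_measurable (F t)" for n using admissible_measurable(1)[OF assms] by simp
    then show "(\<lambda>\<omega>. lim (\<lambda>n. Z n t \<omega>)) \<in> borel_measurable (F t)" by (rule borel_measurable_lim_metric)
  qed
  ultimately show ?thesis unfolding admissible_def by blast
qed

text \<open>The last point of the grid \<open>\<delta> \<int>\<close> that is not after \<open>t\<close>.\<close>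

definition left_node :: "real \<Rightarrow> real \<Rightarrow> real" where
  "left_node \<delta> t = \<delta> * of_int \<lfloor>t / \<delta>\<rfloor>"

lemma left_node_bounds:
  assumes "0 < \<delta>" "0 \<le> t"
  shows "0 \<le> left_node \<delta> t" "left_node \<delta> t \<le> t" "t - left_node \<delta> t \<le> \<delta>"
proof -
  have "0 \<le> \<lfloor>t / \<delta>\<rfloor>" using assms by simp
  then show "0 \<le> left_node \<delta> t" using assms by (simp add: left_node_def)
  have "of_int \<lfloor>t / \<delta>\<rfloor> \<le> t / \<delta>" "t / \<delta> \<le> of_int \<lfloor>t / \<delta>\<rfloor> + 1" by linarith+
  then have "\<delta> * of_int \<lfloor>t / \<delta>\<rfloor> \<le> \<delta> * (t / \<delta>)" "\<delta> * (t / \<delta>) \<le> \<delta> * (of_int \<lfloor>t / \<delta>\<rfloor> + 1)"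
    using assms by (intro mult_left_mono; simp)+
  then show "left_node \<delta> t \<le> t" "t - left_node \<delta> t \<le> \<delta>"
    using assms by (auto simp: left_node_def distrib_left)
qed

text \<open>Only countably many of the random variables \<open>I u\<close> occur, so joint measurability holds
  however the versions \<open>I u\<close> were chosen, and the node lies in the past, so adaptedness is kept.\<close>

lemma admissible_left_node:
  assumes I: "\<And>u. 0 \<le> u \<Longrightarrow> u \<le> T \<Longrightarrow> I u \<in> borel_measurable (F u)" and \<delta>: "0 < \<delta>"
  shows "admissible (\<lambda>t. I (left_node \<delta> t))"
proof -
  define f where "f = (\<lambda>(i::int) z. indicator {0..T} (fst z) *
      (if 0 \<le> \<delta> * of_int i \<and> \<delta> * of_int i \<le> T then I (\<delta> * of_int i) (snd z) else 0))"
  have "f i \<in> borel_measurable (lborel \<Otimes>\<^sub>M M)" for i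
  proof (cases "0 \<le> \<delta> * of_int i \<and> \<delta> * of_int i \<le> T")
    case True
    then have [measurable]: "I (\<delta> * of_int i) \<in> borel_measurable M"
      by (intro measurable_F_M[OF _ _ I]) auto
    show ?thesis using True unfolding f_def by simp
  next
    case False
    then have "f i = (\<lambda>_. 0)" unfolding f_def by auto
    then show ?thesis by simp
  qed
  moreover have "(\<lambda>z. \<lfloor>fst z / \<delta>\<rfloor>) \<in> lborel \<Otimes>\<^sub>M M \<rightarrow>\<^sub>M count_space UNIV" by measurable
  ultimately have "(\<lambda>z. f \<lfloor>fst z / \<delta>\<rfloor> z) \<in> borel_measurable (lborel \<Otimes>\<^sub>M M)"
    by (rule measurable_compose_countable)
  also have "(\<lambda>z. f \<lfloor>fst z / \<delta>\<rfloor> z) = cut T (\<lambda>t. I (left_node \<delta> t))"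
  proof
    fix z :: "real \<times> 'a"
    show "f \<lfloor>fst z / \<delta>\<rfloor> z = cut T (\<lambda>t. I (left_node \<delta> t)) z"
    proof (cases "fst z \<in> {0..T}")
      case True
      then have "0 \<le> left_node \<delta> (fst z)" "left_node \<delta> (fst z) \<le> T"
        using left_node_bounds[OF \<delta>, of "fst z"] by auto
      then show ?thesis by (simp add: f_def cut_def left_node_def case_prod_beta)
    qed (simp add: f_def cut_def case_prod_beta)
  qed
  finally have "measurable_process M T (\<lambda>t. I (left_node \<delta> t))" unfolding measurable_process_iff_cut .
  moreover have "adapted_process F T (\<lambda>t. I (left_node \<delta> t))"
    unfolding adapted_process_def
  proof
    fix t assume t: "t \<in> {0..T}"
    then have b: "0 \<le> left_node \<delta> t" "left_node \<delta> t \<le> t" "left_node \<delta> t \<le> T"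
      using left_node_bounds[OF \<delta>, of t] by auto
    show "I (left_node \<delta> t) \<in> borel_measurable (F t)"
      by (rule measurable_F_mono[OF b(1,2) _ I[OF b(1,3)]]) (use t in simp)
  qed
  ultimately show ?thesis unfolding admissible_def by blast
qed

lemma abs_moment_cong_AE:
  "AE \<omega> in M. I \<omega> = J \<omega> \<Longrightarrow> abs_moment M p I = abs_moment M p J"
  unfolding abs_moment_def by (rule nn_integral_cong_AE) (auto elim: eventually_mono)

text \<open>The integrals are defined separately for each \<open>t\<close>, up to null sets. Freezing them at left
  nodes of finer and finer grids gives admissible processes that converge to them fast in mean
  square, by Hoelder continuity; the pointwise limit is the required version.\<close>

lemma stochastic_convolution:
  assumes Z: "admissible Z"
  shows "\<exists>J. admissible J \<and> (\<forall>t\<in>{0..T}. has_ito_integral M F B t (kernel Z t) (J t) \<and>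
    (\<forall>p>0. abs_moment M p (J t) \<le> ennreal (moment_bound p)))"
proof -
  have "\<forall>t. \<exists>I. 0 \<le> t \<and> t \<le> T \<longrightarrow> I \<in> borel_measurable (F t) \<and> has_ito_integral M F B t (kernel Z t) I \<and>
    (\<forall>p>0. abs_moment M p I \<le> ennreal (moment_bound p))"
    using kernel_integral[OF Z] by blast
  from choice[OF this] obtain I where "\<forall>t. 0 \<le> t \<and> t \<le> T \<longrightarrow> I t \<in> borel_measurable (F t) \<and>
    has_ito_integral M F B t (kernel Z t) (I t) \<and> (\<forall>p>0. abs_moment M p (I t) \<le> ennreal (moment_bound p))"
    by blast
  then have IF: "\<And>t. 0 \<le> t \<Longrightarrow> t \<le> T \<Longrightarrow> I t \<in> borel_measurable (F t)"
    and I: "\<And>t. 0 \<le> t \<Longrightarrow> t \<le> T \<Longrightarrow> has_ito_integral M F B t (kernel Z t) (I t)"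
    and Ip: "\<And>t p. 0 \<le> t \<Longrightarrow> t \<le> T \<Longrightarrow> 0 < p \<Longrightarrow> abs_moment M p (I t) \<le> ennreal (moment_bound p)"
    by blast+
  obtain L where L: "0 < L" "\<And>Z t u I J. admissible Z \<Longrightarrow> 0 \<le> u \<Longrightarrow> u \<le> t \<Longrightarrow> t \<le> T \<Longrightarrow>
      has_ito_integral M F B u (kernel Z u) I \<Longrightarrow> has_ito_integral M F B t (kernel Z t) J \<Longrightarrow>
      ms_dist M I J \<le> ennreal (L * (t - u) powr \<eta>)"
    using kernel_integral_Hoelder by blast
  \<comment> \<open>The mesh for which the Hoelder bound \<open>L * \<delta> powr \<eta>\<close> equals \<open>1 / 2 ^ n\<close>.\<close>
  define \<delta> where "\<delta> = (\<lambda>n::nat. (1 / (L * 2 ^ n)) powr (1 / \<eta>))"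
  have \<delta>: "0 < \<delta> n" "L * \<delta> n powr \<eta> = 1 / 2 ^ n" for n
    using L(1) \<eta>(1) by (simp_all add: \<delta>_def powr_powr)
  define J where "J = (\<lambda>n t. I (left_node (\<delta> n) t))"
  have J: "admissible (J n)" for n
    unfolding J_def by (rule admissible_left_node[OF IF \<delta>(1)])
  have d: "ms_dist M (J n t) (I t) \<le> ennreal (1 / 2 ^ n)" if t: "0 \<le> t" "t \<le> T" for n t
  proof -
    note b = left_node_bounds[OF \<delta>(1)[of n] t(1)]
    have "ms_dist M (J n t) (I t) \<le> ennreal (L * (t - left_node (\<delta> n) t) powr \<eta>)"
      unfolding J_def using b t by (intro L(2)[OF Z] I) auto
    also have "\<dots> \<le> ennreal (L * \<delta> n powr \<eta>)"
      using b L(1) \<eta>(1) by (intro ennreal_leI mult_left_mono powr_mono2) auto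
    finally show ?thesis unfolding \<delta>(2) .
  qed
  define G where "G = (\<lambda>t \<omega>. lim (\<lambda>n. J n t \<omega>))"
  have G: "admissible G" unfolding G_def by (rule admissible_lim[OF J])
  have eq: "AE \<omega> in M. I t \<omega> = G t \<omega>" if t: "0 \<le> t" "t \<le> T" for t
  proof -
    have "AE \<omega> in M. (\<lambda>n. J n t \<omega>) \<longlonglongrightarrow> I t \<omega>"
      by (rule AE_tendsto_of_fast_ms_dist[OF admissible_measurable(2)[OF J t]
            measurable_F_M[OF t IF[OF t]] zero_le_one d[OF t]])
    then show ?thesis unfolding G_def by eventually_elim (simp add: limI)
  qed
  have "has_ito_integral M F B t (kernel Z t) (G t)" if "0 \<le> t" "t \<le> T" for t
    by (rule has_ito_integral_cong_AE[OF I[OF that] eq[OF that] admissible_measurable(2)[OF G that]])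
  moreover have "abs_moment M p (G t) \<le> ennreal (moment_bound p)" if "0 \<le> t" "t \<le> T" "0 < p" for t p
    using Ip[OF that] abs_moment_cong_AE[OF eq[OF that(1,2)]] by simp
  ultimately show ?thesis using G by (intro exI[of _ G]) auto
qed

section \<open>Contraction, existence and uniqueness\<close>

text \<open>The map \<open>Y \<mapsto> \<integral> \<sigma>(t,s,Y\<^sub>s) dB\<^sub>s\<close> contracts the distance \<open>sup\<^sub>t exp (-l t) E \<bar>Y\<^sub>t - Z\<^sub>t\<bar>\<^sup>2\<close> by
  the factor \<open>1 / 4\<close>.\<close>

definition contracting :: "real \<Rightarrow> bool" where
  "contracting l \<longleftrightarrow> 0 < l \<and> (\<forall>Y Z c t I J. admissible Y \<and> admissible Z \<and> 0 \<le> c \<and> 0 \<le> t \<and> t \<le> T \<and>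
     (\<forall>s. 0 \<le> s \<longrightarrow> s < t \<longrightarrow> ms_dist M (Y s) (Z s) \<le> ennreal (c * exp (l * s))) \<and>
     has_ito_integral M F B t (kernel Y t) I \<and> has_ito_integral M F B t (kernel Z t) J \<longrightarrow>
     ms_dist M I J \<le> ennreal (c / 4 * exp (l * t)))"

lemma contracting_pos: "contracting l \<Longrightarrow> 0 < l"
  unfolding contracting_def by blast

lemma contractingD:
  assumes "contracting l" "admissible Y" "admissible Z" "0 \<le> c" "0 \<le> t" "t \<le> T"
    and "\<And>s. 0 \<le> s \<Longrightarrow> s < t \<Longrightarrow> ms_dist M (Y s) (Z s) \<le> ennreal (c * exp (l * s))"
    and "has_ito_integral M F B t (kernel Y t) I" "has_ito_integral M F B t (kernel Z t) J"
  shows "ms_dist M I J \<le> ennreal (c / 4 * exp (l * t))"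
  using assms unfolding contracting_def by blast

lemma kernel_integral_contraction: "\<exists>l. contracting l"
proof -
  obtain L where L: "0 < L" "\<And>t s x y. 0 \<le> s \<Longrightarrow> s < t \<Longrightarrow> t \<le> T \<Longrightarrow>
      (sem_kernel h t s x - sem_kernel h t s y)\<^sup>2 \<le> L * (x - y)\<^sup>2 * (t - s) powr (\<eta> - 1)"
    using sem_kernel_Lipschitz by blast
  \<comment> \<open>The weighted kernel has to beat the factor 16 of the quasi-isometry and the Lipschitz
    constant \<open>L\<close>.\<close>
  have "0 < 1 / (64 * L)" using L(1) by simp
  then obtain l where l: "0 < l" "\<And>t. 0 \<le> t \<Longrightarrow> t \<le> T \<Longrightarrow>
    (\<integral>\<^sup>+s\<in>{0..<t}. ennreal ((t - s) powr (\<eta> - 1) * exp (l * s)) \<partial>lborel) \<le>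
        ennreal (1 / (64 * L) * exp (l * t))"
    using weighted_kernel_small[OF \<eta>(1) less_imp_le[OF T_pos]] by blast
  show ?thesis
    unfolding contracting_def
  proof (intro exI[of _ l] conjI allI impI, rule l(1), elim conjE)
    fix Y Z c t I J
    assume Y: "admissible Y" and Z: "admissible Z" and c: "0 \<le> c" and t: "0 \<le> t" "t \<le> T"
      and "\<forall>s. 0 \<le> s \<longrightarrow> s < t \<longrightarrow> ms_dist M (Y s) (Z s) \<le> ennreal (c * exp (l * s))"
      and I: "has_ito_integral M F B t (kernel Y t) I" and J: "has_ito_integral M F B t (kernel Z t) J"
    then have D: "\<And>s. 0 \<le> s \<Longrightarrow> s < t \<Longrightarrow> ms_dist M (Y s) (Z s) \<le> ennreal (c * exp (l * s))" by blast
    have pt: "ms_dist M (kernel Y t s) (kernel Z t s) \<le>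
        ennreal (L * c) * ennreal ((t - s) powr (\<eta> - 1) * exp (l * s))" if s: "0 \<le> s" "s < t" for s
    proof -
      have [measurable]: "Y s \<in> borel_measurable M" "Z s \<in> borel_measurable M"
        using admissible_measurable(2)[OF Y, of s] admissible_measurable(2)[OF Z, of s] s t by auto
      let ?k = "L * (t - s) powr (\<eta> - 1)"
      have k: "0 \<le> ?k" using L(1) by simp
      have "ms_dist M (kernel Y t s) (kernel Z t s) \<le>
          (\<integral>\<^sup>+\<omega>. ennreal ?k * ennreal ((Y s \<omega> - Z s \<omega>)\<^sup>2) \<partial>M)"
      proof (intro nn_integral_mono)
        fix \<omega>
        have "(kernel Y t s \<omega> - kernel Z t s \<omega>)\<^sup>2 \<le> ?k * (Y s \<omega> - Z s \<omega>)\<^sup>2"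
          using L(2)[OF s t(2), of "Y s \<omega>" "Z s \<omega>"] by (simp only: ac_simps)
        then show "ennreal ((kernel Y t s \<omega> - kernel Z t s \<omega>)\<^sup>2) \<le>
            ennreal ?k * ennreal ((Y s \<omega> - Z s \<omega>)\<^sup>2)"
          using k by (simp add: ennreal_leI flip: ennreal_mult')
      qed
      also have "\<dots> = ennreal ?k * ms_dist M (Y s) (Z s)"
        by (rule nn_integral_cmult) measurable
      also have "\<dots> \<le> ennreal ?k * ennreal (c * exp (l * s))"
        by (intro mult_left_mono D s) simp
      also have "\<dots> = ennreal (?k * (c * exp (l * s)))"
        using k by (rule ennreal_mult'[symmetric])
      also have "?k * (c * exp (l * s)) = (L * c) * ((t - s) powr (\<eta> - 1) * exp (l * s))"
        by (simp only: ac_simps)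
      also have "ennreal \<dots> = ennreal (L * c) * ennreal ((t - s) powr (\<eta> - 1) * exp (l * s))"
        using L(1) c by (intro ennreal_mult') simp
      finally show ?thesis .
    qed
    have "sq_dist M t (kernel Y t) (kernel Z t) =
        (\<integral>\<^sup>+s\<in>{0..t}. ms_dist M (kernel Y t s) (kernel Z t s) \<partial>lborel)"
      by (rule sq_dist_Fubini[OF kernel_measurable[OF Y t] kernel_measurable[OF Z t]])
    also have "\<dots> \<le> (\<integral>\<^sup>+s. ennreal (L * c) * (ennreal ((t - s) powr (\<eta> - 1) * exp (l * s)) * indicator {0..<t} s) \<partial>lborel)"
    proof (rule nn_integral_mono_AE)
      have "AE s in lborel. s \<noteq> t" by (rule AE_lborel_singleton)
      then show "AE s in lborel. ms_dist M (kernel Y t s) (kernel Z t s) * indicator {0..t} s \<le>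
          ennreal (L * c) * (ennreal ((t - s) powr (\<eta> - 1) * exp (l * s)) * indicator {0..<t} s)"
      proof eventually_elim
        case (elim s)
        show ?case
        proof (cases "0 \<le> s \<and> s < t")
          case True
          then show ?thesis using pt[of s] by simp
        qed (use elim in auto)
      qed
    qed
    also have "\<dots> = ennreal (L * c) * (\<integral>\<^sup>+s\<in>{0..<t}. ennreal ((t - s) powr (\<eta> - 1) * exp (l * s)) \<partial>lborel)"
      by (rule nn_integral_cmult) measurable
    also have "\<dots> \<le> ennreal (L * c) * ennreal (1 / (64 * L) * exp (l * t))"
      by (intro mult_left_mono l t) simp
    also have "\<dots> = ennreal (L * c * (1 / (64 * L) * exp (l * t)))"
      using L(1) c by (intro ennreal_mult'[symmetric]) simp
    also have "L * c * (1 / (64 * L) * exp (l * t)) = c / 64 * exp (l * t)" using L(1) by simp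
    finally have sq: "sq_dist M t (kernel Y t) (kernel Z t) \<le> ennreal (c / 64 * exp (l * t))" .
    have "ms_dist M I J \<le> ennreal 16 * sq_dist M t (kernel Y t) (kernel Z t)"
      using has_ito_integral_square_dist[OF I J t] by simp
    also have "\<dots> \<le> ennreal 16 * ennreal (c / 64 * exp (l * t))" by (intro mult_left_mono sq) simp
    also have "\<dots> = ennreal (16 * (c / 64 * exp (l * t)))" by (rule ennreal_mult'[symmetric]) simp
    finally show "ms_dist M I J \<le> ennreal (c / 4 * exp (l * t))" by simp
  qed
qed

lemma moment_bound_nonneg: "0 \<le> moment_bound p" by (simp add: moment_bound_def)

lemma kernel_integral_second_moment:
  assumes Z: "admissible Z" and t: "0 \<le> t" "t \<le> T" and I: "has_ito_integral M F B t (kernel Z t) I"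
  shows "(\<integral>\<^sup>+\<omega>. ennreal ((I \<omega>)\<^sup>2) \<partial>M) \<le> ennreal (moment_bound 2)"
proof -
  obtain J where J: "has_ito_integral M F B t (kernel Z t) J" "\<forall>p>0. abs_moment M p J \<le>
      ennreal (moment_bound p)"
    using kernel_integral[OF Z t] by blast
  have "abs_moment M 2 I = abs_moment M 2 J"
    by (rule abs_moment_cong_AE[OF has_ito_integral_AE_unique[OF I J(1) t]])
  moreover have "abs_moment M 2 I = (\<integral>\<^sup>+\<omega>. ennreal ((I \<omega>)\<^sup>2) \<partial>M)"
    unfolding abs_moment_def by (intro nn_integral_cong) (simp add: powr_numeral)
  ultimately show ?thesis using J(2) by simp
qed

lemma sem_solutionD:
  assumes X: "sem_solution M T F B h g X"
  shows "admissible X"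
    and "\<And>t. 0 \<le> t \<Longrightarrow> t \<le> T \<Longrightarrow> has_ito_integral M F B t (kernel X t) (ito_integral M F B t (kernel X t))"
    and "\<And>t. 0 \<le> t \<Longrightarrow> t \<le> T \<Longrightarrow> AE \<omega> in M. X t \<omega> = g t \<omega> + ito_integral M F B t (kernel X t) \<omega>"
proof -
  show "admissible X" using X unfolding sem_solution_def admissible_def by blast
  fix t assume t: "0 \<le> t" "t \<le> T"
  then have "ito_integrable M F B t (kernel X t)" using X unfolding sem_solution_def by simp
  then show "has_ito_integral M F B t (kernel X t) (ito_integral M F B t (kernel X t))"
    unfolding ito_integrable_def ito_integral_def by (rule someI_ex)
  show "AE \<omega> in M. X t \<omega> = g t \<omega> + ito_integral M F B t (kernel X t) \<omega>"
    using X t unfolding sem_solution_def by simp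
qed

text \<open>The process \<open>g\<close> cancels in the difference of two solutions. What remains is a difference of
  integrals, whose second moments are bounded a priori, so that the contraction can be iterated.\<close>

lemma sem_solution_unique:
  assumes X: "sem_solution M T F B h g X" and Y: "sem_solution M T F B h g Y" and t: "0 \<le> t" "t \<le> T"
  shows "AE \<omega> in M. Y t \<omega> = X t \<omega>"
proof -
  obtain l where "contracting l" using kernel_integral_contraction by blast
  note l = contracting_pos[OF this] contractingD[OF this]
  note aX = sem_solutionD(1)[OF X] and aY = sem_solutionD(1)[OF Y]
  note iX = sem_solutionD(2)[OF X] and iY = sem_solutionD(2)[OF Y]
  have red: "ms_dist M (Y t) (X t) = (\<integral>\<^sup>+\<omega>. ennreal
      ((ito_integral M F B t (kernel Y t) \<omega> - ito_integral M F B t (kernel X t) \<omega>)\<^sup>2) \<partial>M)"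
    if "0 \<le> t" "t \<le> T" for t
  proof (rule nn_integral_cong_AE)
    show "AE \<omega> in M. ennreal ((Y t \<omega> - X t \<omega>)\<^sup>2) = ennreal
      ((ito_integral M F B t (kernel Y t) \<omega> - ito_integral M F B t (kernel X t) \<omega>)\<^sup>2)"
      using sem_solutionD(3)[OF X that] sem_solutionD(3)[OF Y that] by eventually_elim simp
  qed
  let ?c = "4 * moment_bound 2"
  have c0: "0 \<le> ?c" using moment_bound_nonneg by simp
  have decay: "ms_dist M (Y t) (X t) \<le> ennreal (?c / 4 ^ n * exp (l * t))"
    if "0 \<le> t" "t \<le> T" for n t
    using that
  proof (induction n arbitrary: t)
    case 0
    have [measurable]: "ito_integral M F B t (kernel Y t) \<in> borel_measurable M"
      "ito_integral M F B t (kernel X t) \<in> borel_measurable M"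
      using iX[OF 0] iY[OF 0] unfolding has_ito_integral_def by blast+
    have "ms_dist M (Y t) (X t) \<le>
       2 * ((\<integral>\<^sup>+\<omega>. ennreal ((ito_integral M F B t (kernel Y t) \<omega> - 0)\<^sup>2) \<partial>M) +
         (\<integral>\<^sup>+\<omega>. ennreal ((0 - ito_integral M F B t (kernel X t) \<omega>)\<^sup>2) \<partial>M))"
      unfolding red[OF 0] by (rule nn_integral_square_triangle) measurable
    also have "\<dots> \<le> ennreal 2 * (ennreal (moment_bound 2) + ennreal (moment_bound 2))"
      using kernel_integral_second_moment[OF aX 0 iX[OF 0]] kernel_integral_second_moment[OF aY 0 iY[OF 0]]
      by (intro mult_mono add_mono) auto
    also have "\<dots> = ennreal ?c"
      using moment_bound_nonneg
      by (simp flip: ennreal_plus ennreal_mult' del: ennreal_numeral distrib_left_numeral)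
    also have "\<dots> \<le> ennreal (?c / 4 ^ 0 * exp (l * t))"
    proof (intro ennreal_leI)
      have "?c * 1 \<le> ?c * exp (l * t)" using c0 l(1) 0 by (intro mult_left_mono) auto
      then show "?c \<le> ?c / 4 ^ 0 * exp (l * t)" by simp
    qed
    finally show ?case .
  next
    case (Suc n)
    have "ms_dist M (Y t) (X t) \<le> ennreal (?c / 4 ^ n / 4 * exp (l * t))"
      unfolding red[OF Suc.prems]
    proof (rule l(2)[OF aY aX _ Suc.prems _ iY[OF Suc.prems] iX[OF Suc.prems]])
      show "0 \<le> ?c / 4 ^ n" using c0 by simp
    qed (use Suc in auto)
    then show ?case by (simp add: mult.commute)
  qed
  have "ms_dist M (Y t) (X t) \<le> ennreal ((?c * exp (l * t)) / 4 ^ n)" for n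
    using decay[OF t, of n] by (simp only: times_divide_eq_left)
  then have "ms_dist M (Y t) (X t) = 0" by (rule ennreal_zero_of_le_geometric)
  then show ?thesis
    by (intro AE_eq_if_square_dist_zero admissible_measurable(2) aX aY t)
qed

end

lemma abs_moment_add:
  assumes [measurable]: "I \<in> borel_measurable N" "J \<in> borel_measurable N" and p: "0 \<le> p"
  shows "abs_moment N p (\<lambda>\<omega>. I \<omega> + J \<omega>) \<le> ennreal (2 powr p) * (abs_moment N p I + abs_moment N p J)"
proof -
  have le: "\<bar>a + b\<bar> powr p \<le> 2 powr p * (\<bar>a\<bar> powr p + \<bar>b\<bar> powr p)" for a b :: real
  proof -
    have "\<bar>a + b\<bar> powr p \<le> (2 * max \<bar>a\<bar> \<bar>b\<bar>) powr p" using p by (intro powr_mono2) auto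
    also have "\<dots> = 2 powr p * max \<bar>a\<bar> \<bar>b\<bar> powr p" by (rule powr_mult)
    also have "\<dots> \<le> 2 powr p * (\<bar>a\<bar> powr p + \<bar>b\<bar> powr p)"
      by (intro mult_left_mono) (auto simp: max_def)
    finally show ?thesis .
  qed
  have "abs_moment N p (\<lambda>\<omega>. I \<omega> + J \<omega>) \<le>
      (\<integral>\<^sup>+\<omega>. ennreal (2 powr p) * (ennreal (\<bar>I \<omega>\<bar> powr p) + ennreal (\<bar>J \<omega>\<bar> powr p)) \<partial>N)"
    unfolding abs_moment_def
  proof (rule nn_integral_mono)
    fix \<omega>
    have "ennreal (\<bar>I \<omega> + J \<omega>\<bar> powr p) \<le> ennreal (2 powr p * (\<bar>I \<omega>\<bar> powr p + \<bar>J \<omega>\<bar> powr p))"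
      by (rule ennreal_leI[OF le])
    also have "\<dots> = ennreal (2 powr p) * (ennreal (\<bar>I \<omega>\<bar> powr p) + ennreal (\<bar>J \<omega>\<bar> powr p))"
      by (subst ennreal_mult') auto
    finally show "ennreal (\<bar>I \<omega> + J \<omega>\<bar> powr p) \<le>
        ennreal (2 powr p) * (ennreal (\<bar>I \<omega>\<bar> powr p) + ennreal (\<bar>J \<omega>\<bar> powr p))" .
  qed
  also have "\<dots> = ennreal (2 powr p) * (abs_moment N p I + abs_moment N p J)"
    unfolding abs_moment_def by (subst nn_integral_cmult, measurable, subst nn_integral_add) auto
  finally show ?thesis .
qed

context sem_equation
begin

text \<open>Picard iteration started at \<open>g\<close>. The increments of the iteration decay like \<open>1 / 4 ^ n\<close> at
  each time, so the pointwise limit of the iterates exists almost surely and is admissible.\<close>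

lemma sem_solution_exists:
  assumes g: "admissible g"
  shows "\<exists>X. sem_solution M T F B h g X \<and> (\<forall>p>0. \<forall>t\<in>{0..T}.
    abs_moment M p (X t) \<le> ennreal (2 powr p) * (abs_moment M p (g t) + ennreal (moment_bound p)))"
proof -
  obtain l where "contracting l" using kernel_integral_contraction by blast
  note l = contracting_pos[OF this] contractingD[OF this]
  have "\<forall>Z. \<exists>J. admissible Z \<longrightarrow> admissible J \<and> (\<forall>t\<in>{0..T}. has_ito_integral M F B t (kernel Z t) (J t) \<and>
    (\<forall>p>0. abs_moment M p (J t) \<le> ennreal (moment_bound p)))"
    using stochastic_convolution by blast
  from choice[OF this] obtain \<Phi> where "\<forall>Z. admissible Z \<longrightarrow> admissible (\<Phi> Z) \<and>
      (\<forall>t\<in>{0..T}. has_ito_integral M F B t (kernel Z t) (\<Phi> Z t) \<and>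
    (\<forall>p>0. abs_moment M p (\<Phi> Z t) \<le> ennreal (moment_bound p)))" by blast
  then have \<Phi>: "\<And>Z. admissible Z \<Longrightarrow> admissible (\<Phi> Z)"
    and \<Phi>i: "\<And>Z t. admissible Z \<Longrightarrow> 0 \<le> t \<Longrightarrow> t \<le> T \<Longrightarrow> has_ito_integral M F B t (kernel Z t) (\<Phi> Z t)"
    and \<Phi>p: "\<And>Z t p. admissible Z \<Longrightarrow> 0 \<le> t \<Longrightarrow> t \<le> T \<Longrightarrow> 0 < p \<Longrightarrow> abs_moment M p (\<Phi> Z t) \<le>
        ennreal (moment_bound p)"
    by simp_all
  define X where "X = rec_nat g (\<lambda>_ Z t \<omega>. g t \<omega> + \<Phi> Z t \<omega>)"
  have X0: "X 0 = g" and XS: "X (Suc n) = (\<lambda>t \<omega>. g t \<omega> + \<Phi> (X n) t \<omega>)" for n by (simp_all add: X_def)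
  have aX: "admissible (X n)" for n
    by (induction n) (simp_all only: X0 XS g admissible_add \<Phi>)
  let ?c = "moment_bound 2"
  have c0: "0 \<le> ?c" by (rule moment_bound_nonneg)
  have step: "ms_dist M (X (Suc n) t) (X n t) \<le> ennreal (?c / 4 ^ n * exp (l * t))"
    if "0 \<le> t" "t \<le> T" for n t
    using that
  proof (induction n arbitrary: t)
    case 0
    have "ms_dist M (X (Suc 0) t) (X 0 t) = (\<integral>\<^sup>+\<omega>. ennreal ((\<Phi> g t \<omega>)\<^sup>2) \<partial>M)"
      by (simp add: X0 XS)
    also have "\<dots> \<le> ennreal ?c" by (rule kernel_integral_second_moment[OF g 0 \<Phi>i[OF g 0]])
    also have "\<dots> \<le> ennreal (?c / 4 ^ 0 * exp (l * t))"
    proof (intro ennreal_leI)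
      have "?c * 1 \<le> ?c * exp (l * t)" using c0 l(1) 0 by (intro mult_left_mono) auto
      then show "?c \<le> ?c / 4 ^ 0 * exp (l * t)" by simp
    qed
    finally show ?case .
  next
    case (Suc n)
    have "ms_dist M (X (Suc (Suc n)) t) (X (Suc n) t) =
      ms_dist M (\<Phi> (X (Suc n)) t) (\<Phi> (X n) t)"
      by (simp add: XS[of "Suc n"] XS[of n])
    also have "\<dots> \<le> ennreal (?c / 4 ^ n / 4 * exp (l * t))"
    proof (rule l(2)[OF aX aX _ Suc.prems _ \<Phi>i[OF aX Suc.prems] \<Phi>i[OF aX Suc.prems]])
      show "0 \<le> ?c / 4 ^ n" using c0 by simp
    qed (use Suc in auto)
    finally show ?case by (simp add: mult.commute)
  qed
  define Y where "Y = (\<lambda>t \<omega>. lim (\<lambda>n. X n t \<omega>))"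
  have aY: "admissible Y" unfolding Y_def by (rule admissible_lim[OF aX])
  have dist: "ms_dist M (Y t) (X n t) \<le> ennreal (4 * ?c / 4 ^ n * exp (l * t))"
    if t: "0 \<le> t" "t \<le> T" for n t
  proof -
    have "0 \<le> ?c * exp (l * t)" using c0 by simp
    then have "ms_dist M (Y t) (X n t) \<le> ennreal (4 * (?c * exp (l * t)) / 4 ^ n)"
      unfolding Y_def
      by (rule lim_square_dist_of_fast_Cauchy[OF admissible_measurable(2)[OF aX t]])
        (use step[OF t] in \<open>simp only: times_divide_eq_left\<close>)
    then show ?thesis by (simp only: times_divide_eq_left mult.assoc)
  qed
  have solves: "AE \<omega> in M. Y t \<omega> = g t \<omega> + \<Phi> Y t \<omega>" if t: "0 \<le> t" "t \<le> T" for t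
  proof (rule AE_eq_if_square_dist_zero)
    have [measurable]: "X n t \<in> borel_measurable M" for n using admissible_measurable(2)[OF aX t] .
    show [measurable]: "Y t \<in> borel_measurable M" using admissible_measurable(2)[OF aY t] .
    have [measurable]: "g t \<in> borel_measurable M" "\<Phi> Y t \<in> borel_measurable M"
      using admissible_measurable(2)[OF g t] admissible_measurable(2)[OF \<Phi>[OF aY] t] .
    show "(\<lambda>\<omega>. g t \<omega> + \<Phi> Y t \<omega>) \<in> borel_measurable M" by measurable
    let ?e = "exp (l * t)"
    have "(\<integral>\<^sup>+\<omega>. ennreal ((Y t \<omega> - (g t \<omega> + \<Phi> Y t \<omega>))\<^sup>2) \<partial>M) \<le> ennreal (4 * ?c * ?e / 4 ^ n)" for n
    proof -
      have 2: "ms_dist M (\<Phi> (X n) t) (\<Phi> Y t) \<le> ennreal (4 * ?c / 4 ^ n / 4 * ?e)"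
      proof (rule l(2)[OF aX aY _ t _ \<Phi>i[OF aX t] \<Phi>i[OF aY t]])
        show "0 \<le> 4 * ?c / 4 ^ n" using c0 by simp
        fix s assume "0 \<le> s" "s < t"
        then show "ms_dist M (X n s) (Y s) \<le> ennreal (4 * ?c / 4 ^ n * exp (l * s))"
          using dist[of s n] t by (simp add: power2_commute)
      qed
      have "(\<integral>\<^sup>+\<omega>. ennreal ((Y t \<omega> - (g t \<omega> + \<Phi> Y t \<omega>))\<^sup>2) \<partial>M) \<le>
         2 * (ms_dist M (Y t) (X (Suc n) t) +
              (\<integral>\<^sup>+\<omega>. ennreal ((X (Suc n) t \<omega> - (g t \<omega> + \<Phi> Y t \<omega>))\<^sup>2) \<partial>M))"
        by (rule nn_integral_square_triangle) measurable
      also have "(\<integral>\<^sup>+\<omega>. ennreal ((X (Suc n) t \<omega> - (g t \<omega> + \<Phi> Y t \<omega>))\<^sup>2) \<partial>M) =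
          ms_dist M (\<Phi> (X n) t) (\<Phi> Y t)"
        by (simp add: XS)
      also have "2 * (ms_dist M (Y t) (X (Suc n) t) + \<dots>) \<le>
          ennreal 2 * (ennreal (4 * ?c / 4 ^ Suc n * ?e) + ennreal (4 * ?c / 4 ^ n / 4 * ?e))"
        using dist[OF t, of "Suc n"] 2 by (intro mult_mono add_mono) auto
      also have "\<dots> = ennreal (2 * (4 * ?c / 4 ^ Suc n * ?e + 4 * ?c / 4 ^ n / 4 * ?e))"
        using c0 by (simp flip: ennreal_plus ennreal_mult' del: ennreal_numeral distrib_left_numeral)
      also have "2 * (4 * ?c / 4 ^ Suc n * ?e + 4 * ?c / 4 ^ n / 4 * ?e) = 4 * ?c * ?e / 4 ^ n"
        by (simp add: field_simps)
      finally show ?thesis .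
    qed
    then show "(\<integral>\<^sup>+\<omega>. ennreal ((Y t \<omega> - (g t \<omega> + \<Phi> Y t \<omega>))\<^sup>2) \<partial>M) = 0"
      by (rule ennreal_zero_of_le_geometric)
  qed
  have "sem_solution M T F B h g Y"
    unfolding sem_solution_def
  proof (intro conjI ballI)
    show "measurable_process M T Y" "adapted_process F T Y" using aY unfolding admissible_def by blast+
    fix t assume "t \<in> {0..T}"
    then have t: "0 \<le> t" "t \<le> T" by auto
    show int: "ito_integrable M F B t (kernel Y t)"
      unfolding ito_integrable_def using \<Phi>i[OF aY t] by blast
    have "has_ito_integral M F B t (kernel Y t) (ito_integral M F B t (kernel Y t))"
      using int unfolding ito_integrable_def ito_integral_def by (rule someI_ex)
    from has_ito_integral_AE_unique[OF \<Phi>i[OF aY t] this t] solves[OF t]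
    show "AE \<omega> in M. Y t \<omega> = g t \<omega> + ito_integral M F B t (kernel Y t) \<omega>"
      by eventually_elim simp
  qed
  moreover have "abs_moment M p (Y t) \<le> ennreal (2 powr p) * (abs_moment M p (g t) +
      ennreal (moment_bound p))"
    if p: "0 < p" and t: "0 \<le> t" "t \<le> T" for p t
  proof -
    have "abs_moment M p (Y t) = abs_moment M p (\<lambda>\<omega>. g t \<omega> + \<Phi> Y t \<omega>)"
      by (rule abs_moment_cong_AE[OF solves[OF t]])
    also have "\<dots> \<le> ennreal (2 powr p) * (abs_moment M p (g t) + abs_moment M p (\<Phi> Y t))"
      by (intro abs_moment_add admissible_measurable(2) g \<Phi> aY t) (use p in simp)
    also have "\<dots> \<le> ennreal (2 powr p) * (abs_moment M p (g t) + ennreal (moment_bound p))"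
      by (intro mult_left_mono add_left_mono \<Phi>p aY t p) simp
    finally show ?thesis .
  qed
  ultimately show ?thesis by (intro exI[of _ Y]) auto
qed

end

theorem theorem5:
  fixes T p hl :: real and k1 :: "real \<Rightarrow> real \<Rightarrow> real"
  assumes "T > 0" and "p \<ge> 2" and "volterra_K0 T k1"
  shows "\<exists>C::real. C > 0 \<and>
    (\<forall>(M :: 'a measure) F B h hu k2 g.
       filtered_prob_space M T F \<and>
       brownian_motion M T F B \<and>
       hurst_function T hl hu h \<and>
       volterra_K0 T k2 \<and>
       (\<forall>t s x. 0 \<le> s \<and> s < t \<and> t \<le> T \<longrightarrow>
          \<bar>sem_kernel h t s x\<bar>\<^sup>2 \<le> k1 t s * (1 + \<bar>x\<bar>\<^sup>2)) \<and>
       (\<forall>t s x y. 0 \<le> s \<and> s < t \<and> t \<le> T \<longrightarrow>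
          \<bar>sem_kernel h t s x - sem_kernel h t s y\<bar>\<^sup>2 \<le> k2 t s * \<bar>x - y\<bar>\<^sup>2) \<and>
       measurable_process M T g \<and>
       adapted_process F T g \<and>
       (SUP t\<in>{0..T}. \<integral>\<^sup>+s\<in>{0..<t}. ennreal (k1 t s + k2 t s) * abs_moment M p (g s) \<partial>lborel) < \<infinity>
       \<longrightarrow>
       (\<exists>X. sem_solution M T F B h g X \<and>
          (\<forall>Y. sem_solution M T F B h g Y \<longrightarrow> (\<forall>t\<in>{0..T}. AE \<omega> in M. Y t \<omega> = X t \<omega>)) \<and>
          (\<forall>t\<in>{0..T}. abs_moment M p (X t) \<le>
             ennreal C * (1 + abs_moment M p (g t) +
               (SUP u\<in>{0..T}. \<integral>\<^sup>+s\<in>{0..<u}.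
                  ennreal ((u - s) powr (hl - 1/2)) * abs_moment M p (g s) \<partial>lborel)))))"
proof -
  \<comment> \<open>The moment bound depends on \<open>T\<close>, \<open>hl\<close> and \<open>p\<close> only, so it can be named before the probability
    space is given. Its absolute value keeps the constant positive for every \<open>hl\<close>.\<close>
  let ?m = "sem_equation.moment_bound T hl p"
  let ?C = "2 powr p * (1 + \<bar>?m\<bar>)"
  show ?thesis
  proof (intro exI[of _ ?C] conjI allI impI, goal_cases)
    case 1
    show ?case by (intro mult_pos_pos add_pos_nonneg) auto
  next
    case (2 M F B h hu k2 g)
    then interpret sem_equation M T F B h hl hu
      unfolding sem_equation_def brownian_def sem_equation_axioms_def brownian_axioms_def
      using assms(1) by (simp add: filtered_prob_space_def)
    have "admissible g" using 2 unfolding admissible_def by blast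
    then obtain X where X: "sem_solution M T F B h g X"
      and mom: "\<And>p t. 0 < p \<Longrightarrow> t \<in> {0..T} \<Longrightarrow>
        abs_moment M p (X t) \<le> ennreal (2 powr p) * (abs_moment M p (g t) + ennreal (moment_bound p))"
      using sem_solution_exists by blast
    show ?case
    proof (intro exI[of _ X] conjI allI impI ballI)
      show "sem_solution M T F B h g X" by (rule X)
      show "AE \<omega> in M. Y t \<omega> = X t \<omega>" if "sem_solution M T F B h g Y" "t \<in> {0..T}" for Y t
        using sem_solution_unique[OF X that(1), of t] that(2) by simp
      fix t assume t: "t \<in> {0..T}"
      let ?S = "SUP u\<in>{0..T}. \<integral>\<^sup>+s\<in>{0..<u}. ennreal ((u - s) powr (hl - 1/2)) * abs_moment M p (g s) \<partial>lborel"
      have "0 < p" using assms(2) by simp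
      then have "abs_moment M p (X t) \<le> ennreal (2 powr p) * (abs_moment M p (g t) + ennreal ?m)"
        by (rule mom[OF _ t])
      also have "\<dots> \<le> ennreal (2 powr p) * (ennreal (1 + \<bar>?m\<bar>) * (1 + abs_moment M p (g t) + ?S))"
      proof (intro mult_left_mono)
        have "1 * abs_moment M p (g t) \<le> ennreal (1 + \<bar>?m\<bar>) * abs_moment M p (g t)"
          by (intro mult_right_mono) auto
        moreover have "ennreal ?m \<le> ennreal (1 + \<bar>?m\<bar>)" by (intro ennreal_leI) simp
        ultimately have "abs_moment M p (g t) + ennreal ?m \<le>
            ennreal (1 + \<bar>?m\<bar>) * abs_moment M p (g t) + ennreal (1 + \<bar>?m\<bar>) * 1"
          by (simp only: mult_1 mult_1_right add_mono)
        also have "\<dots> = ennreal (1 + \<bar>?m\<bar>) * (1 + abs_moment M p (g t))"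
          by (simp add: distrib_left add.commute)
        also have "\<dots> \<le> ennreal (1 + \<bar>?m\<bar>) * (1 + abs_moment M p (g t) + ?S)"
          by (intro mult_left_mono) auto
        finally show "abs_moment M p (g t) + ennreal ?m \<le> ennreal (1 + \<bar>?m\<bar>) * (1 +
            abs_moment M p (g t) + ?S)" .
      qed simp
      also have "\<dots> = ennreal ?C * (1 + abs_moment M p (g t) + ?S)"
        by (simp only: ennreal_mult'[OF powr_ge_zero] mult.assoc)
      finally show "abs_moment M p (X t) \<le> ennreal ?C * (1 + abs_moment M p (g t) + ?S)" .
    qed
  qed
qed

end
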